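(* Let $m,n\ge 1$ be integers with $N=m+n\ge 3$, let $p_0=\max(N/(m+1),1)$, and let $\psi\in G\Psi(p_0,N)$. Define $$\zeta_\psi(q)=K_{m,n}\!\left(\frac{Nq}{m+q}\right)\cdot\psi\!\left(\frac{Nq}{m+q}\right),\qquad q\in(1,\infty).$$ Then for every radial function $u\in\operatorname{Rad}(\mathbb{R}^N)\cap\bigcap_{p\in(p_0,N)}W^1_p(\mathbb{R}^N)$ with $\|\nabla u\|G(\psi)<\infty$, $$\|S[u]\|G(\zeta_\psi)\le 1\cdot\|\nabla u\|G(\psi).$$ Moreover, the constant $1$ in this inequality is best possible, in the sense that $$\sup_{m,n}\ \sup_{\psi\in G\Psi(p_0,N)}\ \sup_{u}\ \frac{\|S[u]\|G(\zeta_\psi)}{\|\nabla u\|G(\psi)}=1,$$ where the outer supremum is over all integers $m,n\ge1$ with $N=m+n\ge3$, and the innermost supremum is over all $u\in\operatorname{Rad}(\mathbb{R}^N)\cap\bigcap_{p\in(p_0,N)}W^1_p(\mathbb{R}^N)$ with $\nabla u\ne0$ and $\|\nabla u\|G(\psi)<\infty$.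
   Context: Points of $\mathbb{R}^N=\mathbb{R}^{m+n}$ are written $z=(x,y)$ with $x\in\mathbb{R}^m$, $y\in\mathbb{R}^n$, and $|z|=(|x|^2+|y|^2)^{1/2}$ with Euclidean norms. $\operatorname{Rad}(\mathbb{R}^N)$ is the class of radial functions, i.e. functions $u(x,y)$ depending only on $|z|$. For $k\ge1$ and measurable $f$ on $\mathbb{R}^k$, $|f|_{p,k}=\left(\int_{\mathbb{R}^k}|f|^p\right)^{1/p}$. The Sobolev space $W^1_p(\mathbb{R}^N)$ is the closure of the compactly supported continuously differentiable functions on $\mathbb{R}^N$ in the norm $|f|_{p,N}+|\nabla f|_{p,N}$. Here $\nabla u=(\operatorname{grad}_x u,\operatorname{grad}_y u)$ and $$|\nabla u|_{p,N}=\left(|\operatorname{grad}_x u|_{p,N}^p+|\operatorname{grad}_y u|_{p,N}^p\right)^{1/p},$$ where $|\operatorname{grad}_x u|_{p,N}$ and $|\operatorname{grad}_y u|_{p,N}$ are the $L_p(\mathbb{R}^N)$ norms of the Euclidean lengths of the partial gradients. The trace operator is $S[u](x)=u(x,0)$, $x\in\mathbb{R}^m$ (for a radial Sobolev function, use the representative continuous on $\mathbb{R}^N\setminus\{0\}$). For $p\in[1,N)$ put $q(p)=mp/(N-p)$; $K_{m,n}(p)$ is the minimal constant in the Sobolev trace inequality for radial functions: $$K_{m,n}(p)=\sup\left\{\frac{|S[u]|_{q(p),m}}{|\nabla u|_{p,N}}:\ u\in W^1_p(\mathbb{R}^N)\cap\operatorname{Rad}(\mathbb{R}^N),\ \nabla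 u\neq0\right\}.$$ If this supremum is $+\infty$ for some $p$, then $\zeta_\psi=+\infty$ at the corresponding $q$, and quotients with denominator $+\infty$ are taken to be $0$. The map $q\mapsto p=Nq/(m+q)$ is the inverse of $p\mapsto q(p)$ and maps $(1,\infty)$ onto $(p_0,N)$. For $1\le A<B\le\infty$, $G\Psi(A,B)$ is the set of continuous positive functions $\psi$ on the open interval $(A,B)$ with $\inf_{(A,B)}\psi>0$ and $\sup_{(A,B)}\psi=\infty$. Grand Lebesgue norms: $\|\nabla u\|G(\psi)=\sup_{p\in(p_0,N)}|\nabla u|_{p,N}/\psi(p)$ and $\|S[u]\|G(\zeta_\psi)=\sup_{q\in(1,\infty)}|S[u]|_{q,m}/\zeta_\psi(q)$. *)

theory Defs
  imports "HOL-Analysis.Analysis"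
begin

text \<open>
  The dimensions vary inside the statement, so the Euclidean space of dimension \<open>k\<close> is the set of
  extensional functions on \<open>{..<k}\<close>.  Its topology is the one induced by the product topology on
  \<^typ>\<open>nat \<Rightarrow> real\<close>, its measure the product of the one-dimensional Lebesgue measures, and its
  norm \<^term>\<open>\<lambda>z. L2_set z {..<k}\<close>.
  A point \<open>z = (x, y)\<close> of the space of dimension \<open>m + n\<close> has the coordinates of \<open>x\<close> at the indices
  \<open>i < m\<close> and those of \<open>y\<close> at the indices \<open>m \<le> i < m + n\<close>.
  Functions on it are considered on these extensional points only.
\<close>

type_synonym vec = "nat \<Rightarrow> real"

definition Rn :: "nat \<Rightarrow> vec set" where
  "Rn k = (\<Pi>\<^sub>E i\<in>{..<k}. UNIV)"

definition leb :: "nat \<Rightarrow> vec measure" where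
  "leb k = (\<Pi>\<^sub>M i\<in>{..<k}. lborel)"

definition Rad :: "nat \<Rightarrow> (vec \<Rightarrow> real) set" where
  "Rad N = {u. \<exists>g. \<forall>z\<in>Rn N. u z = g (L2_set z {..<N})}"

text \<open>Real powers of extended nonnegative reals, used for exponents \<open>r > 0\<close> only.\<close>

definition epowr :: "ennreal \<Rightarrow> real \<Rightarrow> ennreal" where
  "epowr x r = (if x = \<infinity> then \<infinity> else ennreal (enn2real x powr r))"

definition Lnorm :: "real \<Rightarrow> nat \<Rightarrow> (vec \<Rightarrow> real) \<Rightarrow> ennreal" where
  "Lnorm p k f = epowr (\<integral>\<^sup>+ x. ennreal (\<bar>f x\<bar> powr p) \<partial>leb k) (1 / p)"

definition partial :: "nat \<Rightarrow> (vec \<Rightarrow> real) \<Rightarrow> vec \<Rightarrow> real" where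
  "partial i f z = deriv (\<lambda>t. f (z(i := t))) (z i)"

definition Cc1 :: "nat \<Rightarrow> (vec \<Rightarrow> real) set" where
  "Cc1 N = {f. continuous_on (Rn N) f \<and>
     (\<forall>i<N. (\<forall>z\<in>Rn N. (\<lambda>t. f (z(i := t))) differentiable at (z i)) \<and>
            continuous_on (Rn N) (partial i f)) \<and>
     (\<exists>R. \<forall>z\<in>Rn N. R < L2_set z {..<N} \<longrightarrow> f z = 0)}"

definition loc_integrable :: "nat \<Rightarrow> (vec \<Rightarrow> real) \<Rightarrow> bool" where
  "loc_integrable N f \<longleftrightarrow>
     (\<forall>R. set_integrable (leb N) {z \<in> Rn N. L2_set z {..<N} \<le> R} f)"

text \<open>
  The gradient of a Sobolev function is its weak gradient, which does not depend on the exponent and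
  is unique up to null sets; for continuously differentiable functions it is the classical gradient,
  and for elements of the closure below it is the limit of the approximating gradients.
\<close>

definition has_weak_grad :: "nat \<Rightarrow> (vec \<Rightarrow> real) \<Rightarrow> (vec \<Rightarrow> vec) \<Rightarrow> bool" where
  "has_weak_grad N u g \<longleftrightarrow> loc_integrable N u \<and>
     (\<forall>i<N. loc_integrable N (\<lambda>z. g z i) \<and>
       (\<forall>\<phi>\<in>Cc1 N. (\<integral>z. u z * partial i \<phi> z \<partial>leb N) = - (\<integral>z. g z i * \<phi> z \<partial>leb N)))"

definition grad :: "nat \<Rightarrow> (vec \<Rightarrow> real) \<Rightarrow> vec \<Rightarrow> vec" where
  "grad N u = (SOME g. has_weak_grad N u g)"

definition grad_nonzero :: "nat \<Rightarrow> (vec \<Rightarrow> real) \<Rightarrow> bool" where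
  "grad_nonzero N u \<longleftrightarrow> \<not> (AE z in leb N. \<forall>i<N. grad N u z i = 0)"

definition grad_norm :: "nat \<Rightarrow> nat \<Rightarrow> real \<Rightarrow> (vec \<Rightarrow> real) \<Rightarrow> ennreal" where
  "grad_norm m n p u =
     epowr (epowr (Lnorm p (m + n) (\<lambda>z. L2_set (grad (m + n) u z) {..<m})) p +
            epowr (Lnorm p (m + n) (\<lambda>z. L2_set (grad (m + n) u z) {m..<m + n})) p) (1 / p)"

definition sobolev_norm :: "nat \<Rightarrow> nat \<Rightarrow> real \<Rightarrow> (vec \<Rightarrow> real) \<Rightarrow> ennreal" where
  "sobolev_norm m n p u = Lnorm p (m + n) u + grad_norm m n p u"

text \<open>The closure is taken in the weakly differentiable functions.\<close>

definition W1 :: "nat \<Rightarrow> nat \<Rightarrow> real \<Rightarrow> (vec \<Rightarrow> real) set" where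
  "W1 m n p = {u. (\<exists>g. has_weak_grad (m + n) u g) \<and>
     (\<forall>e>0. \<exists>\<phi>\<in>Cc1 (m + n). sobolev_norm m n p (\<lambda>z. u z - \<phi> z) < e)}"

definition origin :: "nat \<Rightarrow> vec" where
  "origin N = (\<lambda>i\<in>{..<N}. 0)"

text \<open>
  The representative continuous off the origin; it exists for radial Sobolev functions if
  \<open>N \<ge> 2\<close>, and is then unique on \<^term>\<open>Rn N - {origin N}\<close>.
\<close>

definition cont_rep :: "nat \<Rightarrow> (vec \<Rightarrow> real) \<Rightarrow> vec \<Rightarrow> real" where
  "cont_rep N u = (SOME v. continuous_on (Rn N - {origin N}) v \<and> (AE z in leb N. v z = u z))"

text \<open>
  The map \<open>x \<mapsto> u(x, 0)\<close>.  Its value at \<open>x = 0\<close> is unspecified, which is irrelevant for the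
  norms as a point is a null set for \<open>m \<ge> 1\<close>.
\<close>

definition trace_op :: "nat \<Rightarrow> nat \<Rightarrow> (vec \<Rightarrow> real) \<Rightarrow> vec \<Rightarrow> real" where
  "trace_op m n u x = cont_rep (m + n) u (\<lambda>i\<in>{..<m + n}. if i < m then x i else 0)"

definition q_of :: "nat \<Rightarrow> nat \<Rightarrow> real \<Rightarrow> real" where
  "q_of m n p = real m * p / (real (m + n) - p)"

definition p_of :: "nat \<Rightarrow> nat \<Rightarrow> real \<Rightarrow> real" where
  "p_of m n q = real (m + n) * q / (real m + q)"

definition p0 :: "nat \<Rightarrow> nat \<Rightarrow> real" where
  "p0 m n = max (real (m + n) / (real m + 1)) 1"

definition K :: "nat \<Rightarrow> nat \<Rightarrow> real \<Rightarrow> ennreal" where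
  "K m n p = (SUP u \<in> {u \<in> W1 m n p \<inter> Rad (m + n). grad_nonzero (m + n) u}.
     Lnorm (q_of m n p) m (trace_op m n u) / grad_norm m n p u)"

text \<open>Only finite right endpoints \<open>B\<close> are needed.\<close>

definition G\<Psi> :: "real \<Rightarrow> real \<Rightarrow> (real \<Rightarrow> real) set" where
  "G\<Psi> A B = {\<psi>. continuous_on {A<..<B} \<psi> \<and> (\<forall>p\<in>{A<..<B}. 0 < \<psi> p) \<and>
     (INF p\<in>{A<..<B}. ereal (\<psi> p)) > 0 \<and> (SUP p\<in>{A<..<B}. ereal (\<psi> p)) = \<infinity>}"

text \<open>
  The extended conventions are those of \<^typ>\<open>ennreal\<close>: a product of \<open>\<infinity>\<close> with a positive number
  is \<open>\<infinity>\<close>, and a quotient with denominator \<open>\<infinity>\<close> is \<open>0\<close>, also if its numerator is \<open>\<infinity>\<close>.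
\<close>

definition \<zeta> :: "nat \<Rightarrow> nat \<Rightarrow> (real \<Rightarrow> real) \<Rightarrow> real \<Rightarrow> ennreal" where
  "\<zeta> m n \<psi> q = K m n (p_of m n q) * ennreal (\<psi> (p_of m n q))"

definition grand_grad_norm :: "nat \<Rightarrow> nat \<Rightarrow> (real \<Rightarrow> real) \<Rightarrow> (vec \<Rightarrow> real) \<Rightarrow> ennreal" where
  "grand_grad_norm m n \<psi> u =
     (SUP p\<in>{p0 m n<..<real (m + n)}. grad_norm m n p u / ennreal (\<psi> p))"

definition grand_trace_norm :: "nat \<Rightarrow> nat \<Rightarrow> (real \<Rightarrow> real) \<Rightarrow> (vec \<Rightarrow> real) \<Rightarrow> ennreal" where
  "grand_trace_norm m n \<psi> u = (SUP q\<in>{1<..}. Lnorm q m (trace_op m n u) / \<zeta> m n \<psi> q)"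

definition radial_W :: "nat \<Rightarrow> nat \<Rightarrow> (vec \<Rightarrow> real) set" where
  "radial_W m n = Rad (m + n) \<inter> (\<Inter>p\<in>{p0 m n<..<real (m + n)}. W1 m n p)"

end

theory Submission
  imports Defs
begin

text \<open>
  The inequality holds by the definition of \<^const>\<open>K\<close>.  For \<open>q > 1\<close> the exponent \<open>p = p_of m n q\<close> lies in
  \<open>(p0, N)\<close> and \<open>q = q_of m n p\<close>, so the norm of the trace in \<open>L\<^sub>q\<close> is at most \<open>K m n p\<close> times
  \<open>grad_norm m n p u\<close>; division by \<open>\<zeta> m n \<psi> q = K m n p * \<psi> p\<close> leaves \<open>grad_norm m n p u / \<psi> p\<close>, which is one
  of the quotients in the norm of the gradient (\<open>grand_trace_le\<close>).  The supremum \<open>K m n p\<close> runs over functions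
  with nonzero gradient.  If it vanishes, a function with zero gradient must be known to have trace zero.
  It does, since the Hardy inequality forces it to vanish almost everywhere (\<open>W1_zero_grad\<close>).

  For the sharpness of the constant 1, one pair of dimensions and one exponent suffice: \<open>m = 1\<close>, \<open>n = 2\<close>,
  \<open>p = q = 2\<close>.  In polar coordinates, the trace inequality for a radial \<open>u = g(\<bar>z\<bar>)\<close> compares
  \<open>\<integral>g\<^sup>2 dr\<close> with \<open>\<integral>g'\<^sup>2 r\<^sup>2 dr\<close>; this is the Hardy inequality
  \<open>\<integral>u\<^sup>2/\<bar>z\<bar>\<^sup>2 \<le> 4 \<integral>\<bar>\<nabla>u\<bar>\<^sup>2\<close> in dimension three, restricted to radial functions.  The Hardy inequality
  (\<open>Hardy_W1\<close>) therefore bounds \<open>K 1 2 2\<close> from above, with the number \<open>4 vball 1 / (3 vball 3)\<close> for its square.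
  The functions \<open>\<bar>z\<bar>\<^bsup>-1/2\<^esup> h(ln \<bar>z\<bar> / T)\<close> with a fixed bump \<open>h\<close> and large \<open>T\<close> are continuously
  differentiable with compact support, and they come arbitrarily close to equality (\<open>Hardy_near_extremal\<close>).  Such
  a function \<open>u\<close> is admissible for all exponents at once.  Finally \<open>\<psi>\<close> is fitted to \<open>u\<close>: it lies above
  \<open>p \<mapsto> grad_norm 1 2 p u\<close>, touches it at \<open>p = 2\<close>, and blows up at \<open>p = 3\<close> (\<open>adapted_weight\<close>).  Then the norm
  of the gradient of \<open>u\<close> in the weighted scale is at most 1, and the quotient at \<open>q = 2\<close> shows that the norm
  of the trace is nearly 1.

  The remaining work concerns the objects themselves.  The gradient is a chosen weak gradient, so its uniqueness
  is needed: this is the fundamental lemma of the calculus of variations.  The trace is taken of a chosen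
  representative that is continuous off the origin.  For a radial function with a weak gradient such a
  representative is constructed by integrating the flux of the gradient through spheres
  (\<open>radial_continuous_representative\<close>), and it is unique because nonempty open sets have positive measure.
\<close>

section \<open>Continuity, measurability and integrability on the extensional Euclidean space\<close>

abbreviation nrm :: "nat \<Rightarrow> vec \<Rightarrow> real" where
  "nrm N z \<equiv> L2_set z {..<N}"

interpretation lborels: product_sigma_finite "\<lambda>_::nat. lborel :: real measure"
  by standard

lemma space_leb [simp]: "space (leb N) = Rn N"
  by (simp add: leb_def Rn_def space_PiM)

lemma sigma_finite_leb: "sigma_finite_measure (leb N)"
  unfolding leb_def by (rule lborels.sigma_finite) simp

lemma upd_in_Rn: "z \<in> Rn N \<Longrightarrow> i < N \<Longrightarrow> z(i := t) \<in> Rn N"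
  by (auto simp: Rn_def PiE_def extensional_def)

lemma continuous_on_coord: "continuous_on S (\<lambda>z::vec. z i)"
  by (rule continuous_on_product_then_coordinatewise[OF continuous_on_id])

lemma continuous_on_nrm: "continuous_on S (nrm N)"
  unfolding L2_set_def
  by (intro continuous_on_real_sqrt continuous_on_sum continuous_on_power continuous_on_coord)

lemma measurable_coord_leb: "i < N \<Longrightarrow> (\<lambda>z. z i) \<in> borel_measurable (leb N)"
  using measurable_component_singleton[of i "{..<N}" "\<lambda>_. lborel :: real measure"]
  by (simp add: leb_def)

lemma measurable_nrm [measurable]: "nrm N \<in> borel_measurable (leb N)"
proof -
  note [measurable] = measurable_coord_leb
  show ?thesis unfolding L2_set_def by measurable
qed

text \<open>
  The topology of \<^term>\<open>Rn N\<close> comes from all functions on the natural numbers, its sigma-algebra only from the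
  coordinates below \<open>N\<close>.  The two fit together because on \<^term>\<open>Rn N\<close> all other coordinates are constant.
\<close>

lemma borel_measurable_continuous_Rn:
  fixes f :: "vec \<Rightarrow> real"
  assumes "continuous_on (Rn N) f"
  shows "f \<in> borel_measurable (leb N)"
proof -
  have "(\<lambda>z::vec. z i) \<in> borel_measurable (leb N)" for i
  proof (cases "i < N")
    case False
    then have "z i = undefined" if "z \<in> space (leb N)" for z
      using that by (auto simp: Rn_def PiE_def extensional_def)
    then show ?thesis by (subst measurable_cong[where g="\<lambda>_. undefined"]) auto
  qed (rule measurable_coord_leb)
  then have "(\<lambda>z. z) \<in> borel_measurable (leb N)"
    by (rule measurable_coordinatewise_then_product)
  then have "(\<lambda>z. z) \<in> measurable (leb N) (restrict_space borel (Rn N))"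
    by (intro measurable_restrict_space2) auto
  from measurable_compose[OF this borel_measurable_continuous_on_restrict[OF assms]]
  show ?thesis .
qed

lemma coord_le_nrm: "i < N \<Longrightarrow> \<bar>z i\<bar> \<le> nrm N z"
  using member_le_L2_set[of "{..<N}" i "\<lambda>i. \<bar>z i\<bar>"] by (auto simp: L2_set_def)

lemma compact_cube: "compact {z \<in> Rn N. \<forall>i<N. \<bar>z i\<bar> \<le> R}"
proof -
  let ?X = "\<lambda>i. if i < N then {- R .. R} else {undefined :: real}"
  have "{z \<in> Rn N. \<forall>i<N. \<bar>z i\<bar> \<le> R} = Pi\<^sub>E UNIV ?X"
    by (auto simp: Rn_def PiE_iff extensional_def abs_le_iff split: if_splits) (metis minus_le_iff)+
  moreover have "compactin (product_topology (\<lambda>i. euclidean) UNIV) (Pi\<^sub>E UNIV ?X)"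
    by (subst compactin_PiE) (auto simp: compactin_euclidean_iff)
  ultimately show ?thesis
    by (simp add: euclidean_product_topology compactin_euclidean_iff)
qed

text \<open>The functions that may be paired with any locally integrable function.\<close>

definition bounded_support :: "nat \<Rightarrow> (vec \<Rightarrow> real) \<Rightarrow> bool" where
  "bounded_support N f \<longleftrightarrow> f \<in> borel_measurable (leb N) \<and> (\<exists>B. \<forall>z\<in>Rn N. \<bar>f z\<bar> \<le> B) \<and>
     (\<exists>R. \<forall>z\<in>Rn N. R < nrm N z \<longrightarrow> f z = 0)"

lemma continuous_bounded_support:
  assumes f: "continuous_on (Rn N) f" and R: "\<And>z. z \<in> Rn N \<Longrightarrow> R < nrm N z \<Longrightarrow> f z = 0"
  shows "bounded_support N f"
proof -
  let ?Q = "{z \<in> Rn N. \<forall>i<N. \<bar>z i\<bar> \<le> R}"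
  have "compact (f ` ?Q)"
    by (rule compact_continuous_image[OF continuous_on_subset[OF f] compact_cube]) auto
  then obtain B where B: "\<And>z. z \<in> ?Q \<Longrightarrow> \<bar>f z\<bar> \<le> B"
    by (meson bounded_real compact_imp_bounded image_eqI)
  have "\<bar>f z\<bar> \<le> max B 0" if "z \<in> Rn N" for z
  proof (cases "nrm N z \<le> R")
    case True
    then have "z \<in> ?Q" using that coord_le_nrm order_trans by blast
    from B[OF this] show ?thesis by simp
  qed (use R[OF that] in auto)
  then show ?thesis
    unfolding bounded_support_def using borel_measurable_continuous_Rn[OF f] R by blast
qed

lemma bounded_support_mult:
  assumes "bounded_support N f" "bounded_support N g"
  shows "bounded_support N (\<lambda>z. f z * g z)"
proof -
  obtain B C R where "\<And>z. z \<in> Rn N \<Longrightarrow> \<bar>f z\<bar> \<le> B" "\<And>z. z \<in> Rn N \<Longrightarrow> \<bar>g z\<bar> \<le> C"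
    and R: "\<And>z. z \<in> Rn N \<Longrightarrow> R < nrm N z \<Longrightarrow> f z = 0"
    using assms unfolding bounded_support_def by metis
  then have B: "\<bar>f z * g z\<bar> \<le> B * C" if "z \<in> Rn N" for z
    using that unfolding abs_mult by (intro mult_mono) (auto intro: order_trans[OF abs_ge_zero])
  have [measurable]: "f \<in> borel_measurable (leb N)" "g \<in> borel_measurable (leb N)"
    using assms by (auto simp: bounded_support_def)
  show ?thesis
    unfolding bounded_support_def using B R
    by (intro conjI exI[of _ "B * C"] exI[of _ R]) auto
qed

lemma emeasure_ball_finite: "emeasure (leb N) {z \<in> Rn N. nrm N z \<le> R} < \<infinity>"
proof -
  have "{z \<in> Rn N. nrm N z \<le> R} \<subseteq> (\<Pi>\<^sub>E i\<in>{..<N}. {-R..R})"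
  proof
    fix z assume z: "z \<in> {z \<in> Rn N. nrm N z \<le> R}"
    then have "\<bar>z i\<bar> \<le> R" if "i < N" for i
      using coord_le_nrm[OF that, of z] by auto
    then have "z i \<in> {-R..R}" if "i < N" for i
      using that by (metis abs_le_iff atLeastAtMost_iff minus_le_iff)
    then show "z \<in> (\<Pi>\<^sub>E i\<in>{..<N}. {-R..R})"
      using z by (auto simp: Rn_def PiE_iff)
  qed
  then have "emeasure (leb N) {z \<in> Rn N. nrm N z \<le> R} \<le> emeasure (leb N) (\<Pi>\<^sub>E i\<in>{..<N}. {-R..R})"
    by (rule emeasure_mono) (auto simp: leb_def intro!: sets_PiM_I_finite)
  also have "\<dots> = (\<Prod>i<N. emeasure lborel {-R..R})"
    unfolding leb_def by (rule lborels.emeasure_PiM) auto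
  also have "\<dots> < \<infinity>"
    by (cases "0 \<le> R") (auto simp: emeasure_lborel_Icc_eq ennreal_power power_0_left)
  finally show ?thesis .
qed

lemma sets_ball [measurable]: "{z \<in> Rn N. nrm N z \<le> R} \<in> sets (leb N)"
  using measurable_sets[OF measurable_nrm, of "{..R}" N]
  by (simp add: vimage_def Int_def conj_commute)

lemma loc_integrable_measurable:
  assumes "loc_integrable N u"
  shows "u \<in> borel_measurable (leb N)"
proof (rule borel_measurable_LIMSEQ_real)
  let ?f = "\<lambda>n z. indicator {z \<in> Rn N. nrm N z \<le> real n} z *\<^sub>R u z"
  show "?f n \<in> borel_measurable (leb N)" for n
    using assms by (auto simp: loc_integrable_def set_integrable_def)
  fix z assume z: "z \<in> space (leb N)"
  have "eventually (\<lambda>n. ?f n z = u z) sequentially"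
    using eventually_ge_at_top[of "nat \<lceil>nrm N z\<rceil>"]
    by eventually_elim (use z in \<open>auto simp: indicator_def nat_le_iff ceiling_le_iff\<close>)
  then show "(\<lambda>n. ?f n z) \<longlonglongrightarrow> u z"
    by (rule tendsto_eventually)
qed

lemma loc_integrable_const: "loc_integrable N (\<lambda>_. c)"
  unfolding loc_integrable_def set_integrable_def
  using emeasure_ball_finite by (auto intro!: integrable_scaleR_left integrable_real_indicator)

lemma integrable_pairing:
  assumes u: "loc_integrable N u" and f: "bounded_support N f"
  shows "integrable (leb N) (\<lambda>z. u z * f z)"
proof -
  obtain B R where B: "\<And>z. z \<in> Rn N \<Longrightarrow> \<bar>f z\<bar> \<le> B" and R: "\<And>z. z \<in> Rn N \<Longrightarrow> R < nrm N z \<Longrightarrow> f z = 0"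
    and [measurable]: "f \<in> borel_measurable (leb N)"
    using f by (auto simp: bounded_support_def)
  have [measurable]: "u \<in> borel_measurable (leb N)"
    by (rule loc_integrable_measurable[OF u])
  let ?g = "\<lambda>z. indicator {z \<in> Rn N. nrm N z \<le> R} z *\<^sub>R u z"
  have "integrable (leb N) ?g"
    using u by (simp add: loc_integrable_def set_integrable_def)
  then have "integrable (leb N) (\<lambda>z. B * ?g z)" by simp
  then show ?thesis
  proof (rule Bochner_Integration.integrable_bound)
    show "AE z in leb N. norm (u z * f z) \<le> norm (B * ?g z)"
    proof (rule AE_I2)
      fix z assume "z \<in> space (leb N)"
      then have z: "z \<in> Rn N" by simp
      show "norm (u z * f z) \<le> norm (B * ?g z)"
      proof (cases "nrm N z \<le> R")
        case True
        have "\<bar>u z\<bar> * \<bar>f z\<bar> \<le> \<bar>u z\<bar> * \<bar>B\<bar>"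
          using B[OF z] by (intro mult_left_mono) auto
        then show ?thesis using True z by (simp add: abs_mult mult.commute)
      qed (use R[OF z] in auto)
    qed
  qed measurable
qed

lemma integrable_bounded_support: "bounded_support N f \<Longrightarrow> integrable (leb N) f"
  using integrable_pairing[OF loc_integrable_const[of N 1]] by simp

lemma loc_integrable_diff:
  assumes "loc_integrable N u" "loc_integrable N v"
  shows "loc_integrable N (\<lambda>z. u z - v z)"
  using assms by (auto simp: loc_integrable_def intro!: set_integral_diff)

lemma continuous_loc_integrable:
  assumes f: "continuous_on (Rn N) f"
  shows "loc_integrable N f"
  unfolding loc_integrable_def set_integrable_def
proof (intro allI integrable_bounded_support)
  fix R
  let ?Q = "{z \<in> Rn N. \<forall>i<N. \<bar>z i\<bar> \<le> R}"
  have "compact (f ` ?Q)"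
    by (rule compact_continuous_image[OF continuous_on_subset[OF f] compact_cube]) auto
  then obtain B where B: "\<And>z. z \<in> ?Q \<Longrightarrow> \<bar>f z\<bar> \<le> B"
    by (meson bounded_real compact_imp_bounded image_eqI)
  have *: "\<bar>indicator {z \<in> Rn N. nrm N z \<le> R} z *\<^sub>R f z\<bar> \<le> max B 0" if "z \<in> Rn N" for z
  proof (cases "nrm N z \<le> R")
    case True
    then have "z \<in> ?Q" using that coord_le_nrm order_trans by blast
    from B[OF this] show ?thesis using True that by (simp add: indicator_def)
  qed auto
  have [measurable]: "f \<in> borel_measurable (leb N)"
    by (rule borel_measurable_continuous_Rn[OF f])
  show "bounded_support N (\<lambda>z. indicator {z \<in> Rn N. nrm N z \<le> R} z *\<^sub>R f z)"
    unfolding bounded_support_def using * by (intro conjI exI[of _ "max B 0"] exI[of _ R]) auto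
qed

section \<open>Calculus of continuously differentiable functions\<close>

text \<open>
  The partial derivatives are an explicit argument, so that the rules of calculus below compute them.
\<close>

definition C1_with :: "nat \<Rightarrow> (vec \<Rightarrow> real) \<Rightarrow> (nat \<Rightarrow> vec \<Rightarrow> real) \<Rightarrow> bool" where
  "C1_with N f D \<longleftrightarrow> continuous_on (Rn N) f \<and> (\<forall>i<N. continuous_on (Rn N) (D i) \<and>
     (\<forall>z\<in>Rn N. ((\<lambda>t. f (z(i := t))) has_field_derivative D i z) (at (z i))))"

lemma C1_with_partial: "C1_with N f D \<Longrightarrow> i < N \<Longrightarrow> z \<in> Rn N \<Longrightarrow> partial i f z = D i z"
  unfolding C1_with_def partial_def by (blast intro: DERIV_imp_deriv)

lemma Cc1_C1_with: "f \<in> Cc1 N \<Longrightarrow> C1_with N f (\<lambda>i. partial i f)"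
  unfolding Cc1_def C1_with_def partial_def
  by (auto simp: DERIV_deriv_iff_real_differentiable)

lemma C1_with_Cc1:
  assumes "C1_with N f D" "\<And>z. z \<in> Rn N \<Longrightarrow> R < nrm N z \<Longrightarrow> f z = 0"
  shows "f \<in> Cc1 N"
proof -
  have "continuous_on (Rn N) (partial i f)" if "i < N" for i
    using assms(1) that C1_with_partial[OF assms(1) that]
    by (subst continuous_on_cong[OF refl, where g = "D i"]) (auto simp: C1_with_def)
  then show ?thesis
    using assms unfolding Cc1_def C1_with_def
    by (intro CollectI conjI allI impI ballI exI[of _ R])
       (use assms in \<open>auto simp: real_differentiable_def C1_with_def intro!: exI[of _ "D _ _"]\<close>)
qed

lemma C1_with_const: "C1_with N (\<lambda>_. c) (\<lambda>_ _. 0)"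
  by (auto simp: C1_with_def)

lemma C1_with_coord: "C1_with N (\<lambda>z. z j) (\<lambda>i _. if i = j then 1 else 0)"
  by (auto simp: C1_with_def continuous_on_coord)

lemma C1_with_add:
  "C1_with N f D \<Longrightarrow> C1_with N g E \<Longrightarrow> C1_with N (\<lambda>z. f z + g z) (\<lambda>i z. D i z + E i z)"
  unfolding C1_with_def
  by (intro conjI allI impI ballI continuous_on_add DERIV_add) blast+

lemma C1_with_diff:
  "C1_with N f D \<Longrightarrow> C1_with N g E \<Longrightarrow> C1_with N (\<lambda>z. f z - g z) (\<lambda>i z. D i z - E i z)"
  unfolding C1_with_def
  by (intro conjI allI impI ballI continuous_on_diff DERIV_diff) blast+

lemma C1_with_mult:
  assumes "C1_with N f D" "C1_with N g E"
  shows "C1_with N (\<lambda>z. f z * g z) (\<lambda>i z. D i z * g z + E i z * f z)"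
  unfolding C1_with_def
proof (intro conjI allI impI ballI)
  fix i z assume "i < N" "z \<in> Rn N"
  then have "((\<lambda>t. f (z(i := t))) has_field_derivative D i z) (at (z i))"
    "((\<lambda>t. g (z(i := t))) has_field_derivative E i z) (at (z i))"
    using assms by (auto simp: C1_with_def)
  from DERIV_mult[OF this]
  show "((\<lambda>t. f (z(i := t)) * g (z(i := t))) has_field_derivative D i z * g z + E i z * f z) (at (z i))"
    by simp
qed (use assms in \<open>auto simp: C1_with_def intro!: continuous_intros\<close>)

lemma C1_with_sum:
  "(\<And>j. j \<in> J \<Longrightarrow> C1_with N (f j) (D j)) \<Longrightarrow>
    C1_with N (\<lambda>z. \<Sum>j\<in>J. f j z) (\<lambda>i z. \<Sum>j\<in>J. D j i z)"
  by (induction J rule: infinite_finite_induct) (auto simp: C1_with_const C1_with_add)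

lemma C1_with_compose:
  assumes f: "C1_with N f D"
    and h: "\<And>z. z \<in> Rn N \<Longrightarrow> (h has_field_derivative h' (f z)) (at (f z))"
    and h': "continuous_on (f ` Rn N) h'"
  shows "C1_with N (\<lambda>z. h (f z)) (\<lambda>i z. h' (f z) * D i z)"
  unfolding C1_with_def
proof (intro conjI allI impI ballI)
  have c: "continuous_on (Rn N) f" using f by (simp add: C1_with_def)
  have "continuous_on (f ` Rn N) h"
    using h by (intro continuous_at_imp_continuous_on) (auto intro: DERIV_isCont)
  then show "continuous_on (Rn N) (\<lambda>z. h (f z))"
    by (rule continuous_on_compose2[OF _ c]) auto
  fix i assume i: "i < N"
  then show "continuous_on (Rn N) (\<lambda>z. h' (f z) * D i z)"
    using f by (intro continuous_on_mult continuous_on_compose2[OF h' c]) (auto simp: C1_with_def)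
  fix z assume z: "z \<in> Rn N"
  have "((\<lambda>t. f (z(i := t))) has_field_derivative D i z) (at (z i))"
    using f i z by (auto simp: C1_with_def)
  moreover have "(h has_field_derivative h' (f z)) (at (f (z(i := z i))))"
    using h[OF z] by simp
  ultimately show "((\<lambda>t. h (f (z(i := t)))) has_field_derivative h' (f z) * D i z) (at (z i))"
    using DERIV_chain2[of h "h' (f z)" "\<lambda>t. f (z(i := t))" "z i"] by simp
qed

lemma C1_with_cong:
  assumes "C1_with N f D" "\<And>z. z \<in> Rn N \<Longrightarrow> f z = g z"
    "\<And>i z. i < N \<Longrightarrow> z \<in> Rn N \<Longrightarrow> D i z = E i z"
  shows "C1_with N g E"
proof -
  have "(\<lambda>t. f (z(i := t))) = (\<lambda>t. g (z(i := t)))" if "i < N" "z \<in> Rn N" for i z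
    using assms(2) upd_in_Rn[OF that(2,1)] by auto
  moreover have "continuous_on (Rn N) f = continuous_on (Rn N) g"
    by (rule continuous_on_cong) (use assms in auto)
  moreover have "continuous_on (Rn N) (D i) = continuous_on (Rn N) (E i)" if "i < N" for i
    by (rule continuous_on_cong) (use assms that in auto)
  ultimately show ?thesis
    using assms(1,3) unfolding C1_with_def by auto
qed

lemma C1_with_sqnorm: "C1_with N (\<lambda>z. (nrm N z)\<^sup>2) (\<lambda>i z. 2 * z i)"
proof -
  have "C1_with N (\<lambda>z. \<Sum>j<N. z j * z j) (\<lambda>i z. \<Sum>j<N. (if i = j then 1 else 0) * z j + (if i = j then 1 else 0) * z j)"
    by (intro C1_with_sum C1_with_mult C1_with_coord)
  then show ?thesis
  proof (rule C1_with_cong)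
    show "(\<Sum>j<N. z j * z j) = (nrm N z)\<^sup>2" for z
      by (simp add: L2_set_def power2_eq_square sum_nonneg)
    show "(\<Sum>j<N. (if i = j then 1 else 0) * z j + (if i = j then 1 else 0) * z j) = 2 * z i" if "i < N" for i and z :: vec
    proof -
      have "(\<Sum>j<N. (if i = j then 1 else 0) * z j + (if i = j then 1 else 0) * z j) = (\<Sum>j<N. if j = i then 2 * z i else 0)"
        by (intro sum.cong) auto
      then show ?thesis using that by simp
    qed
  qed
qed

lemma Cc1_support:
  assumes "f \<in> Cc1 N"
  obtains R where "\<And>z. z \<in> Rn N \<Longrightarrow> R < nrm N z \<Longrightarrow> f z = 0"
    "\<And>i z. i < N \<Longrightarrow> z \<in> Rn N \<Longrightarrow> R < nrm N z \<Longrightarrow> partial i f z = 0"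
proof -
  obtain R where R: "\<And>z. z \<in> Rn N \<Longrightarrow> R < nrm N z \<Longrightarrow> f z = 0"
    using assms by (auto simp: Cc1_def)
  have "partial i f z = 0" if "i < N" "z \<in> Rn N" "R < nrm N z" for i z
  proof -
    have "isCont (\<lambda>t. nrm N (z(i := t))) (z i)"
    proof -
      have "isCont (\<lambda>t. (z(i := t)) j) (z i)" for j
        by (cases "j = i") auto
      then show ?thesis unfolding L2_set_def by (intro continuous_intros)
    qed
    then have "((\<lambda>t. nrm N (z(i := t))) \<longlongrightarrow> nrm N z) (nhds (z i))"
      using tendsto_at_iff_tendsto_nhds[of "\<lambda>t. nrm N (z(i := t))" "z i"] by (simp add: isCont_def)
    then have "eventually (\<lambda>t. R < nrm N (z(i := t))) (nhds (z i))"
      using that(3) order_tendstoD(1) by blast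
    then have "eventually (\<lambda>t. f (z(i := t)) = 0) (nhds (z i))"
      by eventually_elim (use R upd_in_Rn[OF that(2,1)] in auto)
    then have "((\<lambda>t. f (z(i := t))) has_field_derivative 0) (at (z i))"
      by (subst DERIV_cong_ev[OF refl _ refl, where g = "\<lambda>_. 0"]) auto
    then show ?thesis by (simp add: partial_def DERIV_imp_deriv)
  qed
  with R that show ?thesis by blast
qed

lemma Cc1_bounded_support: "f \<in> Cc1 N \<Longrightarrow> bounded_support N f"
  by (auto simp: Cc1_def intro: continuous_bounded_support)

lemma partial_bounded_support: "f \<in> Cc1 N \<Longrightarrow> i < N \<Longrightarrow> bounded_support N (partial i f)"
  by (rule Cc1_support[of f N], assumption, rule continuous_bounded_support) (auto simp: Cc1_def)

lemma Cc1_mult_C1: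
  assumes "f \<in> Cc1 N" "C1_with N g E"
  shows "(\<lambda>z. f z * g z) \<in> Cc1 N"
proof (rule Cc1_support[OF assms(1)])
  fix R assume "\<And>z. z \<in> Rn N \<Longrightarrow> R < nrm N z \<Longrightarrow> f z = 0"
  then show ?thesis
    using C1_with_Cc1[OF C1_with_mult[OF Cc1_C1_with[OF assms(1)] assms(2)], of R] by simp
qed

lemma partial_mult:
  "f \<in> Cc1 N \<Longrightarrow> C1_with N g E \<Longrightarrow> i < N \<Longrightarrow> z \<in> Rn N \<Longrightarrow>
    partial i (\<lambda>z. f z * g z) z = partial i f z * g z + E i z * f z"
  by (rule C1_with_partial[OF C1_with_mult[OF Cc1_C1_with]])

text \<open>Fubini in the \<open>i\<close>-th coordinate, and the fundamental theorem of calculus.\<close>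

lemma integral_partial_Cc1:
  assumes f: "f \<in> Cc1 N" and i: "i < N"
  shows "(\<integral>z. partial i f z \<partial>leb N) = 0"
proof -
  obtain R where R: "\<And>z. z \<in> Rn N \<Longrightarrow> R < nrm N z \<Longrightarrow> f z = 0"
    "\<And>i z. i < N \<Longrightarrow> z \<in> Rn N \<Longrightarrow> R < nrm N z \<Longrightarrow> partial i f z = 0"
    using Cc1_support[OF f] by metis
  \<comment> \<open>On each line the integration over \<open>[-S, S]\<close> starts and ends outside the support.\<close>
  define S where "S = \<bar>R\<bar> + 1"
  let ?I = "{..<N} - {i}"
  have I: "insert i ?I = {..<N}" using i by auto
  have "integrable (leb N) (partial i f)"
    by (intro integrable_bounded_support partial_bounded_support f i)
  then have "(\<integral>z. partial i f z \<partial>leb N) = (\<integral>x. (\<integral>t. partial i f (x(i := t)) \<partial>lborel) \<partial>Pi\<^sub>M ?I (\<lambda>_. lborel :: real measure))"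
    using lborels.product_integral_insert[of ?I i "partial i f"] unfolding I leb_def by auto
  also have "\<dots> = (\<integral>x. 0 \<partial>Pi\<^sub>M ?I (\<lambda>_. lborel :: real measure))"
  proof (rule Bochner_Integration.integral_cong[OF refl])
    fix x :: vec assume "x \<in> space (Pi\<^sub>M ?I (\<lambda>_. lborel :: real measure))"
    then have x: "x(i := t) \<in> Rn N" for t
      using i by (auto simp: space_PiM Rn_def PiE_def extensional_def)
    have far: "R < nrm N (x(i := t))" if "\<bar>t\<bar> \<ge> S" for t
      using coord_le_nrm[OF i, of "x(i := t)"] that by (auto simp: S_def)
    have ind: "partial i f (x(i := t)) = partial i f (x(i := t)) * indicator {-S..S} t" for t
      using R(2)[OF i x far, of t] by (cases "\<bar>t\<bar> \<ge> S") (auto simp: indicator_def)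
    have d: "((\<lambda>t. f (x(i := t))) has_field_derivative partial i f (x(i := t))) (at t)" for t
    proof -
      have "((\<lambda>s. f ((x(i := t))(i := s))) has_field_derivative partial i f (x(i := t))) (at ((x(i := t)) i))"
        using Cc1_C1_with[OF f] i x[of t] unfolding C1_with_def by blast
      then show ?thesis by simp
    qed
    have c: "isCont (\<lambda>t. partial i f (x(i := t))) t" for t
    proof -
      have "continuous_on UNIV (\<lambda>t. partial i f (x(i := t)))"
      proof (rule continuous_on_compose2[where g = "partial i f" and t = "Rn N"])
        show "continuous_on (Rn N) (partial i f)" using f i by (auto simp: Cc1_def)
        show "continuous_on UNIV (\<lambda>t. x(i := t))"
        proof (rule continuous_on_coordinatewise_then_product)
          show "continuous_on UNIV (\<lambda>t. (x(i := t)) j)" for j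
            by (cases "j = i") auto
        qed
      qed (use x in auto)
      then show ?thesis by (simp add: continuous_on_eq_continuous_at)
    qed
    have "(\<integral>t. partial i f (x(i := t)) \<partial>lborel) = (\<integral>t. partial i f (x(i := t)) * indicator {-S..S} t \<partial>lborel)"
      by (rule Bochner_Integration.integral_cong[OF refl ind])
    also have "\<dots> = f (x(i := S)) - f (x(i := -S))"
      by (rule integral_FTC_Icc_real) (simp add: S_def, rule d, rule c)
    also have "\<dots> = 0" using R(1)[OF x far] by (auto simp: S_def)
    finally show "(\<integral>t. partial i f (x(i := t)) \<partial>lborel) = 0" .
  qed
  finally show ?thesis by simp
qed

section \<open>The fundamental lemma of the calculus of variations\<close>

text \<open>
  The sets over which \<open>f\<close> integrates to zero form a Dynkin system, so a generating system that is stable under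
  intersections suffices.
\<close>

lemma AE_zero_of_set_integrals:
  fixes f :: "'a \<Rightarrow> real"
  assumes f: "integrable M f" and E: "Int_stable E" "E \<subseteq> Pow (space M)"
    and sets: "sets M = sigma_sets (space M) E"
    and zero: "\<And>A. A \<in> E \<Longrightarrow> (\<integral>x. indicator A x * f x \<partial>M) = 0" and total: "(\<integral>x. f x \<partial>M) = 0"
  shows "AE x in M. f x = 0"
proof -
  have int: "integrable M (\<lambda>x. indicator A x * f x)" if "A \<in> sets M" for A
    using integrable_mult_indicator[OF that f] by simp
  have all: "(\<integral>x. indicator A x * f x \<partial>M) = 0" if "A \<in> sets M" for A
    using E that unfolding sets
  proof (induction rule: sigma_sets_induct_disjoint)
    case (basic A) then show ?case by (rule zero)
  next
    case empty then show ?case by simp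
  next
    case (compl A)
    have "(\<integral>x. indicator (space M - A) x * f x \<partial>M) = (\<integral>x. f x - indicator A x * f x \<partial>M)"
      by (rule Bochner_Integration.integral_cong) (auto simp: indicator_def)
    also have "\<dots> = 0"
      using f int compl total by (simp add: sets)
    finally show ?case .
  next
    case (union A)
    have [measurable]: "A i \<in> sets M" for i using union(2) by (auto simp: sets)
    have "(\<integral>x\<in>(\<Union>i. A i). f x \<partial>M) = (\<Sum>i. (\<integral>x\<in>A i. f x \<partial>M))"
      using union(1) f
      by (intro lebesgue_integral_countable_add)
         (auto simp: disjoint_family_on_def set_integrable_def int)
    then show ?case using union(3) by (simp add: set_lebesgue_integral_def)
  qed
  have "AE x in M. f x = (\<lambda>_. 0) x"
    by (rule density_unique_real[OF f]) (use all in \<open>auto simp: set_lebesgue_integral_def\<close>)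
  then show ?thesis by simp
qed

lemma borel_eq_sigma_Ioo: "sets (borel :: real measure) = sigma_sets UNIV (range (\<lambda>(a, b). {a<..<b}))"
proof -
  have "(borel :: real measure) = sigma UNIV (range (\<lambda>(a, b). {a<..<b}))"
    using borel_eq_box[where 'a = real] by (simp add: box_real case_prod_unfold)
  then have "sets (borel :: real measure) = sets (sigma UNIV (range (\<lambda>(a, b). {a<..<b})))"
    by (rule arg_cong)
  also have "\<dots> = sigma_sets UNIV (range (\<lambda>(a, b). {a<..<b}))"
    by (rule sets_measure_of) auto
  finally show ?thesis .
qed

definition obox :: "nat \<Rightarrow> vec \<Rightarrow> vec \<Rightarrow> vec set" where
  "obox N a b = (\<Pi>\<^sub>E i\<in>{..<N}. {a i<..<b i})"

lemma obox_subset: "obox N a b \<subseteq> Rn N"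
  by (auto simp: obox_def Rn_def PiE_iff)

lemma obox_eq: "obox N a b = {z \<in> Rn N. \<forall>i\<in>{..<N}. z i \<in> {a i<..<b i}}"
  unfolding obox_def Rn_def by (intro set_eqI) (simp add: PiE_iff conj_commute)

lemma obox_Int: "obox N a b \<inter> obox N c d = obox N (\<lambda>i. max (a i) (c i)) (\<lambda>i. min (b i) (d i))"
  by (simp add: obox_def PiE_Int)

lemma sets_leb_obox: "sets (leb N) = sigma_sets (Rn N) {obox N a b | a b. True}"
proof -
  let ?E = "range (\<lambda>(a, b). {a<..<b}) :: real set set"
  have cover: "\<exists>S\<subseteq>?E. countable S \<and> UNIV = \<Union>S"
  proof (intro exI conjI)
    show "range (\<lambda>n. {- real n<..<real n}) \<subseteq> ?E" by auto
    show "UNIV = (\<Union>n. {- real n<..<real n})"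
    proof (intro set_eqI iffI UNIV_I)
      fix x :: real
      obtain n where "\<bar>x\<bar> < real n" using reals_Archimedean2 by blast
      then show "x \<in> (\<Union>n. {- real n<..<real n})" by (auto intro!: exI[of _ n])
    qed
  qed simp
  have "sets (leb N) = sets (Pi\<^sub>M {..<N} (\<lambda>_. sigma UNIV ?E))"
    unfolding leb_def by (rule sets_PiM_cong) (auto simp: borel_eq_sigma_Ioo)
  also have "\<dots> = sets (sigma (Rn N)
      {{f \<in> Rn N. \<forall>i\<in>j. f i \<in> A i} | A j. j \<in> {{..<N}} \<and> A \<in> Pi j (\<lambda>_. ?E)})"
    unfolding Rn_def by (rule sets_PiM_sigma) (use cover in auto)
  also have "{{f \<in> Rn N. \<forall>i\<in>j. f i \<in> A i} | A j. j \<in> {{..<N}} \<and> A \<in> Pi j (\<lambda>_. ?E)} = {obox N a b | a b. True}"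
    (is "?L = ?R")
  proof (intro equalityI subsetI)
    fix X assume "X \<in> ?L"
    then obtain A where X: "X = {f \<in> Rn N. \<forall>i<N. f i \<in> A i}" and "\<forall>i<N. A i \<in> ?E" by auto
    then have "\<forall>i. \<exists>p. i < N \<longrightarrow> A i = {fst p<..<snd p}" by fastforce
    then obtain p where "\<forall>i<N. A i = {fst (p i)<..<snd (p i)}" by metis
    then have "X = obox N (\<lambda>i. fst (p i)) (\<lambda>i. snd (p i))"
      by (auto simp: X obox_eq)
    then show "X \<in> ?R" by blast
  next
    fix X assume "X \<in> ?R"
    then obtain a b where X: "X = obox N a b" by blast
    then have "X = {f \<in> Rn N. \<forall>i\<in>{..<N}. f i \<in> {a i<..<b i}}"
      by (simp only: obox_eq)
    then show "X \<in> ?L"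
      by (intro CollectI exI[of _ "\<lambda>i. {a i<..<b i}"] exI[of _ "{..<N}"]) auto
  qed
  finally show ?thesis using obox_subset by (subst (asm) sets_measure_of) auto
qed

lemma obox_nrm_le:
  assumes "z \<in> obox N a b"
  shows "nrm N z \<le> (\<Sum>i<N. \<bar>a i\<bar> + \<bar>b i\<bar>)"
proof -
  have "nrm N z \<le> (\<Sum>i<N. \<bar>z i\<bar>)" by (rule L2_set_le_sum_abs)
  also have "\<dots> \<le> (\<Sum>i<N. \<bar>a i\<bar> + \<bar>b i\<bar>)"
  proof (rule sum_mono)
    fix i assume "i \<in> {..<N}"
    then have "a i < z i" "z i < b i" using assms by (auto simp: obox_def PiE_iff)
    then show "\<bar>z i\<bar> \<le> \<bar>a i\<bar> + \<bar>b i\<bar>" by linarith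
  qed
  finally show ?thesis .
qed

lemma DERIV_max_zero_sq: "((\<lambda>x. (max 0 x)\<^sup>2) has_field_derivative 2 * max 0 x) (at (x::real))"
proof -
  consider "x < 0" | "x = 0" | "x > 0" by linarith
  then show ?thesis
  proof cases
    case 1
    have "eventually (\<lambda>y. (max 0 y)\<^sup>2 = (0::real)) (nhds x)"
      using eventually_nhds_in_open[of "{..<0}" x] 1 by (auto elim: eventually_mono)
    then show ?thesis using 1 by (subst DERIV_cong_ev[OF refl _ refl, where g = "\<lambda>_. 0"]) auto
  next
    case 2
    have "((\<lambda>h::real. (max 0 h)\<^sup>2 / h) \<longlongrightarrow> 0) (at 0)"
    proof (rule Lim_null_comparison)
      show "eventually (\<lambda>h::real. norm ((max 0 h)\<^sup>2 / h) \<le> \<bar>h\<bar>) (at 0)"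
        by (rule always_eventually) (auto simp: max_def power2_eq_square)
      show "((\<lambda>h::real. \<bar>h\<bar>) \<longlongrightarrow> 0) (at 0)" by (rule tendsto_rabs_zero) simp
    qed
    then show ?thesis using 2 by (simp add: DERIV_def)
  next
    case 3
    have "eventually (\<lambda>y. (max 0 y)\<^sup>2 = (y::real)\<^sup>2) (nhds x)"
      using eventually_nhds_in_open[of "{0<..}" x] 3 by (auto elim: eventually_mono)
    then show ?thesis
      using 3 by (subst DERIV_cong_ev[OF refl _ refl, where g = "\<lambda>y. y\<^sup>2"]) (auto intro!: derivative_eq_intros)
  qed
qed

lemma C1_with_max_zero_sq:
  "C1_with N f D \<Longrightarrow> C1_with N (\<lambda>z. (max 0 (f z))\<^sup>2) (\<lambda>i z. 2 * max 0 (f z) * D i z)"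
  by (rule C1_with_compose[where h = "\<lambda>x. (max 0 x)\<^sup>2" and h' = "\<lambda>x. 2 * max 0 x"])
     (assumption, rule DERIV_max_zero_sq, intro continuous_intros)

lemma C1_with_prod:
  "finite J \<Longrightarrow> (\<And>j. j \<in> J \<Longrightarrow> \<exists>D. C1_with N (f j) D) \<Longrightarrow> \<exists>D. C1_with N (\<lambda>z. \<Prod>j\<in>J. f j z) D"
proof (induction J rule: finite_induct)
  case empty
  then show ?case using C1_with_const[of N 1] by auto
next
  case (insert j J)
  then obtain D E where "C1_with N (f j) D" "C1_with N (\<lambda>z. \<Prod>j\<in>J. f j z) E" by (metis insertCI)
  from C1_with_mult[OF this] show ?case using insert by auto
qed

lemma saturation_tendsto_indicator:
  assumes "0 \<le> (m::real)"
  shows "(\<lambda>k::nat. real k * m / (1 + real k * m)) \<longlonglongrightarrow> (if 0 < m then 1 else 0)"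
proof (cases "0 < m")
  case True
  have "(\<lambda>k::nat. 1 - 1 / (1 + real k * m)) \<longlonglongrightarrow> 1 - 0"
  proof (intro tendsto_intros)
    have "filterlim (\<lambda>k::nat. 1 + real k * m) at_top sequentially"
      using True
      by (intro filterlim_tendsto_add_at_top[OF tendsto_const] filterlim_at_top_mult_tendsto_pos[OF tendsto_const])
         (auto simp: filterlim_real_sequentially)
    then show "(\<lambda>k::nat. 1 / (1 + real k * m)) \<longlonglongrightarrow> 0"
      by (intro tendsto_divide_0[OF tendsto_const] filterlim_at_top_imp_at_infinity)
  qed
  moreover have "1 - 1 / (1 + real k * m) = real k * m / (1 + real k * m)" for k
  proof -
    have "1 + real k * m > 0" using True by (simp add: add_pos_nonneg)
    then show ?thesis by (simp add: field_simps)
  qed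
  ultimately show ?thesis using True by simp
qed (use assms in auto)

lemma saturation_bounds:
  assumes "0 \<le> (m::real)"
  shows "0 \<le> real k * m / (1 + real k * m)" "real k * m / (1 + real k * m) \<le> 1"
proof -
  have "0 \<le> real k * m" using assms by simp
  then show "0 \<le> real k * m / (1 + real k * m)" "real k * m / (1 + real k * m) \<le> 1"
    by (auto simp: divide_simps)
qed

text \<open>
  A continuously differentiable \<open>m \<ge> 0\<close> that is positive exactly on the box gives the test functions
  \<open>k m / (1 + k m)\<close>, which converge boundedly to the indicator.  A product of squared positive parts is
  such an \<open>m\<close>.
\<close>

lemma obox_test_functions:
  obtains \<phi> where "\<And>k::nat. \<phi> k \<in> Cc1 N" "\<And>k z. 0 \<le> \<phi> k z \<and> \<phi> k z \<le> 1"
    "\<And>k z. z \<in> Rn N - obox N a b \<Longrightarrow> \<phi> k z = 0"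
    "\<And>z. z \<in> Rn N \<Longrightarrow> (\<lambda>k. \<phi> k z) \<longlonglongrightarrow> indicator (obox N a b) z"
proof -
  define m where "m = (\<lambda>z. \<Prod>j<N. (max 0 (z j - a j))\<^sup>2 * (max 0 (b j - z j))\<^sup>2)"
  define \<phi> where "\<phi> = (\<lambda>k z. real k * m z / (1 + real k * m z))"
  have "\<exists>D. C1_with N (\<lambda>z. (max 0 (z j - a j))\<^sup>2 * (max 0 (b j - z j))\<^sup>2) D" for j
    using C1_with_mult[OF C1_with_max_zero_sq[OF C1_with_diff[OF C1_with_coord C1_with_const]]
        C1_with_max_zero_sq[OF C1_with_diff[OF C1_with_const C1_with_coord]]] by blast
  then have "\<exists>D. C1_with N m D"
    unfolding m_def by (intro C1_with_prod finite_lessThan)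
  then obtain D where D: "C1_with N m D" ..
  have m0: "0 \<le> m z" for z unfolding m_def by (intro prod_nonneg) auto
  have mpos: "0 < m z \<longleftrightarrow> z \<in> obox N a b" if "z \<in> Rn N" for z
  proof
    assume m: "0 < m z"
    have nz: "(max 0 (z j - a j))\<^sup>2 * (max 0 (b j - z j))\<^sup>2 \<noteq> 0" if "j < N" for j
    proof
      assume "(max 0 (z j - a j))\<^sup>2 * (max 0 (b j - z j))\<^sup>2 = 0"
      then have "m z = 0" unfolding m_def using that by (intro prod_zero) auto
      with m show False by simp
    qed
    have "a j < z j \<and> z j < b j" if "j < N" for j
      using nz[OF that] by (auto simp: max_def split: if_splits)
    then show "z \<in> obox N a b" using that by (auto simp: obox_def Rn_def PiE_iff)
  next
    assume "z \<in> obox N a b"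
    then have "a j < z j \<and> z j < b j" if "j < N" for j
      using that by (auto simp: obox_eq)
    then have "0 < (max 0 (z j - a j))\<^sup>2 * (max 0 (b j - z j))\<^sup>2" if "j < N" for j
      using that by (intro mult_pos_pos zero_less_power) (auto simp: less_max_iff_disj)
    then show "0 < m z" unfolding m_def by (intro prod_pos) auto
  qed
  have ev: "\<phi> k \<in> Cc1 N" for k
  proof (rule C1_with_Cc1)
    have den: "1 + real k * m z \<noteq> 0" for z
      using m0[of z] by (smt (verit) mult_nonneg_nonneg of_nat_0_le_iff)
    show "C1_with N (\<phi> k) (\<lambda>i z. real k / (1 + real k * m z)\<^sup>2 * D i z)"
      unfolding \<phi>_def
    proof (rule C1_with_compose[OF D, where h = "\<lambda>x. real k * x / (1 + real k * x)" and h' = "\<lambda>x. real k / (1 + real k * x)\<^sup>2"])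
      show "((\<lambda>x. real k * x / (1 + real k * x)) has_field_derivative real k / (1 + real k * m z)\<^sup>2) (at (m z))" for z
        using den[of z] by (auto intro!: derivative_eq_intros simp: power2_eq_square algebra_simps)
      show "continuous_on (m ` Rn N) (\<lambda>x. real k / (1 + real k * x)\<^sup>2)"
        using den by (intro continuous_intros) auto
    qed
    fix z assume z: "z \<in> Rn N" "(\<Sum>i<N. \<bar>a i\<bar> + \<bar>b i\<bar>) < nrm N z"
    then have "z \<notin> obox N a b" using obox_nrm_le by fastforce
    then have "m z = 0" using mpos[OF z(1)] m0[of z] by auto
    then show "\<phi> k z = 0" by (simp add: \<phi>_def)
  qed
  show ?thesis
  proof (rule that[of \<phi>])
    show "\<phi> k \<in> Cc1 N" for k by (rule ev)
    show "0 \<le> \<phi> k z \<and> \<phi> k z \<le> 1" for k z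
      unfolding \<phi>_def using saturation_bounds[OF m0] by blast
    fix z assume z: "z \<in> Rn N"
    show "(\<lambda>k. \<phi> k z) \<longlonglongrightarrow> indicator (obox N a b) z"
      using saturation_tendsto_indicator[OF m0[of z]] mpos[OF z]
      unfolding \<phi>_def by (auto simp: indicator_def)
  next
    fix k z assume "z \<in> Rn N - obox N a b"
    then show "\<phi> k z = 0" using mpos[of z] m0[of z] by (auto simp: \<phi>_def)
  qed
qed

lemma obox_sets [measurable]: "obox N a b \<in> sets (leb N)"
  unfolding obox_def leb_def by (rule sets_PiM_I_finite) auto

text \<open>
  Test functions approximate indicators of open boxes, so \<open>f\<close> integrates to zero over every box, and the boxes
  generate the sigma-algebra.
\<close>

theorem fundamental_lemma:
  assumes f: "loc_integrable N f" and orth: "\<And>\<phi>. \<phi> \<in> Cc1 N \<Longrightarrow> (\<integral>z. f z * \<phi> z \<partial>leb N) = 0"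
  shows "AE z in leb N. f z = 0"
proof -
  have fm [measurable]: "f \<in> borel_measurable (leb N)" by (rule loc_integrable_measurable[OF f])
  have bs: "bounded_support N (indicator (obox N a b))" for a b
  proof -
    let ?R = "1 + (\<Sum>i<N. \<bar>a i\<bar> + \<bar>b i\<bar>)"
    have "0 \<le> (\<Sum>i<N. \<bar>a i\<bar> + \<bar>b i\<bar>)" by (intro sum_nonneg) simp
    moreover have "indicator (obox N a b) z = (0::real)" if "?R < nrm N z" for z
      using obox_nrm_le[of z N a b] that by (auto simp: indicator_def)
    ultimately show ?thesis
      unfolding bounded_support_def
      by (intro conjI exI[of _ ?R]) (auto simp: indicator_def)
  qed
  have box: "(\<integral>z. f z * indicator (obox N a b) z \<partial>leb N) = 0" for a b
  proof -
    obtain \<phi> where \<phi>: "\<And>k::nat. \<phi> k \<in> Cc1 N" "\<And>k z. 0 \<le> \<phi> k z \<and> \<phi> k z \<le> 1"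
      "\<And>k z. z \<in> Rn N - obox N a b \<Longrightarrow> \<phi> k z = 0"
      "\<And>z. z \<in> Rn N \<Longrightarrow> (\<lambda>k. \<phi> k z) \<longlonglongrightarrow> indicator (obox N a b) z"
      using obox_test_functions[of N a b] by blast
    have [measurable]: "\<phi> k \<in> borel_measurable (leb N)" for k
      using Cc1_bounded_support[OF \<phi>(1)] by (simp add: bounded_support_def)
    have "(\<lambda>k. \<integral>z. f z * \<phi> k z \<partial>leb N) \<longlonglongrightarrow> (\<integral>z. f z * indicator (obox N a b) z \<partial>leb N)"
    proof (rule integral_dominated_convergence)
      show "integrable (leb N) (\<lambda>z. \<bar>f z * indicator (obox N a b) z\<bar>)"
        by (intro integrable_abs integrable_pairing[OF f bs])
      show "AE z in leb N. (\<lambda>k. f z * \<phi> k z) \<longlonglongrightarrow> f z * indicator (obox N a b) z"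
        by (rule AE_I2) (auto intro!: tendsto_mult \<phi>(4))
      show "AE z in leb N. norm (f z * \<phi> k z) \<le> \<bar>f z * indicator (obox N a b) z\<bar>" for k
      proof (rule AE_I2)
        fix z assume "z \<in> space (leb N)"
        then show "norm (f z * \<phi> k z) \<le> \<bar>f z * indicator (obox N a b) z\<bar>"
          using \<phi>(2)[of k z] \<phi>(3)[of z k]
          by (cases "z \<in> obox N a b") (auto simp: abs_mult mult_left_le)
      qed
    qed auto
    then show ?thesis
      by (simp add: orth[OF \<phi>(1)] LIMSEQ_const_iff)
  qed
  have loc: "AE z in leb N. f z * indicator (obox N (\<lambda>_. - real n) (\<lambda>_. real n)) z = 0" for n
  proof (rule AE_zero_of_set_integrals[where E = "{obox N a b | a b. True}"])
    show "integrable (leb N) (\<lambda>z. f z * indicator (obox N (\<lambda>_. - real n) (\<lambda>_. real n)) z)"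
      by (rule integrable_pairing[OF f bs])
    show "Int_stable {obox N a b | a b. True}"
      unfolding Int_stable_def using obox_Int by blast
    fix A assume "A \<in> {obox N a b | a b. True}"
    then obtain a b where A: "A = obox N a b" by blast
    have eq: "indicator A z * (f z * indicator (obox N (\<lambda>_. - real n) (\<lambda>_. real n)) z) =
        f z * indicator (obox N (\<lambda>i. max (a i) (- real n)) (\<lambda>i. min (b i) (real n))) z" for z
      unfolding A obox_Int[symmetric] by (auto simp: indicator_def)
    then show "(\<integral>z. indicator A z * (f z * indicator (obox N (\<lambda>_. - real n) (\<lambda>_. real n)) z) \<partial>leb N) = 0"
      by (simp only: eq box)
  qed (use obox_subset sets_leb_obox box in auto)
  then have "AE z in leb N. \<forall>n. f z * indicator (obox N (\<lambda>_. - real n) (\<lambda>_. real n)) z = 0"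
    unfolding AE_all_countable by blast
  then show ?thesis
  proof (rule AE_mp, intro AE_I2 impI)
    fix z assume z: "z \<in> space (leb N)" and 0: "\<forall>n. f z * indicator (obox N (\<lambda>_. - real n) (\<lambda>_. real n)) z = 0"
    obtain n where n: "nrm N z < real n" using reals_Archimedean2 by blast
    then have "\<bar>z i\<bar> < real n" if "i < N" for i
      using coord_le_nrm[OF that, of z] by linarith
    then have "z \<in> obox N (\<lambda>_. - real n) (\<lambda>_. real n)"
      using z by (fastforce simp: obox_def Rn_def PiE_iff)
    then show "f z = 0" using 0[rule_format, of n] by simp
  qed
qed

section \<open>Weak gradients\<close>

text \<open>
  Any weak gradient may thus replace the one chosen by \<^const>\<open>grad\<close>.
\<close>

lemma has_weak_grad_unique:
  assumes "has_weak_grad N u g" "has_weak_grad N u h"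
  shows "AE z in leb N. \<forall>i<N. g z i = h z i"
proof -
  have "AE z in leb N. g z i - h z i = 0" if i: "i < N" for i
  proof (rule fundamental_lemma)
    have li: "loc_integrable N (\<lambda>z. g z i)" "loc_integrable N (\<lambda>z. h z i)"
      using assms i by (auto simp: has_weak_grad_def)
    then show "loc_integrable N (\<lambda>z. g z i - h z i)" by (rule loc_integrable_diff)
    fix \<phi> assume \<phi>: "\<phi> \<in> Cc1 N"
    have "(\<integral>z. (g z i - h z i) * \<phi> z \<partial>leb N) = (\<integral>z. g z i * \<phi> z \<partial>leb N) - (\<integral>z. h z i * \<phi> z \<partial>leb N)"
      unfolding left_diff_distrib
      by (intro Bochner_Integration.integral_diff integrable_pairing li Cc1_bounded_support \<phi>)
    also have "\<dots> = 0"
    proof -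
      have "(\<integral>z. u z * partial i \<phi> z \<partial>leb N) = - (\<integral>z. g z i * \<phi> z \<partial>leb N)"
        "(\<integral>z. u z * partial i \<phi> z \<partial>leb N) = - (\<integral>z. h z i * \<phi> z \<partial>leb N)"
        using assms i \<phi> by (auto simp: has_weak_grad_def)
      then show ?thesis by simp
    qed
    finally show "(\<integral>z. (g z i - h z i) * \<phi> z \<partial>leb N) = 0" .
  qed
  then have "AE z in leb N. \<forall>i\<in>{..<N}. g z i - h z i = 0"
    by (intro AE_finite_allI) auto
  then show ?thesis by eventually_elim auto
qed

lemma has_weak_grad_grad: "has_weak_grad N u g \<Longrightarrow> has_weak_grad N u (grad N u)"
  unfolding grad_def by (rule someI[of "has_weak_grad N u"])

lemma Cc1_has_weak_grad:
  assumes f: "f \<in> Cc1 N"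
  shows "has_weak_grad N f (\<lambda>z i. partial i f z)"
  unfolding has_weak_grad_def
proof (intro conjI allI impI ballI)
  show "loc_integrable N f"
    using f by (intro continuous_loc_integrable) (simp add: Cc1_def)
  fix i assume i: "i < N"
  show li: "loc_integrable N (partial i f)"
    using f i by (intro continuous_loc_integrable) (simp add: Cc1_def)
  fix \<phi> assume \<phi>: "\<phi> \<in> Cc1 N"
  have "0 = (\<integral>z. partial i (\<lambda>z. f z * \<phi> z) z \<partial>leb N)"
    by (rule integral_partial_Cc1[OF Cc1_mult_C1[OF f Cc1_C1_with[OF \<phi>]] i, symmetric])
  also have "\<dots> = (\<integral>z. partial i f z * \<phi> z + f z * partial i \<phi> z \<partial>leb N)"
    using partial_mult[OF f Cc1_C1_with[OF \<phi>] i]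
    by (intro Bochner_Integration.integral_cong) auto
  also have "\<dots> = (\<integral>z. partial i f z * \<phi> z \<partial>leb N) + (\<integral>z. f z * partial i \<phi> z \<partial>leb N)"
    by (intro Bochner_Integration.integral_add integrable_bounded_support bounded_support_mult
        Cc1_bounded_support[OF f] Cc1_bounded_support[OF \<phi>]
        partial_bounded_support[OF f i] partial_bounded_support[OF \<phi> i])
  finally show "(\<integral>z. f z * partial i \<phi> z \<partial>leb N) = - (\<integral>z. partial i f z * \<phi> z \<partial>leb N)"
    by simp
qed

lemma has_weak_grad_diff:
  assumes "has_weak_grad N u g" "has_weak_grad N v h"
  shows "has_weak_grad N (\<lambda>z. u z - v z) (\<lambda>z i. g z i - h z i)"
  unfolding has_weak_grad_def
proof (intro conjI allI impI ballI)
  have l: "loc_integrable N u" "loc_integrable N v" using assms by (auto simp: has_weak_grad_def)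
  then show "loc_integrable N (\<lambda>z. u z - v z)" by (rule loc_integrable_diff)
  fix i assume i: "i < N"
  then have li: "loc_integrable N (\<lambda>z. g z i)" "loc_integrable N (\<lambda>z. h z i)"
    using assms by (auto simp: has_weak_grad_def)
  then show "loc_integrable N (\<lambda>z. g z i - h z i)" by (rule loc_integrable_diff)
  fix \<phi> assume \<phi>: "\<phi> \<in> Cc1 N"
  have "(\<integral>z. (u z - v z) * partial i \<phi> z \<partial>leb N) = (\<integral>z. u z * partial i \<phi> z \<partial>leb N) - (\<integral>z. v z * partial i \<phi> z \<partial>leb N)"
    unfolding left_diff_distrib
    by (intro Bochner_Integration.integral_diff integrable_pairing l partial_bounded_support \<phi> i)
  also have "\<dots> = - (\<integral>z. g z i * \<phi> z \<partial>leb N) + (\<integral>z. h z i * \<phi> z \<partial>leb N)"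
    using assms i \<phi> by (simp add: has_weak_grad_def)
  also have "\<dots> = - (\<integral>z. (g z i - h z i) * \<phi> z \<partial>leb N)"
    unfolding left_diff_distrib
    by (subst Bochner_Integration.integral_diff) (auto intro!: integrable_pairing li Cc1_bounded_support \<phi>)
  finally show "(\<integral>z. (u z - v z) * partial i \<phi> z \<partial>leb N) = - (\<integral>z. (g z i - h z i) * \<phi> z \<partial>leb N)" .
qed

section \<open>Norms of Sobolev functions and smooth approximation\<close>

abbreviation energy :: "real \<Rightarrow> nat \<Rightarrow> (vec \<Rightarrow> vec) \<Rightarrow> ennreal" where
  "energy p N g \<equiv> \<integral>\<^sup>+z. ennreal (nrm N (g z) powr p) \<partial>leb N"

abbreviation Hardy_mass :: "real \<Rightarrow> nat \<Rightarrow> (vec \<Rightarrow> real) \<Rightarrow> ennreal" where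
  "Hardy_mass p N u \<equiv> \<integral>\<^sup>+z. ennreal (\<bar>u z\<bar> powr p * nrm N z powr (- p)) \<partial>leb N"

lemma epowr_inverse: "0 < p \<Longrightarrow> epowr (epowr x (1 / p)) p = x"
  by (cases x) (auto simp: epowr_def powr_powr)

lemma epowr_less:
  assumes "epowr x (1 / p) < ennreal e" "0 < p"
  shows "x < ennreal (e powr p)"
proof (cases x)
  case (real r)
  with assms have "r powr (1 / p) < e" by (auto simp: epowr_def ennreal_less_iff)
  then have "(r powr (1 / p)) powr p < e powr p"
    using assms(2) by (intro powr_less_mono2) auto
  then show ?thesis using real assms(2) by (simp add: powr_powr ennreal_less_iff)
qed (use assms in \<open>auto simp: epowr_def\<close>)

lemma weak_grad_measurable:
  "has_weak_grad N u g \<Longrightarrow> i < N \<Longrightarrow> (\<lambda>z. g z i) \<in> borel_measurable (leb N)"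
  by (intro loc_integrable_measurable) (simp add: has_weak_grad_def)

lemma measurable_L2_set:
  assumes "\<And>i. i \<in> I \<Longrightarrow> (\<lambda>z. g z i) \<in> borel_measurable M"
  shows "(\<lambda>z. L2_set (g z) I) \<in> borel_measurable M"
  unfolding L2_set_def using assms by measurable

lemma grad_norm_eq:
  assumes "has_weak_grad (m + n) u g" "0 < p"
  shows "grad_norm m n p u =
    epowr ((\<integral>\<^sup>+z. ennreal (L2_set (g z) {..<m} powr p) \<partial>leb (m + n)) +
           (\<integral>\<^sup>+z. ennreal (L2_set (g z) {m..<m + n} powr p) \<partial>leb (m + n))) (1 / p)"
proof -
  have ae: "AE z in leb (m + n). \<forall>i<m + n. grad (m + n) u z i = g z i"
    using has_weak_grad_unique has_weak_grad_grad assms(1) by blast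
  have "(\<integral>\<^sup>+z. ennreal (\<bar>L2_set (grad (m + n) u z) I\<bar> powr p) \<partial>leb (m + n)) =
      (\<integral>\<^sup>+z. ennreal (L2_set (g z) I powr p) \<partial>leb (m + n))" if "I \<subseteq> {..<m + n}" for I
  proof (rule nn_integral_cong_AE)
    show "AE z in leb (m + n). ennreal (\<bar>L2_set (grad (m + n) u z) I\<bar> powr p) = ennreal (L2_set (g z) I powr p)"
      using ae
    proof eventually_elim
      case (elim z)
      then have "L2_set (grad (m + n) u z) I = L2_set (g z) I"
        using that by (intro L2_set_cong) auto
      then show ?case by simp
    qed
  qed
  then show ?thesis
    using assms(2) by (simp add: grad_norm_def Lnorm_def epowr_inverse subset_eq)
qed

lemma nrm_le_blocks: "nrm (m + n) x \<le> L2_set x {..<m} + L2_set x {m..<m + n}"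
proof -
  have "(\<Sum>i<m + n. (x i)\<^sup>2) = (\<Sum>i<m. (x i)\<^sup>2) + (\<Sum>i=m..<m + n. (x i)\<^sup>2)"
    by (subst sum.union_disjoint[symmetric]) (auto intro!: sum.cong)
  then show ?thesis
    unfolding L2_set_def by (simp add: sqrt_add_le_add_sqrt sum_nonneg)
qed

lemma powr_add_le:
  fixes a b p :: real
  assumes "0 \<le> a" "0 \<le> b" "0 < p"
  shows "(a + b) powr p \<le> 2 powr p * (a powr p + b powr p)"
proof -
  have "(a + b) powr p \<le> (2 * max a b) powr p"
    using assms by (intro powr_mono2) auto
  also have "\<dots> = 2 powr p * max a b powr p"
    using assms by (simp add: powr_mult)
  also have "\<dots> \<le> 2 powr p * (a powr p + b powr p)"
    by (intro mult_left_mono) (auto simp: max_def)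
  finally show ?thesis .
qed

lemma W1_has_weak_grad: "u \<in> W1 m n p \<Longrightarrow> has_weak_grad (m + n) u (grad (m + n) u)"
  by (auto simp: W1_def intro: has_weak_grad_grad)

text \<open>
  The norm of \<^const>\<open>W1\<close> measures the blocks \<open>grad\<^sub>x\<close> and \<open>grad\<^sub>y\<close> separately; the length of the full
  gradient is at most the sum of the two, at the cost of a factor \<open>2\<^sup>p\<close> in the \<open>p\<close>-th power.
\<close>

lemma W1_approx:
  assumes u: "u \<in> W1 m n p" and g: "has_weak_grad (m + n) u g" and p: "0 < p" and e: "0 < (e::real)"
  obtains \<phi> where "\<phi> \<in> Cc1 (m + n)"
    "(\<integral>\<^sup>+z. ennreal (\<bar>u z - \<phi> z\<bar> powr p) \<partial>leb (m + n)) < ennreal e"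
    "(\<integral>\<^sup>+z. ennreal (nrm (m + n) (\<lambda>i. g z i - partial i \<phi> z) powr p) \<partial>leb (m + n)) < ennreal e"
proof -
  let ?N = "m + n" and ?I = "\<lambda>f. \<integral>\<^sup>+z. ennreal (f z) \<partial>leb (m + n)"
  define d where "d = (e / 2 powr p) powr (1 / p)"
  have d: "0 < d" "d powr p = e / 2 powr p" using e p by (auto simp: d_def powr_powr)
  obtain \<phi> where \<phi>: "\<phi> \<in> Cc1 ?N" and s: "sobolev_norm m n p (\<lambda>z. u z - \<phi> z) < ennreal d"
    using u d(1) unfolding W1_def by force
  let ?h = "\<lambda>z i. g z i - partial i \<phi> z"
  have h: "has_weak_grad ?N (\<lambda>z. u z - \<phi> z) ?h"
    by (rule has_weak_grad_diff[OF g Cc1_has_weak_grad[OF \<phi>]])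
  have 1: "?I (\<lambda>z. \<bar>u z - \<phi> z\<bar> powr p) < ennreal (d powr p)"
  proof (rule epowr_less[OF _ p])
    show "epowr (?I (\<lambda>z. \<bar>u z - \<phi> z\<bar> powr p)) (1 / p) < ennreal d"
      using s unfolding sobolev_norm_def Lnorm_def by (rule le_less_trans[rotated]) simp
  qed
  let ?A = "\<lambda>z. L2_set (?h z) {..<m}" and ?B = "\<lambda>z. L2_set (?h z) {m..<m + n}"
  have hm: "(\<lambda>z. ?h z i) \<in> borel_measurable (leb ?N)" if "i < ?N" for i
    by (rule weak_grad_measurable[OF h that])
  have [measurable]: "?A \<in> borel_measurable (leb ?N)" "?B \<in> borel_measurable (leb ?N)"
    by (intro measurable_L2_set hm; simp)+
  have 2: "?I (\<lambda>z. ?A z powr p) + ?I (\<lambda>z. ?B z powr p) < ennreal (d powr p)"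
  proof (rule epowr_less[OF _ p])
    show "epowr (?I (\<lambda>z. ?A z powr p) + ?I (\<lambda>z. ?B z powr p)) (1 / p) < ennreal d"
      using s unfolding sobolev_norm_def grad_norm_eq[OF h p] by (rule le_less_trans[rotated]) simp
  qed
  have "?I (\<lambda>z. nrm ?N (?h z) powr p) \<le> ?I (\<lambda>z. 2 powr p * (?A z powr p + ?B z powr p))"
  proof (intro nn_integral_mono ennreal_leI)
    fix z
    have "nrm ?N (?h z) powr p \<le> (?A z + ?B z) powr p"
      using p by (intro powr_mono2 nrm_le_blocks) auto
    also have "\<dots> \<le> 2 powr p * (?A z powr p + ?B z powr p)"
      using p by (intro powr_add_le) auto
    finally show "nrm ?N (?h z) powr p \<le> 2 powr p * (?A z powr p + ?B z powr p)" .
  qed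
  also have "\<dots> = ennreal (2 powr p) * (?I (\<lambda>z. ?A z powr p) + ?I (\<lambda>z. ?B z powr p))"
    by (simp add: ennreal_mult nn_integral_cmult nn_integral_add)
  also have "\<dots> < ennreal (2 powr p) * ennreal (d powr p)"
    using 2 by (intro ennreal_mult_strict_left_mono) auto
  also have "\<dots> = ennreal e"
    using d e by (simp flip: ennreal_mult)
  finally have 3: "?I (\<lambda>z. nrm ?N (?h z) powr p) < ennreal e" .
  have "d powr p \<le> e"
    unfolding d(2) using e ge_one_powr_ge_zero[of 2 p] p by (simp add: divide_le_eq)
  then have "?I (\<lambda>z. \<bar>u z - \<phi> z\<bar> powr p) < ennreal e"
    by (rule less_le_trans[OF 1 ennreal_leI])
  from that[OF \<phi> this 3] show thesis .
qed

section \<open>The Hardy inequality\<close>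

lemma DERIV_abs_powr:
  assumes "1 < (p::real)"
  shows "((\<lambda>t. \<bar>t\<bar> powr p) has_field_derivative p * \<bar>t\<bar> powr (p - 1) * sgn t) (at t)"
proof (cases "t = 0")
  case True
  have "((\<lambda>h::real. \<bar>h\<bar> powr p / h) \<longlongrightarrow> 0) (at 0)"
  proof (rule Lim_null_comparison)
    show "eventually (\<lambda>h::real. norm (\<bar>h\<bar> powr p / h) \<le> \<bar>h\<bar> powr (p - 1)) (at 0)"
      by (rule always_eventually) (auto simp: powr_diff)
    have "((\<lambda>h::real. \<bar>h\<bar> powr (p - 1)) \<longlongrightarrow> \<bar>0\<bar> powr (p - 1)) (at 0)"
      using assms by (intro tendsto_powr2 tendsto_intros) (auto intro!: always_eventually)
    then show "((\<lambda>h::real. \<bar>h\<bar> powr (p - 1)) \<longlongrightarrow> 0) (at 0)" by simp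
  qed
  then show ?thesis using True by (simp add: DERIV_def)
next
  case False
  have "((\<lambda>t. \<bar>t\<bar>) has_field_derivative sgn t) (at t)"
  proof (cases "0 < t")
    case True
    then have "eventually (\<lambda>y. \<bar>y\<bar> = y) (nhds t)"
      using eventually_nhds_in_open[of "{0<..}" t] by (auto elim: eventually_mono)
    then show ?thesis using True by (subst DERIV_cong_ev[OF refl _ refl, where g = "\<lambda>y. y"]) auto
  next
    case neg: False
    then have "eventually (\<lambda>y. \<bar>y\<bar> = - y) (nhds t)"
      using False eventually_nhds_in_open[of "{..<0}" t] by (auto elim: eventually_mono)
    then show ?thesis
      using False neg by (subst DERIV_cong_ev[OF refl _ refl, where g = "\<lambda>y. - y"]) (auto intro!: derivative_eq_intros)
  qed
  from DERIV_fun_powr[OF this, of p] False show ?thesis by (simp add: mult_ac)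
qed

lemma continuous_on_abs_powr_deriv:
  assumes "1 < (p::real)"
  shows "continuous_on S (\<lambda>t. p * \<bar>t\<bar> powr (p - 1) * sgn t)"
proof (intro continuous_at_imp_continuous_on ballI)
  fix t :: real
  show "isCont (\<lambda>t. p * \<bar>t\<bar> powr (p - 1) * sgn t) t"
  proof (cases "t = 0")
    case True
    have "((\<lambda>t. p * \<bar>t\<bar> powr (p - 1) * sgn t) \<longlongrightarrow> 0) (at 0)"
    proof (rule Lim_null_comparison)
      show "eventually (\<lambda>t::real. norm (p * \<bar>t\<bar> powr (p - 1) * sgn t) \<le> p * \<bar>t\<bar> powr (p - 1)) (at 0)"
        using assms by (intro always_eventually) (auto simp: abs_mult sgn_if)
      have "((\<lambda>h::real. p * \<bar>h\<bar> powr (p - 1)) \<longlongrightarrow> p * \<bar>0\<bar> powr (p - 1)) (at 0)"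
        using assms by (intro tendsto_powr2 tendsto_intros) (auto intro!: always_eventually)
      then show "((\<lambda>h::real. p * \<bar>h\<bar> powr (p - 1)) \<longlongrightarrow> 0) (at 0)" by simp
    qed
    then show ?thesis using True by (simp add: isCont_def)
  next
    case False
    then show ?thesis by (intro continuous_intros) auto
  qed
qed

text \<open>
  With \<open>c = (N - p) / p\<close> this choice of the weights in Young's inequality gives the best constant in the
  Hardy inequality.
\<close>

lemma weighted_Young:
  fixes X Y c p :: real
  assumes "1 < p" "0 < c" "0 \<le> X" "0 \<le> Y"
  shows "p * (X powr (p - 1) * Y) \<le> (p - 1) * c * X powr p + c powr (1 - p) * Y powr p"
proof -
  let ?q = "p / (p - 1)" and ?a = "c powr ((p - 1) / p) * X powr (p - 1)" and ?b = "c powr (- (p - 1) / p) * Y"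
  have ab: "?a * ?b = X powr (p - 1) * Y"
  proof -
    have "c powr ((p - 1) / p) * c powr (- (p - 1) / p) = 1"
      using assms by (simp flip: powr_add add_divide_distrib)
    then show ?thesis by (simp add: mult_ac)
  qed
  have q: "?q > 1" "1 / ?q + 1 / p = 1" using assms by (auto simp: field_simps)
  have "?a * ?b \<le> ?a powr ?q / ?q + ?b powr p / p"
    by (rule Youngs_inequality) (use assms q in auto)
  moreover have "?a powr ?q = c * X powr p"
    using assms by (simp add: powr_mult powr_powr)
  moreover have "?b powr p = c powr (1 - p) * Y powr p"
    using assms by (simp add: powr_mult powr_powr)
  ultimately have "X powr (p - 1) * Y \<le> c * X powr p * ((p - 1) / p) + c powr (1 - p) * Y powr p / p"
    unfolding ab by (simp add: field_simps)
  then have "p * (X powr (p - 1) * Y) \<le> p * (c * X powr p * ((p - 1) / p) + c powr (1 - p) * Y powr p / p)"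
    using assms by (intro mult_left_mono) auto
  also have "\<dots> = (p - 1) * c * X powr p + c powr (1 - p) * Y powr p"
    using assms by (simp add: field_simps)
  finally show ?thesis .
qed

lemma continuous_on_grad_powr:
  assumes "\<phi> \<in> Cc1 N" "0 < p"
  shows "continuous_on (Rn N) (\<lambda>z. nrm N (\<lambda>i. partial i \<phi> z) powr p)"
  using assms unfolding L2_set_def
  by (intro continuous_on_powr' continuous_intros) (auto simp: Cc1_def sum_nonneg)

lemma integrable_grad_powr:
  assumes \<phi>: "\<phi> \<in> Cc1 N" and p: "0 < p"
  shows "integrable (leb N) (\<lambda>z. nrm N (\<lambda>i. partial i \<phi> z) powr p)"
proof (rule Cc1_support[OF \<phi>], rule integrable_bounded_support)
  fix R assume "\<And>i z. i < N \<Longrightarrow> z \<in> Rn N \<Longrightarrow> R < nrm N z \<Longrightarrow> partial i \<phi> z = 0"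
  then show "bounded_support N (\<lambda>z. nrm N (\<lambda>i. partial i \<phi> z) powr p)"
    by (intro continuous_bounded_support[where R = R] continuous_on_grad_powr \<phi> p) (simp add: L2_set_0')
qed

text \<open>
  The divergence of \<open>\<bar>\<phi>\<bar>\<^sup>p z w\<close> with \<open>w = (\<bar>z\<bar>\<^sup>2 + d)\<^bsup>-p/2\<^esup>\<close> integrates to zero.  Since the divergence of
  \<open>z w\<close> is at least \<open>(N - p) w\<close> and \<open>\<bar>z\<bar> w \<le> w\<^bsup>(p-1)/p\<^esup>\<close>, Young's inequality absorbs the term that contains the
  derivative of \<open>\<phi>\<close>.  The shift \<open>d > 0\<close> keeps the field differentiable at the origin.
\<close>

lemma Hardy_Cc1:
  assumes \<phi>: "\<phi> \<in> Cc1 N" and p: "1 < p" "p < real N" and d: "0 < d"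
  shows "integrable (leb N) (\<lambda>z. \<bar>\<phi> z\<bar> powr p * ((nrm N z)\<^sup>2 + d) powr (- p / 2))" (is "integrable _ ?XP")
    and "(\<integral>z. \<bar>\<phi> z\<bar> powr p * ((nrm N z)\<^sup>2 + d) powr (- p / 2) \<partial>leb N) \<le>
      (p / (real N - p)) powr p * (\<integral>z. nrm N (\<lambda>i. partial i \<phi> z) powr p \<partial>leb N)"
proof -
  define c where "c = (real N - p) / p"
  have c: "0 < c" "p * c = real N - p" using p by (auto simp: c_def)
  let ?P = "\<lambda>z. \<bar>\<phi> z\<bar> powr p"
  let ?P' = "\<lambda>i z. p * \<bar>\<phi> z\<bar> powr (p - 1) * sgn (\<phi> z) * partial i \<phi> z"
  let ?h = "\<lambda>s. (s + d) powr (- p / 2)" and ?h' = "\<lambda>s. (- p / 2) * (s + d) powr (- p / 2 - 1)"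
  let ?w = "\<lambda>z. ?h ((nrm N z)\<^sup>2)" and ?w' = "\<lambda>i z. ?h' ((nrm N z)\<^sup>2) * (2 * z i)"
  let ?Y = "\<lambda>z. nrm N (\<lambda>i. partial i \<phi> z)"
  have P: "C1_with N ?P ?P'"
    using C1_with_compose[OF Cc1_C1_with[OF \<phi>], of "\<lambda>t. \<bar>t\<bar> powr p" "\<lambda>t. p * \<bar>t\<bar> powr (p - 1) * sgn t"]
      DERIV_abs_powr[OF p(1)] continuous_on_abs_powr_deriv[OF p(1)] by blast
  have PC: "?P \<in> Cc1 N"
    by (rule Cc1_support[OF \<phi>]) (rule C1_with_Cc1[OF P], simp)
  have w: "C1_with N ?w ?w'"
  proof (rule C1_with_compose[OF C1_with_sqnorm, where h = ?h and h' = ?h'])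
    fix z
    show "(?h has_real_derivative ?h' ((nrm N z)\<^sup>2)) (at ((nrm N z)\<^sup>2))"
      using d by (auto intro!: derivative_eq_intros simp: add_nonneg_pos)
  next
    show "continuous_on ((\<lambda>z. (nrm N z)\<^sup>2) ` Rn N) ?h'"
      using d by (intro continuous_intros) (auto simp: add_nonneg_eq_0_iff)
  qed
  let ?F = "\<lambda>i z. z i * ?w z" and ?F' = "\<lambda>i z. ?w z + ?w' i z * z i"
  have F: "C1_with N (?F j) (\<lambda>i z. (if i = j then 1 else 0) * ?w z + ?w' i z * z j)" for j
    by (rule C1_with_mult[OF C1_with_coord w])
  let ?D = "\<lambda>i. partial i (\<lambda>z. ?P z * ?F i z)"
  have PF: "(\<lambda>z. ?P z * ?F i z) \<in> Cc1 N" for i by (rule Cc1_mult_C1[OF PC F])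
  have XC: "?XP \<in> Cc1 N" by (rule Cc1_mult_C1[OF PC w])
  then show int: "integrable (leb N) ?XP"
    by (intro integrable_bounded_support Cc1_bounded_support)
  have intY: "integrable (leb N) (\<lambda>z. ?Y z powr p)"
    using p by (intro integrable_grad_powr \<phi>) simp
  have intD: "integrable (leb N) (?D i)" if "i < N" for i
    by (intro integrable_bounded_support partial_bounded_support PF that)
  have point: "c * ?XP z - c powr (1 - p) * ?Y z powr p \<le> (\<Sum>i<N. ?D i z)" if z: "z \<in> Rn N" for z
  proof -
    define s where "s = (nrm N z)\<^sup>2"
    have s0: "0 \<le> s" by (simp add: s_def)
    with d have s: "0 \<le> s" "0 < s + d" by auto
    have sq: "(\<Sum>i<N. z i * z i) = s"
      by (simp add: s_def L2_set_def sum_nonneg power2_eq_square)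
    have Di: "?D i z = ?P' i z * ?F i z + ?F' i z * ?P z" if "i < N" for i
      using partial_mult[OF PC F that z] C1_with_partial[OF P that z] by simp
    let ?q = "\<Sum>i<N. partial i \<phi> z * z i"
    have "(\<Sum>i<N. ?D i z) = (\<Sum>i<N. ?P' i z * ?F i z + ?F' i z * ?P z)"
      using Di by (intro sum.cong) auto
    also have "\<dots> = p * \<bar>\<phi> z\<bar> powr (p - 1) * sgn (\<phi> z) * ?h s * ?q + (real N * ?h s + ?h' s * 2 * s) * ?P z"
      unfolding sum.distrib sum_distrib_left sum_distrib_right[symmetric]
      by (simp add: s_def[symmetric] sq[symmetric] sum.distrib sum_distrib_left sum_distrib_right sum_negf mult_ac)
    also have "\<dots> \<ge> - (p * ((\<bar>\<phi> z\<bar> * (s + d) powr (- 1 / 2)) powr (p - 1) * ?Y z)) + (real N - p) * ?h s * ?P z"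
    proof (rule add_mono)
      have q: "\<bar>?q\<bar> \<le> ?Y z * sqrt s"
      proof -
        have "\<bar>?q\<bar> \<le> (\<Sum>i<N. \<bar>partial i \<phi> z\<bar> * \<bar>z i\<bar>)"
          by (rule order_trans[OF sum_abs]) (simp add: abs_mult)
        also have "\<dots> \<le> ?Y z * nrm N z" by (rule L2_set_mult_ineq)
        finally show ?thesis by (simp add: s_def)
      qed
      have hs: "?h s * sqrt s \<le> ((s + d) powr (- 1 / 2)) powr (p - 1)"
      proof -
        have "sqrt s \<le> (s + d) powr (1 / 2)"
          using s d by (simp add: powr_half_sqrt)
        then have "?h s * sqrt s \<le> ?h s * (s + d) powr (1 / 2)"
          by (intro mult_left_mono) auto
        also have "\<dots> = ((s + d) powr (- 1 / 2)) powr (p - 1)"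
        proof -
          have "- p / 2 + 1 / 2 = (- 1 / 2) * (p - 1)" by (simp add: field_simps)
          then show ?thesis by (simp only: powr_powr flip: powr_add)
        qed
        finally show ?thesis .
      qed
      have "\<bar>p * \<bar>\<phi> z\<bar> powr (p - 1) * sgn (\<phi> z) * ?h s * ?q\<bar> =
          p * \<bar>\<phi> z\<bar> powr (p - 1) * \<bar>sgn (\<phi> z)\<bar> * ?h s * \<bar>?q\<bar>"
        using p by (simp add: abs_mult)
      also have "\<dots> \<le> p * \<bar>\<phi> z\<bar> powr (p - 1) * 1 * ?h s * (?Y z * sqrt s)"
        using p q by (intro mult_mono) (auto simp: sgn_if)
      also have "\<dots> = p * \<bar>\<phi> z\<bar> powr (p - 1) * ?Y z * (?h s * sqrt s)"
        by (simp add: mult_ac)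
      also have "\<dots> \<le> p * \<bar>\<phi> z\<bar> powr (p - 1) * ?Y z * ((s + d) powr (- 1 / 2)) powr (p - 1)"
        using p by (intro mult_left_mono hs) auto
      also have "\<dots> = p * ((\<bar>\<phi> z\<bar> * (s + d) powr (- 1 / 2)) powr (p - 1) * ?Y z)"
        by (simp add: powr_mult mult_ac)
      finally show "- (p * ((\<bar>\<phi> z\<bar> * (s + d) powr (- 1 / 2)) powr (p - 1) * ?Y z)) \<le>
          p * \<bar>\<phi> z\<bar> powr (p - 1) * sgn (\<phi> z) * ?h s * ?q" by linarith
      have "(s + d) powr (- p / 2 - 1) * s \<le> (s + d) powr (- p / 2 - 1) * (s + d)"
        using d by (intro mult_left_mono) auto
      also have "\<dots> = ?h s"
        using s by (simp add: powr_diff)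
      finally have "p * ((s + d) powr (- p / 2 - 1) * s) \<le> p * ?h s"
        using p by (intro mult_left_mono) auto
      then have "(real N - p) * ?h s \<le> real N * ?h s + ?h' s * 2 * s"
        by (simp add: algebra_simps)
      then show "(real N - p) * ?h s * ?P z \<le> (real N * ?h s + ?h' s * 2 * s) * ?P z"
        by (rule mult_right_mono) simp
    qed
    finally have 1: "- (p * ((\<bar>\<phi> z\<bar> * (s + d) powr (- 1 / 2)) powr (p - 1) * ?Y z)) + (real N - p) * ?h s * ?P z
        \<le> (\<Sum>i<N. ?D i z)" .
    define X where "X = \<bar>\<phi> z\<bar> * (s + d) powr (- 1 / 2)"
    have X: "0 \<le> X" "X powr p = ?XP z"
      by (auto simp: X_def powr_mult powr_powr s_def)
    have "p * (X powr (p - 1) * ?Y z) \<le> (p - 1) * c * X powr p + c powr (1 - p) * ?Y z powr p"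
      using p c X by (intro weighted_Young) auto
    moreover have "(real N - p) * ?h s * ?P z = p * c * X powr p"
      unfolding X(2) by (simp add: c(2)[symmetric] s_def mult_ac)
    ultimately show ?thesis
      using 1 unfolding X_def[symmetric] X(2)[symmetric] by (simp add: algebra_simps)
  qed
  have "(\<integral>z. c * ?XP z - c powr (1 - p) * ?Y z powr p \<partial>leb N) \<le> (\<integral>z. (\<Sum>i<N. ?D i z) \<partial>leb N)"
    using point int intY intD by (intro integral_mono) auto
  also have "\<dots> = (\<Sum>i<N. \<integral>z. ?D i z \<partial>leb N)"
    using intD by (intro Bochner_Integration.integral_sum) auto
  also have "\<dots> = 0"
    using integral_partial_Cc1[OF PF] by (intro sum.neutral) auto
  finally have "c * (\<integral>z. ?XP z \<partial>leb N) \<le> c powr (1 - p) * (\<integral>z. ?Y z powr p \<partial>leb N)"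
    using int intY by simp
  then have "(\<integral>z. ?XP z \<partial>leb N) \<le> c powr (1 - p) / c * (\<integral>z. ?Y z powr p \<partial>leb N)"
    using c by (simp add: field_simps)
  also have "c powr (1 - p) / c = (p / (real N - p)) powr p"
  proof -
    have "c powr (1 - p) / c = (1 / c) powr p"
      using c by (simp add: powr_diff powr_divide)
    then show ?thesis by (simp add: c_def)
  qed
  finally show "(\<integral>z. ?XP z \<partial>leb N) \<le> (p / (real N - p)) powr p * (\<integral>z. ?Y z powr p \<partial>leb N)" .
qed

text \<open>
  Convexity of the power, in a form that takes the place of the triangle inequality in \<open>L\<^sub>p\<close>: as \<open>l \<rightarrow> 1\<close> the
  factor of the main term tends to 1.
\<close>

lemma powr_add_convex:
  fixes a b p l :: real
  assumes "0 \<le> a" "0 \<le> b" "1 < p" "0 < l" "l < 1"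
  shows "(a + b) powr p \<le> l powr (1 - p) * a powr p + (1 - l) powr (1 - p) * b powr p"
proof -
  have one: "1 \<le> t powr (1 - p)" if "0 < t" "t < 1" for t
  proof -
    have "1 = t powr 0" using that by simp
    also have "\<dots> \<le> t powr (1 - p)"
      using that assms by (intro powr_mono') auto
    finally show ?thesis .
  qed
  have sc: "t * (x / t) powr p = t powr (1 - p) * x powr p" if "0 < t" "0 \<le> x" for t x
    using that by (simp add: powr_divide powr_diff)
  consider "a = 0" | "b = 0" | "0 < a" "0 < b" using assms by linarith
  then show ?thesis
  proof cases
    case 1
    then show ?thesis using one[of "1 - l"] assms mult_right_mono[of 1 "(1 - l) powr (1 - p)" "b powr p"] by simp
  next
    case 2
    then show ?thesis using one[of l] assms mult_right_mono[of 1 "l powr (1 - p)" "a powr p"] by simp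
  next
    case 3
    have "(l * (a / l) + (1 - l) * (b / (1 - l))) powr p \<le> l * (a / l) powr p + (1 - l) * (b / (1 - l)) powr p"
      using convex_onD[OF powr_convex[of p], of "1 - l" "a / l" "b / (1 - l)"] assms 3 by simp
    then show ?thesis using sc[of l a] sc[of "1 - l" b] assms by simp
  qed
qed

lemma nn_integral_Hardy_Cc1:
  assumes \<phi>: "\<phi> \<in> Cc1 N" and p: "1 < p" "p < real N" and d: "0 < d"
  shows "(\<integral>\<^sup>+z. ennreal (\<bar>\<phi> z\<bar> powr p * ((nrm N z)\<^sup>2 + d) powr (- p / 2)) \<partial>leb N) \<le>
    ennreal ((p / (real N - p)) powr p) * energy p N (\<lambda>z i. partial i \<phi> z)"
proof -
  have "(\<integral>\<^sup>+z. ennreal (\<bar>\<phi> z\<bar> powr p * ((nrm N z)\<^sup>2 + d) powr (- p / 2)) \<partial>leb N) =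
      ennreal (\<integral>z. \<bar>\<phi> z\<bar> powr p * ((nrm N z)\<^sup>2 + d) powr (- p / 2) \<partial>leb N)"
    by (rule nn_integral_eq_integral[OF Hardy_Cc1(1)[OF assms]]) simp
  also have "\<dots> \<le> ennreal ((p / (real N - p)) powr p * (\<integral>z. nrm N (\<lambda>i. partial i \<phi> z) powr p \<partial>leb N))"
    by (rule ennreal_leI[OF Hardy_Cc1(2)[OF assms]])
  also have "\<dots> = ennreal ((p / (real N - p)) powr p) * energy p N (\<lambda>z i. partial i \<phi> z)"
    using p by (subst nn_integral_eq_integral[OF integrable_grad_powr[OF \<phi>]]) (auto simp: ennreal_mult)
  finally show ?thesis .
qed

text \<open>
  The weight is bounded for \<open>d > 0\<close>, so both sides pass to the limit along smooth approximations of \<open>u\<close>.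
\<close>

lemma Hardy_W1_regularized:
  assumes u: "u \<in> W1 m n p" and g: "has_weak_grad (m + n) u g"
    and p: "1 < p" "p < real (m + n)" and d: "0 < d"
  shows "(\<integral>\<^sup>+z. ennreal (\<bar>u z\<bar> powr p * ((nrm (m + n) z)\<^sup>2 + d) powr (- p / 2)) \<partial>leb (m + n)) \<le>
    ennreal ((p / (real (m + n) - p)) powr p) * energy p (m + n) g"
    (is "?L \<le> ennreal ?C * ?G")
proof -
  let ?N = "m + n"
  let ?w = "\<lambda>z. ((nrm ?N z)\<^sup>2 + d) powr (- p / 2)"
  have [measurable]: "u \<in> borel_measurable (leb ?N)"
    using g by (intro loc_integrable_measurable) (simp add: has_weak_grad_def)
  have gm: "(\<lambda>z. g z i) \<in> borel_measurable (leb ?N)" if "i < ?N" for i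
    by (rule weak_grad_measurable[OF g that])
  have [measurable]: "(\<lambda>z. nrm ?N (g z)) \<in> borel_measurable (leb ?N)"
    by (intro measurable_L2_set gm) simp
  have C: "0 < ?C" using p by simp
  show ?thesis
  proof (cases "?G = \<infinity>")
    case True
    then show ?thesis using C p by (simp add: ennreal_mult_top)
  next
    case False
    have step: "?L \<le> ennreal (l powr (1 - p) * (?C * l powr (1 - p))) * ?G" if l: "0 < l" "l < 1" for l
    proof -
      define k where "k = l powr (1 - p)"
      define K where "K = (1 - l) powr (1 - p)"
      have kK: "0 < k" "0 < K" using l by (auto simp: k_def K_def)
      \<comment> \<open>\<open>T\<close> is the total factor of the approximation error in the estimate below.\<close>
      define T where "T = k * ?C * K + K * d powr (- p / 2)"
      have T: "0 < T" using kK C d by (simp add: T_def add_pos_pos)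
      show ?thesis
      proof (rule ennreal_le_epsilon)
        fix e :: real assume e: "0 < e"
        obtain \<phi> where \<phi>: "\<phi> \<in> Cc1 ?N"
          and near: "(\<integral>\<^sup>+z. ennreal (\<bar>u z - \<phi> z\<bar> powr p) \<partial>leb ?N) < ennreal (e / T)"
            "(\<integral>\<^sup>+z. ennreal (nrm ?N (\<lambda>i. g z i - partial i \<phi> z) powr p) \<partial>leb ?N) < ennreal (e / T)"
          using W1_approx[OF u g, where e = "e / T"] p e T by force
        have [measurable]: "\<phi> \<in> borel_measurable (leb ?N)"
          using Cc1_bounded_support[OF \<phi>] by (simp add: bounded_support_def)
        have pm: "partial i \<phi> \<in> borel_measurable (leb ?N)" if "i < ?N" for i
          using partial_bounded_support[OF \<phi> that] by (simp add: bounded_support_def)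
        have [measurable]: "(\<lambda>z. nrm ?N (\<lambda>i. partial i \<phi> z)) \<in> borel_measurable (leb ?N)"
          "(\<lambda>z. nrm ?N (\<lambda>i. g z i - partial i \<phi> z)) \<in> borel_measurable (leb ?N)"
          by (intro measurable_L2_set borel_measurable_diff gm pm; simp)+
        have "?L \<le> (\<integral>\<^sup>+z. ennreal k * ennreal (\<bar>\<phi> z\<bar> powr p * ?w z) +
            ennreal (K * d powr (- p / 2)) * ennreal (\<bar>u z - \<phi> z\<bar> powr p) \<partial>leb ?N)"
        proof (rule nn_integral_mono)
          fix z
          have w: "0 \<le> ?w z" "?w z \<le> d powr (- p / 2)"
            using d p by (auto intro!: powr_mono2')
          have "\<bar>u z\<bar> powr p \<le> (\<bar>\<phi> z\<bar> + \<bar>u z - \<phi> z\<bar>) powr p"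
            using p by (intro powr_mono2) auto
          also have "\<dots> \<le> k * \<bar>\<phi> z\<bar> powr p + K * \<bar>u z - \<phi> z\<bar> powr p"
            unfolding k_def K_def using p l by (intro powr_add_convex) auto
          finally have "\<bar>u z\<bar> powr p * ?w z \<le> (k * \<bar>\<phi> z\<bar> powr p + K * \<bar>u z - \<phi> z\<bar> powr p) * ?w z"
            using w by (intro mult_right_mono)
          also have "\<dots> = k * (\<bar>\<phi> z\<bar> powr p * ?w z) + K * \<bar>u z - \<phi> z\<bar> powr p * ?w z"
            by (simp add: algebra_simps)
          also have "\<dots> \<le> k * (\<bar>\<phi> z\<bar> powr p * ?w z) + K * \<bar>u z - \<phi> z\<bar> powr p * d powr (- p / 2)"
            using w kK by (intro add_left_mono mult_left_mono) auto
          also have "\<dots> = k * (\<bar>\<phi> z\<bar> powr p * ?w z) + K * d powr (- p / 2) * \<bar>u z - \<phi> z\<bar> powr p"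
            by (simp add: mult_ac)
          finally show "ennreal (\<bar>u z\<bar> powr p * ?w z) \<le> ennreal k * ennreal (\<bar>\<phi> z\<bar> powr p * ?w z) +
            ennreal (K * d powr (- p / 2)) * ennreal (\<bar>u z - \<phi> z\<bar> powr p)"
            using w kK by (simp flip: ennreal_mult ennreal_plus add: ennreal_leI)
        qed
        also have "\<dots> = ennreal k * (\<integral>\<^sup>+z. ennreal (\<bar>\<phi> z\<bar> powr p * ?w z) \<partial>leb ?N) +
            ennreal (K * d powr (- p / 2)) * (\<integral>\<^sup>+z. ennreal (\<bar>u z - \<phi> z\<bar> powr p) \<partial>leb ?N)"
          by (simp add: nn_integral_add nn_integral_cmult)
        also have "\<dots> \<le> ennreal k * (ennreal ?C * (ennreal k * ?G + ennreal K * ennreal (e / T))) +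
            ennreal (K * d powr (- p / 2)) * ennreal (e / T)"
        proof (intro add_mono mult_left_mono)
          have "energy p ?N (\<lambda>z i. partial i \<phi> z) \<le>
            (\<integral>\<^sup>+z. ennreal k * ennreal (nrm ?N (g z) powr p) +
               ennreal K * ennreal (nrm ?N (\<lambda>i. g z i - partial i \<phi> z) powr p) \<partial>leb ?N)"
          proof (rule nn_integral_mono)
            fix z
            have "nrm ?N (\<lambda>i. partial i \<phi> z) = nrm ?N (\<lambda>i. g z i + - (g z i - partial i \<phi> z))" by simp
            also have "\<dots> \<le> nrm ?N (g z) + nrm ?N (\<lambda>i. - (g z i - partial i \<phi> z))"
              by (rule L2_set_triangle_ineq)
            also have "nrm ?N (\<lambda>i. - (g z i - partial i \<phi> z)) = nrm ?N (\<lambda>i. g z i - partial i \<phi> z)"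
              unfolding L2_set_def by (simp only: power2_minus)
            finally have "nrm ?N (\<lambda>i. partial i \<phi> z) powr p \<le>
                (nrm ?N (g z) + nrm ?N (\<lambda>i. g z i - partial i \<phi> z)) powr p"
              using p by (intro powr_mono2) auto
            also have "\<dots> \<le> k * nrm ?N (g z) powr p + K * nrm ?N (\<lambda>i. g z i - partial i \<phi> z) powr p"
              unfolding k_def K_def using p l by (intro powr_add_convex) auto
            finally show "ennreal (nrm ?N (\<lambda>i. partial i \<phi> z) powr p) \<le> ennreal k * ennreal (nrm ?N (g z) powr p) +
               ennreal K * ennreal (nrm ?N (\<lambda>i. g z i - partial i \<phi> z) powr p)"
              using kK by (simp flip: ennreal_mult ennreal_plus add: ennreal_leI)
          qed
          also have "\<dots> = ennreal k * ?G +
               ennreal K * (\<integral>\<^sup>+z. ennreal (nrm ?N (\<lambda>i. g z i - partial i \<phi> z) powr p) \<partial>leb ?N)"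
            by (simp add: nn_integral_add nn_integral_cmult)
          also have "\<dots> \<le> ennreal k * ?G + ennreal K * ennreal (e / T)"
            using near(2) by (intro add_mono mult_left_mono) auto
          finally have "ennreal ?C * energy p ?N (\<lambda>z i. partial i \<phi> z) \<le>
              ennreal ?C * (ennreal k * ?G + ennreal K * ennreal (e / T))"
            by (rule mult_left_mono) simp
          with nn_integral_Hardy_Cc1[OF \<phi> p d]
          show "(\<integral>\<^sup>+z. ennreal (\<bar>\<phi> z\<bar> powr p * ?w z) \<partial>leb ?N) \<le>
              ennreal ?C * (ennreal k * ?G + ennreal K * ennreal (e / T))"
            by (rule order_trans)
        qed (use near(1) in auto)
        also have "\<dots> = ennreal (k * (?C * k)) * ?G + ennreal (T * (e / T))"
        proof (cases ?G)
          case (real G)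
          have "k * (?C * (k * G + K * E)) + K * d powr (- p / 2) * E = k * (?C * k) * G + T * E" for E
            by (simp add: T_def algebra_simps)
          note this[of "e / T"]
          with real kK C T e show ?thesis
            by (simp flip: ennreal_mult ennreal_plus)
        qed (use False in simp)
        finally show "?L \<le> ennreal (l powr (1 - p) * (?C * l powr (1 - p))) * ?G + ennreal e"
          using T by (simp add: k_def)
      qed
    qed
    have "(\<lambda>j. 1 - inverse (real (Suc (Suc j)))) \<longlonglongrightarrow> 1 - 0"
      by (intro tendsto_intros LIMSEQ_Suc[OF LIMSEQ_inverse_real_of_nat])
    then have "(\<lambda>j. ennreal ((1 - inverse (real (Suc (Suc j)))) powr (1 - p) * (?C * (1 - inverse (real (Suc (Suc j)))) powr (1 - p))) * ?G)
        \<longlonglongrightarrow> ennreal ((1 - 0) powr (1 - p) * (?C * (1 - 0) powr (1 - p))) * ?G"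
      using False p
      by (intro ennreal_tendsto_cmult[of ?G, simplified mult.commute] tendsto_ennrealI tendsto_mult tendsto_powr tendsto_const)
         (auto simp: less_top)
    then have "?L \<le> ennreal ((1 - 0) powr (1 - p) * (?C * (1 - 0) powr (1 - p))) * ?G"
      by (rule LIMSEQ_le_const) (intro exI[of _ 0] allI impI step; simp add: field_simps)
    then show ?thesis by simp
  qed
qed

text \<open>
  The right-hand side of the Hardy inequality vanishes, and the weight on the left is positive.
\<close>

lemma W1_zero_grad:
  assumes u: "u \<in> W1 m n p" and g: "has_weak_grad (m + n) u g" and p: "1 < p" "p < real (m + n)"
    and 0: "AE z in leb (m + n). \<forall>i<m + n. g z i = 0"
  shows "AE z in leb (m + n). u z = 0"
proof -
  have [measurable]: "u \<in> borel_measurable (leb (m + n))"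
    using g by (intro loc_integrable_measurable) (simp add: has_weak_grad_def)
  have "energy p (m + n) g = (\<integral>\<^sup>+z. 0 \<partial>leb (m + n))"
  proof (rule nn_integral_cong_AE)
    show "AE z in leb (m + n). ennreal (nrm (m + n) (g z) powr p) = 0"
      using 0 by eventually_elim (simp add: L2_set_0')
  qed
  then have "(\<integral>\<^sup>+z. ennreal (\<bar>u z\<bar> powr p * ((nrm (m + n) z)\<^sup>2 + 1) powr (- p / 2)) \<partial>leb (m + n)) = 0"
    using Hardy_W1_regularized[OF u g p, of 1] by simp
  then have "AE z in leb (m + n). ennreal (\<bar>u z\<bar> powr p * ((nrm (m + n) z)\<^sup>2 + 1) powr (- p / 2)) = 0"
    by (subst (asm) nn_integral_0_iff_AE) auto
  then show ?thesis
  proof eventually_elim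
    case (elim z)
    have "0 < ((nrm (m + n) z)\<^sup>2 + 1) powr (- p / 2)" by (simp add: add_nonneg_eq_0_iff)
    then have "\<bar>u z\<bar> powr p = 0"
      using elim by (metis ennreal_eq_0_iff mult_le_0_iff not_le powr_ge_zero order_antisym)
    then show ?case by simp
  qed
qed

lemma Hardy_W1:
  assumes u: "u \<in> W1 m n p" and g: "has_weak_grad (m + n) u g"
    and p: "1 < p" "p < real (m + n)"
  shows "Hardy_mass p (m + n) u \<le>
    ennreal ((p / (real (m + n) - p)) powr p) * energy p (m + n) g"
proof -
  let ?N = "m + n"
  have [measurable]: "u \<in> borel_measurable (leb ?N)"
    using g by (intro loc_integrable_measurable) (simp add: has_weak_grad_def)
  let ?d = "\<lambda>j. inverse (real (Suc j))"
  let ?f = "\<lambda>j z. ennreal (\<bar>u z\<bar> powr p * ((nrm ?N z)\<^sup>2 + ?d j) powr (- p / 2))"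
  have "Hardy_mass p ?N u \<le> (\<integral>\<^sup>+z. liminf (\<lambda>j. ?f j z) \<partial>leb ?N)"
  proof (rule nn_integral_mono)
    fix z
    show "ennreal (\<bar>u z\<bar> powr p * nrm ?N z powr (- p)) \<le> liminf (\<lambda>j. ?f j z)"
    proof (cases "nrm ?N z = 0")
      case False
      then have pos: "0 < (nrm ?N z)\<^sup>2" by simp
      have "(\<lambda>j. (nrm ?N z)\<^sup>2 + ?d j) \<longlonglongrightarrow> (nrm ?N z)\<^sup>2 + 0"
        by (intro tendsto_intros LIMSEQ_inverse_real_of_nat)
      then have "(\<lambda>j. ?f j z) \<longlonglongrightarrow> ennreal (\<bar>u z\<bar> powr p * ((nrm ?N z)\<^sup>2) powr (- p / 2))"
        using pos by (intro tendsto_ennrealI tendsto_mult tendsto_const tendsto_powr) auto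
      also have "((nrm ?N z)\<^sup>2) powr (- p / 2) = nrm ?N z powr (- p)"
        using False by (simp add: powr_powr flip: powr_numeral) 
      finally show ?thesis
        using lim_imp_Liminf trivial_limit_sequentially by fastforce
    qed simp
  qed
  also have "\<dots> \<le> liminf (\<lambda>j. \<integral>\<^sup>+z. ?f j z \<partial>leb ?N)"
    by (rule nn_integral_liminf) measurable
  also have "\<dots> \<le> liminf (\<lambda>j. ennreal ((p / (real ?N - p)) powr p) * energy p ?N g)"
    by (intro Liminf_mono always_eventually allI Hardy_W1_regularized[OF u g p]) simp
  also have "\<dots> = ennreal ((p / (real ?N - p)) powr p) * energy p ?N g"
    by (simp add: Liminf_const)
  finally show ?thesis .
qed

section \<open>Integration of radial functions\<close>

definition vball :: "nat \<Rightarrow> real" where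
  "vball N = measure (leb N) {z \<in> Rn N. nrm N z < 1}"

lemma leb_scale:
  assumes b: "0 < b"
  shows "density (distr (leb N) (leb N) (\<lambda>z. \<lambda>i\<in>{..<N}. b * z i)) (\<lambda>_. ennreal (b ^ N)) = leb N"
    (is "?P = _")
proof -
  let ?s = "\<lambda>z. \<lambda>i\<in>{..<N}. b * z i"
  have sm [measurable]: "?s \<in> measurable (leb N) (leb N)"
    unfolding leb_def by measurable
  have "?P = (\<Pi>\<^sub>M i\<in>{..<N}. lborel)"
  proof (rule lborels.PiM_eqI)
    show "sets ?P = sets (\<Pi>\<^sub>M i\<in>{..<N}. lborel)" by (simp add: leb_def)
    fix A :: "nat \<Rightarrow> real set" assume A: "\<And>i. i \<in> {..<N} \<Longrightarrow> A i \<in> sets lborel"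
    let ?B = "\<lambda>i. (\<lambda>x. b * x) -` A i"
    have B: "?B i \<in> sets borel" if "i < N" for i
      using measurable_sets[of "\<lambda>x. b * x" borel borel "A i"] A[of i] that by simp
    have AS: "Pi\<^sub>E {..<N} A \<in> sets (leb N)"
      unfolding leb_def using A by (intro sets_PiM_I_finite) auto
    have one: "emeasure lborel (A i) = ennreal b * emeasure lborel (?B i)" if "i < N" for i
    proof -
      have "emeasure lborel (A i) = emeasure (density (distr lborel borel (\<lambda>x. 0 + b * x)) (\<lambda>_. ennreal \<bar>b\<bar>)) (A i)"
        using lborel_real_affine[of b 0] b by simp
      also have "\<dots> = ennreal b * emeasure (distr lborel borel (\<lambda>x. b * x)) (A i)"
        using A[of i] that b by (subst emeasure_density_const) auto
      also have "emeasure (distr lborel borel (\<lambda>x. b * x)) (A i) = emeasure lborel (?B i)"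
        using A[of i] that by (subst emeasure_distr) auto
      finally show ?thesis .
    qed
    have "emeasure ?P (Pi\<^sub>E {..<N} A) = ennreal (b ^ N) * emeasure (distr (leb N) (leb N) ?s) (Pi\<^sub>E {..<N} A)"
      using AS by (subst emeasure_density_const) auto
    also have "emeasure (distr (leb N) (leb N) ?s) (Pi\<^sub>E {..<N} A) = emeasure (leb N) (?s -` Pi\<^sub>E {..<N} A \<inter> space (leb N))"
      using AS by (subst emeasure_distr) auto
    also have "?s -` Pi\<^sub>E {..<N} A \<inter> space (leb N) = Pi\<^sub>E {..<N} ?B"
      by (rule set_eqI) (simp add: Rn_def PiE_iff conj_commute)
    also have "emeasure (leb N) (Pi\<^sub>E {..<N} ?B) = (\<Prod>i<N. emeasure lborel (?B i))"
      unfolding leb_def using B by (intro lborels.emeasure_PiM) auto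
    also have "ennreal (b ^ N) * \<dots> = (\<Prod>i<N. ennreal b * emeasure lborel (?B i))"
      using b by (simp add: prod.distrib ennreal_power)
    also have "\<dots> = (\<Prod>i<N. emeasure lborel (A i))"
      using one by (intro prod.cong) auto
    finally show "emeasure ?P (Pi\<^sub>E {..<N} A) = (\<Prod>i<N. emeasure lborel (A i))" .
  qed simp
  then show ?thesis by (simp add: leb_def)
qed

lemma nrm_scale: "0 \<le> b \<Longrightarrow> nrm N (\<lambda>i\<in>{..<N}. b * z i) = b * nrm N z"
proof -
  assume "0 \<le> b"
  have "nrm N (\<lambda>i\<in>{..<N}. b * z i) = nrm N (\<lambda>i. b * z i)" by (rule L2_set_cong) auto
  also have "\<dots> = b * nrm N z" using L2_set_right_distrib[OF \<open>0 \<le> b\<close>, of z "{..<N}"] by simp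
  finally show ?thesis .
qed

lemma sets_oball [measurable]: "{z \<in> Rn N. nrm N z < b} \<in> sets (leb N)"
  using measurable_sets[OF measurable_nrm, of "{..<b}" N]
  by (simp add: vimage_def Int_def conj_commute)

lemma emeasure_unit_ball: "emeasure (leb N) {z \<in> Rn N. nrm N z < 1} = ennreal (vball N)"
proof -
  have "emeasure (leb N) {z \<in> Rn N. nrm N z < 1} \<le> emeasure (leb N) {z \<in> Rn N. nrm N z \<le> 1}"
    by (rule emeasure_mono) (auto intro: sets_ball)
  also have "\<dots> < \<infinity>" by (rule emeasure_ball_finite)
  finally show ?thesis unfolding vball_def by (intro emeasure_eq_ennreal_measure) auto
qed

lemma emeasure_obox_pos:
  assumes "\<And>i. i < N \<Longrightarrow> a i < b i"
  shows "0 < emeasure (leb N) (obox N a b)"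
proof -
  have "emeasure (leb N) (obox N a b) = (\<Prod>i<N. emeasure lborel {a i<..<b i})"
    unfolding leb_def obox_def by (rule lborels.emeasure_PiM) auto
  also have "\<dots> = (\<Prod>i<N. ennreal (b i - a i))"
    using assms by (intro prod.cong) (auto simp: less_imp_le)
  also have "\<dots> = ennreal (\<Prod>i<N. b i - a i)"
    using assms by (intro prod_ennreal) (auto simp: less_imp_le)
  also have "\<dots> > 0"
  proof -
    have "0 < (\<Prod>i<N. b i - a i)" using assms by (intro prod_pos) auto
    then show ?thesis by simp
  qed
  finally show ?thesis .
qed

lemma vball_pos: "0 < vball N"
proof -
  let ?e = "1 / (2 * real (N + 1))"
  have "nrm N z < 1" if z: "z \<in> obox N (\<lambda>_. - ?e) (\<lambda>_. ?e)" for z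
  proof -
    have "nrm N z \<le> (\<Sum>i<N. \<bar>- ?e\<bar> + \<bar>?e\<bar>)" by (rule obox_nrm_le[OF z])
    also have "\<dots> = real N / real (N + 1)" by (simp add: field_simps)
    also have "\<dots> < 1" by simp
    finally show ?thesis .
  qed
  then have sub: "obox N (\<lambda>_. - ?e) (\<lambda>_. ?e) \<subseteq> {z \<in> Rn N. nrm N z < 1}"
    using obox_subset by blast
  have "0 < emeasure (leb N) (obox N (\<lambda>_. - ?e) (\<lambda>_. ?e))"
    by (rule emeasure_obox_pos) (simp add: minus_less_iff)
  also have "\<dots> \<le> emeasure (leb N) {z \<in> Rn N. nrm N z < 1}"
    using sub by (rule emeasure_mono) (rule sets_oball)
  finally show ?thesis by (simp add: emeasure_unit_ball)
qed

lemma emeasure_oball: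
  assumes b: "0 < b"
  shows "emeasure (leb N) {z \<in> Rn N. nrm N z < b} = ennreal (vball N * b ^ N)"
proof -
  let ?s = "\<lambda>z. \<lambda>i\<in>{..<N}. b * z i" and ?S = "{z \<in> Rn N. nrm N z < b}"
  have sm [measurable]: "?s \<in> measurable (leb N) (leb N)"
    unfolding leb_def by measurable
  have "emeasure (leb N) ?S = emeasure (density (distr (leb N) (leb N) ?s) (\<lambda>_. ennreal (b ^ N))) ?S"
    by (simp add: leb_scale[OF b])
  also have "\<dots> = ennreal (b ^ N) * emeasure (distr (leb N) (leb N) ?s) ?S"
    using sets_oball by (subst emeasure_density_const) auto
  also have "emeasure (distr (leb N) (leb N) ?s) ?S = emeasure (leb N) (?s -` ?S \<inter> space (leb N))"
    using sets_oball by (subst emeasure_distr) auto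
  also have "?s -` ?S \<inter> space (leb N) = {z \<in> Rn N. nrm N z < 1}"
  proof (rule set_eqI)
    fix z
    have "?s z \<in> Rn N" by (simp add: Rn_def PiE_iff)
    moreover have "nrm N (?s z) = b * nrm N z" using b by (simp add: nrm_scale)
    ultimately show "z \<in> ?s -` ?S \<inter> space (leb N) \<longleftrightarrow> z \<in> {z \<in> Rn N. nrm N z < 1}"
      using b by (simp add: conj_commute)
  qed
  finally show ?thesis
    using b vball_pos[of N] by (simp add: emeasure_unit_ball ennreal_mult[symmetric] mult.commute less_imp_le)
qed

text \<open>
  The area of the sphere of radius \<open>r\<close>, extended by zero to negative radii.
\<close>

definition rdens :: "nat \<Rightarrow> real \<Rightarrow> real" where
  "rdens N r = indicator {0..} r * (real N * vball N * r ^ (N - 1))"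

lemma rdens_nonneg [simp]: "0 \<le> rdens N r"
  using vball_pos[of N] by (auto simp: rdens_def indicator_def)

lemma measurable_rdens [measurable]: "rdens N \<in> borel_measurable borel"
  unfolding rdens_def by measurable

text \<open>
  A ball of radius \<open>r\<close> has volume \<open>vball N * r ^ N\<close> by scaling, so the derivative of this expression is
  the density of the norm.
\<close>

lemma distr_nrm:
  assumes N: "1 \<le> N"
  shows "distr (leb N) borel (nrm N) = density lborel (\<lambda>r. ennreal (rdens N r))"
proof (rule measure_eqI_generator_eq[where E = "range lessThan" and \<Omega> = UNIV and A = "\<lambda>j. {..<real j}"])
  have sig: "sets (borel :: real measure) = sigma_sets UNIV (range lessThan)"
  proof -
    have "sets (borel :: real measure) = sets (sigma UNIV (range lessThan))"
      by (rule arg_cong[OF borel_Iio])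
    also have "\<dots> = sigma_sets UNIV (range lessThan)" by (rule sets_measure_of) auto
    finally show ?thesis .
  qed
  then show "sets (distr (leb N) borel (nrm N)) = sigma_sets UNIV (range lessThan)"
    "sets (density lborel (\<lambda>r. ennreal (rdens N r))) = sigma_sets UNIV (range lessThan)"
    by auto
  show "Int_stable (range (lessThan :: real \<Rightarrow> real set))"
    unfolding Int_stable_def
  proof (intro ballI)
    fix A B :: "real set" assume "A \<in> range lessThan" "B \<in> range lessThan"
    then obtain a b where "A = {..<a}" "B = {..<b}" by auto
    then have "A \<inter> B = {..<min a b}" by auto
    then show "A \<inter> B \<in> range lessThan" by simp
  qed
  have L: "emeasure (distr (leb N) borel (nrm N)) {..<b} = ennreal (vball N * (max 0 b) ^ N)" for b
  proof -
    have "nrm N -` {..<b} \<inter> space (leb N) = {z \<in> Rn N. nrm N z < b}" by auto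
    then have *: "emeasure (distr (leb N) borel (nrm N)) {..<b} = emeasure (leb N) {z \<in> Rn N. nrm N z < b}"
      by (subst emeasure_distr) auto
    show ?thesis
    proof (cases "0 < b")
      case False
      then have e: "{z \<in> Rn N. nrm N z < b} = {}"
        by (auto simp: not_less intro: order_trans[OF _ L2_set_nonneg])
      show ?thesis unfolding * e using False N by (cases N) (auto simp: max_def)
    qed (use * emeasure_oball in simp)
  qed
  show "emeasure (distr (leb N) borel (nrm N)) {..<real i} \<noteq> \<infinity>" for i
    by (simp add: L)
  show "(\<Union>i. {..<real i}) = UNIV"
    using reals_Archimedean2 by blast
  show "range (\<lambda>j. {..<real j}) \<subseteq> range lessThan" by blast
  fix X :: "real set" assume "X \<in> range lessThan"
  then obtain b where X: "X = {..<b}" by auto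
  have "emeasure (density lborel (\<lambda>r. ennreal (rdens N r))) X = (\<integral>\<^sup>+r. ennreal (rdens N r) * indicator {..<b} r \<partial>lborel)"
    unfolding X by (subst emeasure_density) auto
  also have "\<dots> = (\<integral>\<^sup>+r. ennreal (real N * vball N * r ^ (N - 1)) * indicator {0..max 0 b} r \<partial>lborel)"
  proof (rule nn_integral_cong_AE)
    have "AE r in lborel. r \<noteq> b \<and> r \<noteq> 0" by (intro AE_conjI AE_lborel_singleton)
    then show "AE r in lborel. ennreal (rdens N r) * indicator {..<b} r =
        ennreal (real N * vball N * r ^ (N - 1)) * indicator {0..max 0 b} r"
      by eventually_elim (auto simp: rdens_def indicator_def max_def)
  qed
  also have "\<dots> = ennreal (vball N * (max 0 b) ^ N - vball N * 0 ^ N)"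
  proof (rule nn_integral_FTC_Icc)
    fix r
    show "((\<lambda>r. vball N * r ^ N) has_field_derivative real N * vball N * r ^ (N - 1)) (at r)"
      by (auto intro!: derivative_eq_intros)
  next
    fix r :: real assume "r \<in> {0..max 0 b}"
    then show "0 \<le> real N * vball N * r ^ (N - 1)" using vball_pos[of N] by auto
  qed auto
  also have "\<dots> = emeasure (distr (leb N) borel (nrm N)) X"
  proof -
    show ?thesis unfolding X L using N by (cases N) auto
  qed
  finally show "emeasure (distr (leb N) borel (nrm N)) X = emeasure (density lborel (\<lambda>r. ennreal (rdens N r))) X" ..
qed simp

lemma nn_integral_radial:
  assumes "1 \<le> N" and [measurable]: "F \<in> borel_measurable borel"
  shows "(\<integral>\<^sup>+z. F (nrm N z) \<partial>leb N) = (\<integral>\<^sup>+r. ennreal (rdens N r) * F r \<partial>lborel)"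
proof -
  have "(\<integral>\<^sup>+z. F (nrm N z) \<partial>leb N) = (\<integral>\<^sup>+r. F r \<partial>distr (leb N) borel (nrm N))"
    by (subst nn_integral_distr) auto
  also have "\<dots> = (\<integral>\<^sup>+r. ennreal (rdens N r) * F r \<partial>lborel)"
    unfolding distr_nrm[OF assms(1)] by (subst nn_integral_density) auto
  finally show ?thesis .
qed

lemma integrable_radial_iff:
  fixes F :: "real \<Rightarrow> real"
  assumes "1 \<le> N" and [measurable]: "F \<in> borel_measurable borel"
  shows "integrable (leb N) (\<lambda>z. F (nrm N z)) \<longleftrightarrow> integrable lborel (\<lambda>r. rdens N r * F r)"
proof -
  have "integrable (leb N) (\<lambda>z. F (nrm N z)) \<longleftrightarrow> integrable (distr (leb N) borel (nrm N)) F"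
    by (subst integrable_distr_eq) auto
  also have "\<dots> \<longleftrightarrow> integrable lborel (\<lambda>r. rdens N r * F r)"
    unfolding distr_nrm[OF assms(1)] by (subst integrable_density) auto
  finally show ?thesis .
qed

lemma integral_radial:
  fixes F :: "real \<Rightarrow> real"
  assumes "1 \<le> N" and [measurable]: "F \<in> borel_measurable borel"
  shows "(\<integral>z. F (nrm N z) \<partial>leb N) = (\<integral>r. rdens N r * F r \<partial>lborel)"
proof -
  have "(\<integral>z. F (nrm N z) \<partial>leb N) = (\<integral>r. F r \<partial>distr (leb N) borel (nrm N))"
    by (subst integral_distr) auto
  also have "\<dots> = (\<integral>r. rdens N r * F r \<partial>lborel)"
    unfolding distr_nrm[OF assms(1)] by (subst integral_density) auto
  finally show ?thesis .
qed

lemma AE_radial: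
  assumes "1 \<le> N" and P: "{r. P r} \<in> sets borel" and ae: "AE r in lborel. 0 < r \<longrightarrow> P r"
  shows "AE z in leb N. P (nrm N z)"
proof -
  have "AE r in lborel. ennreal (rdens N r) > 0 \<longrightarrow> P r"
    using ae AE_lborel_singleton[of 0]
    by eventually_elim (auto simp: rdens_def indicator_def split: if_splits)
  then have "AE r in distr (leb N) borel (nrm N). P r"
    unfolding distr_nrm[OF assms(1)] by (subst AE_density) auto
  then show ?thesis
    by (subst (asm) AE_distr_iff) (use P in auto)
qed

lemma AE_nrm_neq:
  assumes "1 \<le> N"
  shows "AE z in leb N. nrm N z \<noteq> r"
proof (rule AE_radial[OF assms, where P = "\<lambda>s. s \<noteq> r"])
  have "{s. s \<noteq> r} = - {r}" by auto
  then show "{s. s \<noteq> r} \<in> sets borel" by simp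
  show "AE s in lborel. 0 < s \<longrightarrow> s \<noteq> r"
    using AE_lborel_singleton[of r] by eventually_elim simp
qed

section \<open>Representatives continuous off the origin\<close>

lemma nrm_eq_0_iff: "z \<in> Rn N \<Longrightarrow> nrm N z = 0 \<longleftrightarrow> z = origin N"
  unfolding L2_set_eq_0_iff[OF finite_lessThan] origin_def
  by (auto simp: Rn_def PiE_def intro!: extensionalityI)

text \<open>
  Near a point off the origin where \<open>v\<close> and \<open>w\<close> differ, they differ on an open box, which has positive measure.
\<close>

lemma continuous_AE_eq_imp_eq:
  assumes v: "continuous_on (Rn N - {origin N}) v" and w: "continuous_on (Rn N - {origin N}) w"
    and ae: "AE z in leb N. v z = w z" and z: "z \<in> Rn N - {origin N}"
  shows "v z = (w z :: real)"
proof (rule ccontr)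
  assume "v z \<noteq> w z"
  let ?S = "Rn N - {origin N}"
  have "openin (top_of_set ?S) (?S \<inter> (\<lambda>z. v z - w z) -` (- {0}))"
    by (intro continuous_openin_preimage_gen continuous_on_diff v w) auto
  then obtain U where U: "open U" "?S \<inter> (\<lambda>z. v z - w z) -` (- {0}) = ?S \<inter> U"
    unfolding openin_open by blast
  have "z \<in> ?S \<inter> (\<lambda>z. v z - w z) -` (- {0})" using z \<open>v z \<noteq> w z\<close> by simp
  then have zU: "z \<in> U" unfolding U(2) by blast
  have "openin (product_topology (\<lambda>_. euclidean) UNIV) U"
    using U(1) by (simp only: open_fun_def)
  from product_topology_open_contains_basis[OF this zU]
  obtain X where X: "z \<in> Pi\<^sub>E UNIV X" "\<And>i. open (X i)" "Pi\<^sub>E UNIV X \<subseteq> U"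
    by (auto simp only: open_openin[symmetric])
  obtain j where j: "j < N" "z j \<noteq> 0"
  proof -
    have "nrm N z \<noteq> 0" using z nrm_eq_0_iff by blast
    then show ?thesis using that by (auto simp: L2_set_eq_0_iff)
  qed
  \<comment> \<open>One nonzero coordinate keeps the whole box away from the origin.\<close>
  define Y where "Y = (\<lambda>i. X i \<inter> (if i = j then - {0} else UNIV))"
  have Y: "open (Y i)" "z i \<in> Y i" for i
    using X(1,2) j by (auto simp: Y_def PiE_iff)
  then have "\<forall>i. \<exists>e>0. ball (z i) e \<subseteq> Y i" by (meson openE)
  then obtain e where e: "\<And>i. 0 < e i" "\<And>i. ball (z i) (e i) \<subseteq> Y i" by metis
  let ?B = "obox N (\<lambda>i. z i - e i) (\<lambda>i. z i + e i)"
  have B: "x \<in> ?S \<inter> U" if x: "x \<in> ?B" for x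
  proof -
    have xi: "x i \<in> Y i" if "i < N" for i
    proof -
      have "z i - e i < x i" "x i < z i + e i" using x that by (auto simp: obox_eq)
      then have "x i \<in> ball (z i) (e i)" by (simp add: dist_real_def abs_less_iff)
      then show ?thesis using e(2) by blast
    qed
    have xR: "x \<in> Rn N" using x obox_subset by blast
    have "x i = z i" if "\<not> i < N" for i
      using xR z that by (auto simp: Rn_def PiE_iff extensional_def)
    then have "x i \<in> Y i" for i using xi Y(2) by metis
    then have "x \<in> Pi\<^sub>E UNIV X" by (auto simp: Y_def PiE_iff)
    moreover have "x j \<noteq> 0" using xi[OF j(1)] by (simp add: Y_def)
    then have "x \<noteq> origin N" using j(1) by (auto simp: origin_def)
    ultimately show ?thesis using X(3) xR by blast
  qed
  have "AE x in leb N. x \<notin> ?B"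
    using ae
  proof eventually_elim
    case (elim x)
    show ?case
    proof
      assume "x \<in> ?B"
      then have "x \<in> ?S \<inter> (\<lambda>z. v z - w z) -` (- {0})" using B U(2) by simp
      with elim show False by simp
    qed
  qed
  then have "?B \<in> null_sets (leb N)"
    by (simp add: AE_iff_null_sets[OF obox_sets])
  moreover have "0 < emeasure (leb N) ?B"
    using e(1) by (intro emeasure_obox_pos) (simp add: add_pos_pos)
  ultimately show False by auto
qed

lemma cont_rep_eq:
  assumes v: "continuous_on (Rn N - {origin N}) v" and ae: "AE z in leb N. v z = u z"
    and z: "z \<in> Rn N - {origin N}"
  shows "cont_rep N u z = v z"
proof -
  let ?P = "\<lambda>v. continuous_on (Rn N - {origin N}) v \<and> (AE z in leb N. v z = u z)"
  have "?P (cont_rep N u)"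
    unfolding cont_rep_def by (rule someI[of ?P v]) (use v ae in auto)
  then have c: "continuous_on (Rn N - {origin N}) (cont_rep N u)" "AE z in leb N. cont_rep N u z = u z" by auto
  from c(2) ae have "AE z in leb N. cont_rep N u z = v z" by eventually_elim simp
  from continuous_AE_eq_imp_eq[OF c(1) v this z] show ?thesis .
qed

text \<open>
  The point \<open>(x, 0)\<close> has the norm of \<open>x\<close>.
\<close>

lemma trace_radial:
  assumes m: "1 \<le> m" and V: "continuous_on {0<..} V" and ae: "AE z in leb (m + n). V (nrm (m + n) z) = u z"
  shows "AE x in leb m. trace_op m n u x = V (nrm m x)"
  using AE_nrm_neq[OF m, of 0] AE_space
proof eventually_elim
  case (elim x)
  let ?z = "\<lambda>i\<in>{..<m + n}. if i < m then x i else 0"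
  have "(\<Sum>i<m + n. (?z i)\<^sup>2) = (\<Sum>i<m. (x i)\<^sup>2)"
    by (rule sum.mono_neutral_cong_right) auto
  then have nz: "nrm (m + n) ?z = nrm m x" by (simp add: L2_set_def)
  have zR: "?z \<in> Rn (m + n)" by (simp add: Rn_def PiE_iff)
  have "?z \<noteq> origin (m + n)"
    using nrm_eq_0_iff[OF zR] elim(1) nz by simp
  then have z: "?z \<in> Rn (m + n) - {origin (m + n)}" using zR by simp
  have "continuous_on (Rn (m + n) - {origin (m + n)}) (\<lambda>z. V (nrm (m + n) z))"
  proof (rule continuous_on_compose2[OF V continuous_on_nrm])
    show "nrm (m + n) ` (Rn (m + n) - {origin (m + n)}) \<subseteq> {0<..}"
      using nrm_eq_0_iff by (fastforce simp: less_le)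
  qed
  from cont_rep_eq[OF this ae z] show ?case
    unfolding trace_op_def by (simp add: nz)
qed

section \<open>The continuous representative of a radial weakly differentiable function\<close>

text \<open>
  A profile that vanishes near zero is a smooth function of \<open>\<bar>z\<bar>\<^sup>2\<close>, which is differentiable everywhere, unlike
  the norm.
\<close>

lemma C1_with_radial:
  assumes d: "\<And>r. 0 < r \<Longrightarrow> (g has_field_derivative g' r) (at r)" and c: "continuous_on {0<..} g'"
    and a: "0 < a" and zero: "\<And>r. r < a \<Longrightarrow> g r = 0" "\<And>r. r < a \<Longrightarrow> g' r = 0"
  shows "C1_with N (\<lambda>z. g (nrm N z)) (\<lambda>i z. g' (nrm N z) * z i / nrm N z)"
proof -
  let ?h = "\<lambda>s. g (sqrt s)" and ?h' = "\<lambda>s. g' (sqrt s) / (2 * sqrt s)"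
  have near: "eventually (\<lambda>s. ?h s = 0) (nhds s)" "eventually (\<lambda>s. ?h' s = 0) (nhds s)" if "s < a\<^sup>2" for s
  proof -
    have ev: "eventually (\<lambda>s. s < a\<^sup>2) (nhds s)"
      using eventually_nhds_in_open[of "{..<a\<^sup>2}" s] that by simp
    have "sqrt s < a" if "s < a\<^sup>2" for s
      using real_sqrt_less_mono[OF that] a by simp
    with zero show "eventually (\<lambda>s. ?h s = 0) (nhds s)" "eventually (\<lambda>s. ?h' s = 0) (nhds s)"
      by (auto intro: eventually_mono[OF ev])
  qed
  have der: "(?h has_field_derivative ?h' s) (at s)" if "0 \<le> s" for s
  proof (cases "s < a\<^sup>2")
    case True
    have "?h' s = 0" using near(2)[OF True] by (rule eventually_nhds_x_imp_x)
    then show ?thesis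
      by (subst DERIV_cong_ev[OF refl near(1)[OF True] refl]) auto
  next
    case False
    then have s: "0 < s" using a by (smt (verit) zero_less_power)
    have "(?h has_field_derivative g' (sqrt s) * (inverse (sqrt s) / 2)) (at s)"
      by (rule DERIV_chain2[OF d DERIV_real_sqrt]) (use s in auto)
    then show ?thesis by (simp add: field_simps)
  qed
  have cont: "continuous_on {0..} ?h'"
  proof (intro continuous_at_imp_continuous_on ballI)
    fix s :: real assume "s \<in> {0..}"
    show "isCont ?h' s"
    proof (cases "s < a\<^sup>2")
      case True
      then show ?thesis using isCont_cong[OF near(2)[OF True]] by simp
    next
      case False
      then have s: "0 < s" using a by (smt (verit) zero_less_power)
      have "isCont g' (sqrt s)"
        using c s by (simp add: continuous_on_eq_continuous_at)
      then have "isCont (\<lambda>s. g' (sqrt s)) s"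
        by (rule isCont_o2[OF isCont_real_sqrt])
      then show ?thesis
        using s by (intro continuous_intros) auto
    qed
  qed
  have "C1_with N (\<lambda>z. ?h ((nrm N z)\<^sup>2)) (\<lambda>i z. ?h' ((nrm N z)\<^sup>2) * (2 * z i))"
  proof (rule C1_with_compose[OF C1_with_sqnorm, where h = ?h and h' = ?h'])
    show "(?h has_field_derivative ?h' ((nrm N z)\<^sup>2)) (at ((nrm N z)\<^sup>2))" for z
      by (rule der) simp
    show "continuous_on ((\<lambda>z. (nrm N z)\<^sup>2) ` Rn N) ?h'"
      by (rule continuous_on_subset[OF cont]) auto
  qed
  then show ?thesis
    by (rule C1_with_cong) auto
qed

text \<open>
  The field \<open>z H(\<bar>z\<bar>) / \<bar>z\<bar>\<^sup>N\<close> has the divergence \<open>H'(\<bar>z\<bar>) / \<bar>z\<bar>\<^bsup>N - 1\<^esup>\<close>.  Tested against it, a radial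
  function sees only the weak derivative of its profile.
\<close>

lemma weak_grad_radial_test:
  assumes u: "has_weak_grad N u g" and N: "1 \<le> N"
    and H: "\<And>r. (H has_field_derivative k r) (at r)" and k: "continuous_on UNIV k"
    and a: "0 < a" and zero: "\<And>r. r \<notin> {a..b} \<Longrightarrow> H r = 0 \<and> k r = 0"
  shows "(\<integral>z. u z * (k (nrm N z) / nrm N z ^ (N - 1)) \<partial>leb N) =
    - (\<integral>z. (\<Sum>i<N. g z i * z i) * (H (nrm N z) / nrm N z ^ N) \<partial>leb N)"
proof -
  let ?G = "\<lambda>r. H r / r ^ N"
  let ?G' = "\<lambda>r. (k r * r ^ N - H r * (real N * r ^ (N - 1))) / (r ^ N * r ^ N)"
  have "continuous_on UNIV H"
    using H by (intro continuous_at_imp_continuous_on) (auto intro: DERIV_isCont)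
  then have "continuous_on {0<..} H" "continuous_on {0<..} k"
    using k by (auto intro: continuous_on_subset)
  then have G: "C1_with N (\<lambda>z. ?G (nrm N z)) (\<lambda>i z. ?G' (nrm N z) * z i / nrm N z)"
  proof (intro C1_with_radial[where a = a])
    fix r :: real assume "0 < r"
    then show "(?G has_field_derivative ?G' r) (at r)"
      using DERIV_divide[OF H DERIV_pow[of N r]] by simp
  qed (use a zero in \<open>auto intro!: continuous_intros\<close>)
  let ?F = "\<lambda>i z. z i * ?G (nrm N z)"
  let ?D = "\<lambda>j i z. (if i = j then 1 else 0) * ?G (nrm N z) + ?G' (nrm N z) * z i / nrm N z * z j"
  have F1: "C1_with N (?F j) (?D j)" for j
    by (rule C1_with_mult[OF C1_with_coord G])
  have F: "?F j \<in> Cc1 N" for j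
  proof (rule C1_with_Cc1[OF F1])
    fix z assume "b < nrm N z"
    then show "?F j z = 0" using zero[of "nrm N z"] by simp
  qed
  have div: "(\<Sum>i<N. partial i (?F i) z) = k (nrm N z) / nrm N z ^ (N - 1)" if z: "z \<in> Rn N" for z
  proof -
    let ?r = "nrm N z"
    have sq: "(\<Sum>i<N. z i * z i) = ?r * ?r"
      by (simp add: L2_set_def sum_nonneg flip: power2_eq_square)
    have "(\<Sum>i<N. partial i (?F i) z) = (\<Sum>i<N. ?G ?r + ?G' ?r * z i / ?r * z i)"
      using C1_with_partial[OF F1 _ z] by (intro sum.cong) auto
    also have "\<dots> = real N * ?G ?r + ?G' ?r / ?r * (\<Sum>i<N. z i * z i)"
    proof -
      have "(\<Sum>i<N. A + c * z i / r * z i) = real N * A + c / r * (\<Sum>i<N. z i * z i)" for A c r :: real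
        by (simp add: sum.distrib sum_distrib_left sum_divide_distrib mult_ac)
      then show ?thesis .
    qed
    also have "\<dots> = real N * ?G ?r + ?G' ?r * ?r"
      unfolding sq by simp
    also have "\<dots> = k ?r / ?r ^ (N - 1)"
    proof (cases "?r = 0")
      case True
      then show ?thesis using zero[of 0] a by simp
    next
      case False
      obtain M where M: "N = Suc M" using N by (cases N) auto
      show ?thesis using False unfolding M by (simp add: field_simps)
    qed
    finally show ?thesis .
  qed
  have lu: "loc_integrable N u" and lg: "\<And>i. i < N \<Longrightarrow> loc_integrable N (\<lambda>z. g z i)"
    using u by (auto simp: has_weak_grad_def)
  have "(\<integral>z. u z * (k (nrm N z) / nrm N z ^ (N - 1)) \<partial>leb N) = (\<integral>z. (\<Sum>i<N. u z * partial i (?F i) z) \<partial>leb N)"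
    using div by (intro Bochner_Integration.integral_cong) (auto simp flip: sum_distrib_left)
  also have "\<dots> = (\<Sum>i<N. \<integral>z. u z * partial i (?F i) z \<partial>leb N)"
    by (intro Bochner_Integration.integral_sum integrable_pairing lu partial_bounded_support F) simp
  also have "\<dots> = (\<Sum>i<N. - (\<integral>z. g z i * ?F i z \<partial>leb N))"
    using u F by (intro sum.cong) (auto simp: has_weak_grad_def)
  also have "\<dots> = - (\<integral>z. (\<Sum>i<N. g z i * ?F i z) \<partial>leb N)"
    unfolding sum_negf
    by (subst Bochner_Integration.integral_sum)
       (rule integrable_pairing[OF lg Cc1_bounded_support[OF F]], simp_all)
  also have "(\<lambda>z. \<Sum>i<N. g z i * ?F i z) = (\<lambda>z. (\<Sum>i<N. g z i * z i) * ?G (nrm N z))"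
    by (simp only: sum_distrib_right mult.assoc)
  finally show ?thesis .
qed

lemma integrable_mult_compact_support:
  fixes D k :: "real \<Rightarrow> real"
  assumes D: "integrable lborel (\<lambda>r. D r * indicator {a..b} r)" and k: "continuous_on UNIV k"
    and zero: "\<And>r. r \<notin> {a..b} \<Longrightarrow> k r = 0"
  shows "integrable lborel (\<lambda>r. D r * k r)"
proof -
  have "compact (k ` {a..b})"
    by (intro compact_continuous_image continuous_on_subset[OF k]) auto
  then obtain B where B: "\<And>r. r \<in> {a..b} \<Longrightarrow> \<bar>k r\<bar> \<le> B"
    by (meson bounded_real compact_imp_bounded image_eqI)
  have eq: "(\<lambda>r. D r * k r) = (\<lambda>r. (D r * indicator {a..b} r) * k r)"
    using zero by (intro ext) (auto simp: indicator_def)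
  have km: "k \<in> borel_measurable lborel"
    using borel_measurable_continuous_onI[OF k] by simp
  have Dm: "(\<lambda>r. D r * indicator {a..b} r) \<in> borel_measurable lborel" using D by auto
  show ?thesis unfolding eq
  proof (rule Bochner_Integration.integrable_bound)
    show "integrable lborel (\<lambda>r. B * (D r * indicator {a..b} r))" using D by simp
    show "AE r in lborel. norm (D r * indicator {a..b} r * k r) \<le> norm (B * (D r * indicator {a..b} r))"
    proof (rule AE_I2)
      fix r
      show "norm (D r * indicator {a..b} r * k r) \<le> norm (B * (D r * indicator {a..b} r))"
      proof (cases "r \<in> {a..b}")
        case True
        have "\<bar>D r\<bar> * \<bar>k r\<bar> \<le> \<bar>D r\<bar> * \<bar>B\<bar>"
          using B[OF True] by (intro mult_left_mono) auto
        then show ?thesis using True by (simp add: abs_mult mult.commute)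
      qed simp
    qed
  qed (rule borel_measurable_times[OF Dm km])
qed

text \<open>
  As in the fundamental lemma, with the functions \<open>k m / (1 + k m)\<close> approximating indicators of intervals that stay
  away from zero.
\<close>

lemma AE_zero_of_continuous_test:
  fixes D :: "real \<Rightarrow> real"
  assumes D: "\<And>a b. 0 < a \<Longrightarrow> integrable lborel (\<lambda>r. D r * indicator {a..b} r)"
    and orth: "\<And>k a b. continuous_on UNIV k \<Longrightarrow> 0 < a \<Longrightarrow> (\<And>r. r \<notin> {a..b} \<Longrightarrow> k r = 0) \<Longrightarrow>
      (\<integral>r. D r * k r \<partial>lborel) = 0"
  shows "AE r in lborel. 0 < r \<longrightarrow> D r = 0"
proof -
  have int: "integrable lborel (\<lambda>r. D r * indicator {a<..<b} r)" if "0 < a" for a b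
  proof -
    have "integrable lborel (\<lambda>r. indicator {a<..<b} r *\<^sub>R (D r * indicator {a..b} r))"
      by (intro integrable_mult_indicator D that) simp
    moreover have "(\<lambda>r. indicator {a<..<b} r *\<^sub>R (D r * indicator {a..b} r)) = (\<lambda>r. D r * indicator {a<..<b} r)"
      by (intro ext) (auto simp: indicator_def)
    ultimately show ?thesis by simp
  qed
  have ioo: "(\<integral>r. D r * indicator {a<..<b} r \<partial>lborel) = 0" if a: "0 < a" for a b
  proof -
    define m where "m = (\<lambda>r. max 0 ((r - a) * (b - r)))"
    define k where "k = (\<lambda>(j::nat) r. real j * m r / (1 + real j * m r))"
    have m0: "0 \<le> m r" for r by (simp add: m_def)
    have mpos: "0 < m r \<longleftrightarrow> a < r \<and> r < b \<or> b < r \<and> r < a" for r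
      by (auto simp: m_def less_max_iff_disj zero_less_mult_iff)
    have den: "1 + real j * m r \<noteq> 0" for j r
      using m0[of r] by (smt (verit) mult_nonneg_nonneg of_nat_0_le_iff)
    show ?thesis
    proof (cases "a < b")
      case True
      have kc: "continuous_on UNIV (k j)" for j
        unfolding k_def using den by (intro continuous_intros) (auto simp: m_def intro!: continuous_intros)
      have kz: "k j r = 0" if "r \<notin> {a<..<b}" for j r
        using that mpos[of r] m0[of r] True by (auto simp: k_def)
      have kz': "k j r = 0" if "r \<notin> {a..b}" for j r
        using that by (intro kz) auto
      have kb: "\<bar>k j r\<bar> \<le> 1" for j r
        unfolding k_def
        by (simp only: abs_of_nonneg[OF saturation_bounds(1)[OF m0]] saturation_bounds(2)[OF m0])
      have "(\<lambda>j. \<integral>r. D r * k j r \<partial>lborel) \<longlonglongrightarrow> (\<integral>r. D r * indicator {a<..<b} r \<partial>lborel)"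
      proof (rule integral_dominated_convergence)
        show "integrable lborel (\<lambda>r. \<bar>D r * indicator {a<..<b} r\<bar>)"
          by (intro integrable_abs int a)
        show "(\<lambda>r. D r * indicator {a<..<b} r) \<in> borel_measurable lborel"
          using int[OF a] by auto
        show "(\<lambda>r. D r * k j r) \<in> borel_measurable lborel" for j
          using integrable_mult_compact_support[OF D[OF a] kc kz'] by auto
        show "AE r in lborel. (\<lambda>j. D r * k j r) \<longlonglongrightarrow> D r * indicator {a<..<b} r"
        proof (intro AE_I2 tendsto_mult tendsto_const)
          fix r
          show "(\<lambda>j. k j r) \<longlonglongrightarrow> indicator {a<..<b} r"
            using saturation_tendsto_indicator[OF m0[of r]] mpos[of r] True
            unfolding k_def by (auto simp: indicator_def)
        qed
        show "AE r in lborel. norm (D r * k j r) \<le> \<bar>D r * indicator {a<..<b} r\<bar>" for j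
        proof (rule AE_I2)
          fix r
          show "norm (D r * k j r) \<le> \<bar>D r * indicator {a<..<b} r\<bar>"
            using kz[of r j] kb[of j r]
            by (cases "r \<in> {a<..<b}") (auto simp: abs_mult mult_left_le)
        qed
      qed
      moreover have "(\<integral>r. D r * k j r \<partial>lborel) = 0" for j
        by (rule orth[OF kc a kz'])
      ultimately show ?thesis by (simp add: LIMSEQ_const_iff)
    qed simp
  qed
  have "AE r in lborel. D r * indicator {1 / real (Suc n)<..<real n} r = 0" for n
  proof (rule AE_zero_of_set_integrals[where E = "range (\<lambda>(a, b). {a<..<b})"])
    show "Int_stable (range (\<lambda>(a, b). {a<..<b :: real}))"
      unfolding Int_stable_def
    proof (intro ballI)
      fix A B :: "real set" assume "A \<in> range (\<lambda>(a, b). {a<..<b})" "B \<in> range (\<lambda>(a, b). {a<..<b})"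
      then obtain a b c d where "A = {a<..<b}" "B = {c<..<d}" by auto
      then have "A \<inter> B = (\<lambda>(a, b). {a<..<b}) (max a c, min b d)" by auto
      then show "A \<inter> B \<in> range (\<lambda>(a, b). {a<..<b})" by (rule image_eqI) simp
    qed
    fix A :: "real set" assume "A \<in> range (\<lambda>(a, b). {a<..<b})"
    then obtain a b where A: "A = {a<..<b}" by auto
    have eq: "indicator A r * (D r * indicator {1 / real (Suc n)<..<real n} r) =
        D r * indicator {max a (1 / real (Suc n))<..<min b (real n)} r" for r
      unfolding A by (simp add: indicator_def)
    have "0 < max a (1 / real (Suc n))" by (simp add: less_max_iff_disj)
    from ioo[OF this] show "(\<integral>r. indicator A r * (D r * indicator {1 / real (Suc n)<..<real n} r) \<partial>lborel) = 0"
      unfolding eq .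
  qed (use int[of "1 / real (Suc n)" "real n"] ioo[of "1 / real (Suc n)" "real n"] borel_eq_sigma_Ioo in auto)
  then have "AE r in lborel. \<forall>n. D r * indicator {1 / real (Suc n)<..<real n} r = 0"
    unfolding AE_all_countable by blast
  then show ?thesis
  proof eventually_elim
    case (elim r)
    show ?case
    proof
      assume r: "0 < r"
      obtain n1 n2 where n: "r < real n1" "inverse (real (Suc n2)) < r"
        using reals_Archimedean2 reals_Archimedean[OF r] by blast
      let ?n = "max n1 n2"
      have "1 / real (Suc ?n) \<le> 1 / real (Suc n2)"
        by (intro divide_left_mono) auto
      then have "r \<in> {1 / real (Suc ?n)<..<real ?n}"
        using n by (auto simp: inverse_eq_divide)
      then show "D r = 0" using elim[rule_format, of ?n] by simp
    qed
  qed
qed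

lemma antiderivative_compact_support:
  fixes k :: "real \<Rightarrow> real"
  assumes k: "continuous_on UNIV k" and zero: "\<And>r. r \<notin> {a..b} \<Longrightarrow> k r = 0" and ab: "a \<le> b"
    and int: "(\<integral>r. k r \<partial>lborel) = 0"
  obtains H where "\<And>r. (H has_field_derivative k r) (at r)" "\<And>r. r \<notin> {a..b} \<Longrightarrow> H r = 0"
proof -
  have kc: "isCont k r" for r using k by (simp add: continuous_on_eq_continuous_at)
  obtain F where F: "\<And>r. (F has_vector_derivative k r) (at r)"
    using einterval_antiderivative[of "-\<infinity>" "\<infinity>" k] kc by auto
  define H where "H = (\<lambda>r. F r - F a)"
  have H: "(H has_field_derivative k r) (at r)" for r
    unfolding H_def has_real_derivative_iff_has_vector_derivative
    using F[of r] by (auto intro!: derivative_eq_intros)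
  have ftc: "(\<integral>r. k r * indicator {x..y} r \<partial>lborel) = H y - H x" if "x \<le> y" for x y
    using that H kc by (intro integral_FTC_Icc_real) auto
  have left: "H r = 0" if "r < a" for r
  proof -
    have "k s * indicator {r..a} s = k a * indicator {a} s" for s
      using zero[of s] that by (cases s a rule: linorder_cases) (auto simp: indicator_def)
    then have "(\<integral>s. k s * indicator {r..a} s \<partial>lborel) = (\<integral>s. k a * indicator {a} s \<partial>lborel)"
      by (simp only:)
    also have "\<dots> = 0" by simp
    finally have "H a - H r = 0" using ftc[of r a] that by simp
    then show ?thesis by (simp add: H_def)
  qed
  have right: "H r = 0" if "b < r" for r
  proof -
    have "(\<lambda>s. k s * indicator {a..r} s) = k"
    proof (rule ext)
      show "k s * indicator {a..r} s = k s" for s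
        using zero[of s] that by (cases "s \<le> b") (auto simp: indicator_def)
    qed
    then have "H r - H a = 0" using ftc[of a r] that ab int by simp
    then show ?thesis by (simp add: H_def)
  qed
  show thesis by (rule that[OF H]) (use left right in force)
qed

text \<open>
  Derivatives of test functions are the test functions with integral zero.  Subtracting from \<open>k\<close> the
  multiple of a fixed bump of integral 1 makes its integral zero; so \<open>D\<close> minus its mean over that bump is
  orthogonal to all \<open>k\<close>.
\<close>

lemma du_Bois_Reymond:
  fixes D :: "real \<Rightarrow> real"
  assumes D: "\<And>a b. 0 < a \<Longrightarrow> integrable lborel (\<lambda>r. D r * indicator {a..b} r)"
    and orth: "\<And>H k a b. (\<And>r. (H has_field_derivative k r) (at r)) \<Longrightarrow> continuous_on UNIV k \<Longrightarrow> 0 < a \<Longrightarrow>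
      (\<And>r. r \<notin> {a..b} \<Longrightarrow> H r = 0 \<and> k r = 0) \<Longrightarrow> (\<integral>r. D r * k r \<partial>lborel) = 0"
  obtains C where "AE r in lborel. 0 < r \<longrightarrow> D r = C"
proof -
  \<comment> \<open>A bump on \<open>[1, 2]\<close>; the factor 6 makes its integral 1.\<close>
  define w where "w = (\<lambda>r::real. 6 * max 0 ((r - 1) * (2 - r)))"
  have wc: "continuous_on UNIV w" unfolding w_def by (intro continuous_intros)
  have wz: "w r = 0" if "r \<notin> {1..2}" for r
    using that by (auto simp: w_def max_def zero_le_mult_iff)
  have one: "integrable lborel (\<lambda>r. 1 * indicator {a..b} r :: real)" for a b :: real
    by (auto intro!: integrable_real_indicator simp: emeasure_lborel_Icc_eq)
  have w1: "(\<integral>r. w r \<partial>lborel) = 1"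
  proof -
    have "w = (\<lambda>r. (6 * ((r - 1) * (2 - r))) * indicator {1..2} r)"
      by (intro ext) (auto simp: w_def indicator_def max_def zero_le_mult_iff)
    moreover have "(\<integral>r. (6 * ((r - 1) * (2 - r))) * indicator {1..2} r \<partial>lborel) =
        (- 2 * 2 ^ 3 + 9 * 2 ^ 2 - 12 * 2) - (- 2 * 1 ^ 3 + 9 * 1 ^ 2 - 12 * (1 :: real))"
    proof (rule integral_FTC_Icc_real)
      fix r :: real
      show "((\<lambda>r. - 2 * r ^ 3 + 9 * r ^ 2 - 12 * r) has_real_derivative 6 * ((r - 1) * (2 - r))) (at r)"
        by (auto intro!: derivative_eq_intros simp: algebra_simps power2_eq_square)
      show "isCont (\<lambda>r. 6 * ((r - 1) * (2 - r))) r" by (intro continuous_intros)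
    qed simp
    ultimately show ?thesis by simp
  qed
  have wi: "integrable lborel w"
    using integrable_mult_compact_support[OF one wc wz] by simp
  define C where "C = (\<integral>r. D r * w r \<partial>lborel)"
  have Dw: "integrable lborel (\<lambda>r. D r * w r)"
    by (rule integrable_mult_compact_support[where a = 1 and b = 2, OF D wc wz]) simp_all
  have "AE r in lborel. 0 < r \<longrightarrow> D r - C = 0"
  proof (rule AE_zero_of_continuous_test)
    fix a b :: real assume a: "0 < a"
    show "integrable lborel (\<lambda>r. (D r - C) * indicator {a..b} r)"
      unfolding left_diff_distrib using one[of a b]
      by (intro Bochner_Integration.integrable_diff D a integrable_mult_right) simp
    fix k :: "real \<Rightarrow> real" assume k: "continuous_on UNIV k" and kz: "\<And>r. r \<notin> {a..b} \<Longrightarrow> k r = 0"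
    have ki: "integrable lborel k" and Dk: "integrable lborel (\<lambda>r. D r * k r)"
      using integrable_mult_compact_support[OF one k kz] integrable_mult_compact_support[OF D[OF a] k kz] by auto
    define K where "K = (\<integral>r. k r \<partial>lborel)"
    let ?k = "\<lambda>r. k r - K * w r" and ?a = "min a 1" and ?b = "max b 2"
    have c: "continuous_on UNIV ?k" by (intro continuous_intros k wc)
    have z: "?k r = 0" if "r \<notin> {?a..?b}" for r
      using that by (subst kz, force, subst wz) auto
    have i: "(\<integral>r. ?k r \<partial>lborel) = 0"
      using ki wi by (simp add: K_def w1)
    have ab: "?a \<le> ?b" by simp
    obtain H where H: "\<And>r. (H has_field_derivative ?k r) (at r)" "\<And>r. r \<notin> {?a..?b} \<Longrightarrow> H r = 0"
      using antiderivative_compact_support[OF c z ab i] by blast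
    have "(\<integral>r. D r * ?k r \<partial>lborel) = 0"
      by (rule orth[OF H(1) c, of ?a ?b]) (use a H(2) z in auto)
    moreover have "(\<integral>r. D r * ?k r \<partial>lborel) = (\<integral>r. D r * k r \<partial>lborel) - K * C"
      using Dk Dw by (simp add: right_diff_distrib C_def mult.left_commute)
    ultimately show "(\<integral>r. (D r - C) * k r \<partial>lborel) = 0"
      using Dk ki by (simp add: left_diff_distrib K_def)
  qed
  then have "AE r in lborel. 0 < r \<longrightarrow> D r = C" by eventually_elim simp
  then show thesis by (rule that)
qed

context
  fixes N :: nat and u :: "vec \<Rightarrow> real" and g :: "vec \<Rightarrow> vec"
  assumes N: "1 \<le> N" and g: "has_weak_grad N u g"
begin

text \<open>
  Up to the factor \<open>N * vball N\<close>, the integral of \<open>radial_flux\<close> over the shell between two radii is the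
  difference of the values of \<open>u\<close> at these radii.  Integration from the radius 1 avoids the origin, where the flux may
  fail to be integrable, as well as infinity; the sign of \<open>shell\<close> changes at \<open>r = 1\<close> accordingly.  So
  \<open>profile\<close> is the profile of \<open>u\<close> up to an additive constant.
\<close>

definition radial_flux :: "vec \<Rightarrow> real" where
  "radial_flux z = (\<Sum>i<N. g z i * z i) / nrm N z ^ N"

definition shell :: "real \<Rightarrow> vec \<Rightarrow> real" where
  "shell r z = (if nrm N z \<le> r then 1 else 0) - (if nrm N z \<le> 1 then 1 else 0)"

definition profile :: "real \<Rightarrow> real" where
  "profile r = (\<integral>z. radial_flux z * shell r z \<partial>leb N) / (real N * vball N)"

lemma radial_flux_measurable [measurable]: "radial_flux \<in> borel_measurable (leb N)"
proof -
  have [measurable]: "(\<lambda>z. g z i) \<in> borel_measurable (leb N)" if "i < N" for i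
    by (rule weak_grad_measurable[OF g that])
  show ?thesis unfolding radial_flux_def
    by (intro borel_measurable_divide borel_measurable_sum borel_measurable_times borel_measurable_power
        measurable_coord_leb) auto
qed

lemma shell_measurable [measurable]: "shell r \<in> borel_measurable (leb N)"
  unfolding shell_def by measurable

lemma annulus_bounded_support:
  assumes "0 < a"
  shows "bounded_support N (\<lambda>z. indicator {a..b} (nrm N z) / nrm N z ^ M)"
  unfolding bounded_support_def
proof (intro conjI exI ballI impI)
  show "(\<lambda>z. indicator {a..b} (nrm N z) / nrm N z ^ M) \<in> borel_measurable (leb N)" by measurable
  show "\<bar>indicator {a..b} (nrm N z) / nrm N z ^ M\<bar> \<le> 1 / a ^ M" for z
  proof (cases "nrm N z \<in> {a..b}")
    case True
    then have "1 / nrm N z ^ M \<le> 1 / a ^ M"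
      using assms by (intro divide_left_mono power_mono mult_pos_pos zero_less_power) auto
    then show ?thesis using True by simp
  qed (use assms in auto)
  show "indicator {a..b} (nrm N z) / nrm N z ^ M = 0" if "b < nrm N z" for z
    using that by simp
qed

lemma coord_annulus_bounded_support:
  assumes "0 < a" "i < N"
  shows "bounded_support N (\<lambda>z. z i * (indicator {a..b} (nrm N z) / nrm N z ^ M))"
proof -
  have "bounded_support N (\<lambda>z. z i * indicator {a..b} (nrm N z))"
    unfolding bounded_support_def
  proof (intro conjI exI ballI impI)
    show "(\<lambda>z. z i * indicator {a..b} (nrm N z)) \<in> borel_measurable (leb N)"
      by (intro borel_measurable_times measurable_coord_leb assms) measurable
    show "\<bar>z i * indicator {a..b} (nrm N z)\<bar> \<le> max b 0" for z
      using coord_le_nrm[OF assms(2), of z] by (auto simp: indicator_def)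
    show "z i * indicator {a..b} (nrm N z) = 0" if "b < nrm N z" for z
      using that by simp
  qed
  from bounded_support_mult[OF this annulus_bounded_support[OF assms(1), of b M]]
  have "bounded_support N (\<lambda>z. z i * indicator {a..b} (nrm N z) * (indicator {a..b} (nrm N z) / nrm N z ^ M))" .
  moreover have "(\<lambda>z. z i * indicator {a..b} (nrm N z) * (indicator {a..b} (nrm N z) / nrm N z ^ M)) =
      (\<lambda>z. z i * (indicator {a..b} (nrm N z) / nrm N z ^ M))"
    by (intro ext) (auto simp: indicator_def)
  ultimately show ?thesis by simp
qed

lemma radial_flux_integrable:
  assumes "0 < a"
  shows "integrable (leb N) (\<lambda>z. radial_flux z * indicator {a..b} (nrm N z))"
proof -
  have "integrable (leb N) (\<lambda>z. \<Sum>i<N. g z i * (z i * (indicator {a..b} (nrm N z) / nrm N z ^ N)))"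
    using g by (intro Bochner_Integration.integrable_sum integrable_pairing coord_annulus_bounded_support assms)
      (auto simp: has_weak_grad_def)
  then have "integrable (leb N) (\<lambda>z. (\<Sum>i<N. g z i * z i) * (indicator {a..b} (nrm N z) / nrm N z ^ N))"
    by (simp only: sum_distrib_right mult.assoc)
  then show ?thesis by (simp add: radial_flux_def)
qed

lemma shell_bound:
  assumes "a < r" "a \<le> 1" "r < b" "1 \<le> b"
  shows "\<bar>radial_flux z * shell r z\<bar> \<le> \<bar>radial_flux z * indicator {a..b} (nrm N z)\<bar>"
  using assms by (auto simp: shell_def indicator_def)

text \<open>
  Dominated convergence, as spheres are null sets.
\<close>

lemma continuous_profile: "continuous_on {0<..} profile"
proof (intro continuous_at_imp_continuous_on ballI)
  fix r0 :: real assume "r0 \<in> {0<..}"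
  then have r0: "0 < r0" by simp
  define a where "a = min (r0 / 2) 1"
  define b where "b = max (2 * r0) 1"
  have ab: "0 < a" "a \<le> 1" "1 \<le> b" "a < r0" "r0 < b" using r0 by (auto simp: a_def b_def min_def max_def)
  have "continuous_on {a<..<b} (\<lambda>r. \<integral>z. radial_flux z * shell r z \<partial>leb N)"
  proof (rule continuous_on_sequentiallyI)
    fix s r assume s: "\<forall>n. s n \<in> {a<..<b}" and r: "r \<in> {a<..<b}" and lim: "s \<longlonglongrightarrow> r"
    show "(\<lambda>n. \<integral>z. radial_flux z * shell (s n) z \<partial>leb N) \<longlonglongrightarrow> (\<integral>z. radial_flux z * shell r z \<partial>leb N)"
    proof (rule integral_dominated_convergence)
      show "integrable (leb N) (\<lambda>z. \<bar>radial_flux z * indicator {a..b} (nrm N z)\<bar>)"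
        by (intro integrable_abs radial_flux_integrable ab)
      show "AE z in leb N. norm (radial_flux z * shell (s n) z) \<le> \<bar>radial_flux z * indicator {a..b} (nrm N z)\<bar>" for n
        using s ab by (intro AE_I2) (simp add: shell_bound)
      show "AE z in leb N. (\<lambda>n. radial_flux z * shell (s n) z) \<longlonglongrightarrow> radial_flux z * shell r z"
        using AE_nrm_neq[OF N, of r]
      proof eventually_elim
        case (elim z)
        have "eventually (\<lambda>n. shell (s n) z = shell r z) sequentially"
        proof (cases "nrm N z < r")
          case True
          from order_tendstoD(1)[OF lim this] show ?thesis
            by eventually_elim (use True in \<open>simp add: shell_def\<close>)
        next
          case False
          then have "r < nrm N z" using elim by simp
          from order_tendstoD(2)[OF lim this] show ?thesis
            by eventually_elim (use \<open>r < nrm N z\<close> in \<open>simp add: shell_def\<close>)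
        qed
        then show ?case
          by (intro tendsto_mult tendsto_const tendsto_eventually)
      qed
    qed (auto intro!: borel_measurable_times radial_flux_measurable shell_measurable)
  qed
  then have "continuous_on {a<..<b} profile"
    unfolding profile_def using N vball_pos[of N] by (intro continuous_intros) auto
  then show "isCont profile r0"
    using ab by (simp add: continuous_on_eq_continuous_at)
qed

text \<open>
  By Fubini, the integration over \<open>r\<close> turns \<open>shell r z * k r\<close> into \<open>- H(\<bar>z\<bar>)\<close>, the antiderivative of \<open>k\<close>
  with compact support; this is the situation of \<open>weak_grad_radial_test\<close>.
\<close>

lemma profile_pairing:
  assumes H: "\<And>r. (H has_field_derivative k r) (at r)" and k: "continuous_on UNIV k"
    and a: "0 < a" and zero: "\<And>r. r \<notin> {a..b} \<Longrightarrow> H r = 0 \<and> k r = 0"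
  shows "real N * vball N * (\<integral>r. profile r * k r \<partial>lborel) =
    (\<integral>z. u z * (k (nrm N z) / nrm N z ^ (N - 1)) \<partial>leb N)"
proof -
  interpret leb: sigma_finite_measure "leb N" by (rule sigma_finite_leb)
  interpret P: pair_sigma_finite "leb N" lborel ..
  have kc: "isCont k r" for r using k by (simp add: continuous_on_eq_continuous_at)
  have km [measurable]: "k \<in> borel_measurable borel" by (rule borel_measurable_continuous_onI[OF k])
  have one: "integrable lborel (\<lambda>r. 1 * indicator {a..b} r :: real)"
    by (auto intro!: integrable_real_indicator simp: emeasure_lborel_Icc_eq)
  have kz: "k r = 0" if "r \<notin> {a..b}" for r using zero[OF that] by simp
  have ki: "integrable lborel k"
    using integrable_mult_compact_support[OF one k kz] by simp
  have tail: "(\<integral>r. k r * (if x \<le> r then 1 else 0) \<partial>lborel) = - H x" for x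
  proof -
    let ?y = "max (b + 1) x"
    have "(\<lambda>r. k r * (if x \<le> r then 1 else 0)) = (\<lambda>r. k r * indicator {x..?y} r)"
    proof (rule ext)
      show "k r * (if x \<le> r then 1 else 0) = k r * indicator {x..?y} r" for r
        using kz[of r] by (cases "r \<le> b") (auto simp: indicator_def)
    qed
    then have "(\<integral>r. k r * (if x \<le> r then 1 else 0) \<partial>lborel) = (\<integral>r. k r * indicator {x..?y} r \<partial>lborel)"
      by simp
    also have "\<dots> = H ?y - H x"
      using H kc by (intro integral_FTC_Icc_real) auto
    also have "H ?y = 0" using zero[of ?y] by simp
    finally show ?thesis by simp
  qed
  have total: "(\<integral>r. k r \<partial>lborel) = 0"
  proof -
    have "(\<lambda>r. k r * (if a - 1 \<le> r then 1 else 0)) = k"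
      using kz by (intro ext) auto
    then show ?thesis using tail[of "a - 1"] zero[of "a - 1"] by simp
  qed
  define a' where "a' = min (a / 2) 1"
  define b' where "b' = max (b + 1) 1"
  have ab: "0 < a'" "a' \<le> 1" "1 \<le> b'" "a' < a" "b < b'" using a by (auto simp: a'_def b'_def min_def max_def)
  let ?f = "\<lambda>(z, r). radial_flux z * shell r z * k r"
  have [measurable]: "(\<lambda>x. nrm N (fst x)) \<in> borel_measurable (leb N \<Otimes>\<^sub>M lborel)"
    "(\<lambda>x. radial_flux (fst x)) \<in> borel_measurable (leb N \<Otimes>\<^sub>M lborel)"
    "(\<lambda>x. k (snd x)) \<in> borel_measurable (leb N \<Otimes>\<^sub>M lborel)"
    by (rule measurable_compose[OF measurable_fst measurable_nrm]
        measurable_compose[OF measurable_fst radial_flux_measurable]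
        measurable_compose[OF measurable_snd], simp)+
  have fm [measurable]: "?f \<in> borel_measurable (leb N \<Otimes>\<^sub>M lborel)"
  proof -
    have eq: "?f = (\<lambda>x. radial_flux (fst x) *
        (indicator {0..} (snd x - nrm N (fst x)) - indicator {..1} (nrm N (fst x))) * k (snd x))"
      by (intro ext) (simp add: shell_def indicator_def case_prod_unfold)
    show ?thesis unfolding eq
      by (intro borel_measurable_times borel_measurable_diff
          measurable_compose[OF _ borel_measurable_indicator[of _ borel]]) (simp_all, measurable)
  qed
  let ?q = "\<lambda>z. radial_flux z * indicator {a'..b'} (nrm N z)"
  have qi: "integrable (leb N) ?q" by (rule radial_flux_integrable[OF ab(1)])
  have qk: "integrable (leb N \<Otimes>\<^sub>M lborel) (\<lambda>(z, r). ?q z * k r)"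
  proof (rule P.Fubini_integrable)
    show "(\<lambda>(z, r). ?q z * k r) \<in> borel_measurable (leb N \<Otimes>\<^sub>M lborel)" by measurable
    have "integrable (leb N) (\<lambda>z. \<bar>?q z\<bar> * (\<integral>r. \<bar>k r\<bar> \<partial>lborel))"
      using qi by (intro integrable_mult_left integrable_abs) auto
    then show "integrable (leb N) (\<lambda>z. \<integral>r. norm (case (z, r) of (z, r) \<Rightarrow> ?q z * k r) \<partial>lborel)"
      by (simp add: abs_mult)
    show "AE z in leb N. integrable lborel (\<lambda>r. case (z, r) of (z, r) \<Rightarrow> ?q z * k r)"
      using ki by (intro AE_I2) simp
  qed
  have fi: "integrable (leb N \<Otimes>\<^sub>M lborel) ?f"
  proof (rule Bochner_Integration.integrable_bound[OF qk fm], rule AE_I2)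
    fix x :: "vec \<times> real"
    obtain z r where x: "x = (z, r)" by (cases x)
    have "\<bar>radial_flux z * shell r z\<bar> * \<bar>k r\<bar> \<le> \<bar>?q z\<bar> * \<bar>k r\<bar>"
    proof (cases "r \<in> {a..b}")
      case True
      then show ?thesis using ab by (intro mult_right_mono shell_bound) auto
    qed (use kz in simp)
    then show "norm (?f x) \<le> norm (case x of (z, r) \<Rightarrow> ?q z * k r)"
      by (simp add: x abs_mult)
  qed
  have "real N * vball N * (\<integral>r. profile r * k r \<partial>lborel) = (\<integral>r. (\<integral>z. radial_flux z * shell r z \<partial>leb N) * k r \<partial>lborel)"
  proof -
    have "profile r * k r = (\<integral>z. radial_flux z * shell r z \<partial>leb N) * k r / (real N * vball N)" for r
      by (simp add: profile_def)
    then show ?thesis using N vball_pos[of N] by simp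
  qed
  also have "\<dots> = (\<integral>r. (\<integral>z. ?f (z, r) \<partial>leb N) \<partial>lborel)"
    by simp
  also have "\<dots> = (\<integral>z. (\<integral>r. ?f (z, r) \<partial>lborel) \<partial>leb N)"
    using P.Fubini_integral[of "\<lambda>z r. ?f (z, r)"] fi by simp
  also have "\<dots> = (\<integral>z. - ((\<Sum>i<N. g z i * z i) * (H (nrm N z) / nrm N z ^ N)) \<partial>leb N)"
  proof (rule Bochner_Integration.integral_cong[OF refl])
    fix z
    have ti: "integrable lborel (\<lambda>r. k r * (if nrm N z \<le> r then 1 else 0))"
      using ki by (rule Bochner_Integration.integrable_bound) auto
    have "(\<integral>r. ?f (z, r) \<partial>lborel) =
        (\<integral>r. radial_flux z * (k r * (if nrm N z \<le> r then 1 else 0) - (if nrm N z \<le> 1 then 1 else 0) * k r) \<partial>lborel)"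
      by (rule Bochner_Integration.integral_cong) (auto simp: shell_def)
    also have "\<dots> = radial_flux z * ((\<integral>r. k r * (if nrm N z \<le> r then 1 else 0) \<partial>lborel) -
        (if nrm N z \<le> 1 then 1 else 0) * (\<integral>r. k r \<partial>lborel))"
      using ti ki by simp
    also have "\<dots> = - ((\<Sum>i<N. g z i * z i) * (H (nrm N z) / nrm N z ^ N))"
      by (simp add: tail total radial_flux_def)
    finally show "(\<integral>r. ?f (z, r) \<partial>lborel) = - ((\<Sum>i<N. g z i * z i) * (H (nrm N z) / nrm N z ^ N))" .
  qed
  also have "\<dots> = (\<integral>z. u z * (k (nrm N z) / nrm N z ^ (N - 1)) \<partial>leb N)"
    using weak_grad_radial_test[OF g N H k a zero] by simp
  finally show ?thesis .
qed

text \<open>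
  By polar coordinates, \<open>profile_pairing\<close> says that \<open>profile\<close> and the profile of \<open>u\<close> agree on all derivatives of
  test functions, so they differ by a constant almost everywhere.
\<close>

lemma radial_continuous_representative:
  assumes rad: "u \<in> Rad N"
  obtains V where "continuous_on {0<..} V" "AE z in leb N. V (nrm N z) = u z"
proof -
  define pt where "pt = (\<lambda>r::real. \<lambda>i\<in>{..<N}. if i = 0 then r else 0)"
  \<comment> \<open>The profile of \<open>u\<close>, read off along a coordinate axis, is measurable.\<close>
  define \<gamma> where "\<gamma> = (\<lambda>r. u (pt r))"
  obtain h where h: "\<And>z. z \<in> Rn N \<Longrightarrow> u z = h (nrm N z)" using rad by (auto simp: Rad_def)
  have ptR: "pt r \<in> Rn N" for r by (simp add: pt_def Rn_def PiE_iff)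
  have ptn: "nrm N (pt r) = \<bar>r\<bar>" for r
  proof -
    have "(\<Sum>i<N. (pt r i)\<^sup>2) = (\<Sum>i<N. if i = 0 then r\<^sup>2 else 0)"
      by (rule sum.cong) (auto simp: pt_def)
    then show ?thesis using N by (simp add: L2_set_def)
  qed
  have u\<gamma>: "u z = \<gamma> (nrm N z)" if "z \<in> Rn N" for z
    using h[OF that] h[OF ptR[of "nrm N z"]] by (simp add: \<gamma>_def ptn)
  have lu: "loc_integrable N u" using g by (simp add: has_weak_grad_def)
  have "pt \<in> measurable borel (leb N)"
    unfolding pt_def leb_def by (rule measurable_restrict) simp
  then have \<gamma>m [measurable]: "\<gamma> \<in> borel_measurable borel"
    unfolding \<gamma>_def by (rule measurable_compose) (rule loc_integrable_measurable[OF lu])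
  have c: "0 < real N * vball N" using N vball_pos[of N] by simp
  have \<gamma>i: "integrable lborel (\<lambda>r. \<gamma> r * indicator {a..b} r)" if a: "0 < a" for a b
  proof -
    have "integrable (leb N) (\<lambda>z. u z * (indicator {a..b} (nrm N z) / nrm N z ^ (N - 1)))"
      by (rule integrable_pairing[OF lu annulus_bounded_support[OF a]])
    then have "integrable (leb N) (\<lambda>z. \<gamma> (nrm N z) * (indicator {a..b} (nrm N z) / nrm N z ^ (N - 1)))"
      by (subst (asm) Bochner_Integration.integrable_cong[OF refl]) (auto simp: u\<gamma>)
    then have "integrable lborel (\<lambda>r. rdens N r * (\<gamma> r * (indicator {a..b} r / r ^ (N - 1))))"
      by (subst (asm) integrable_radial_iff[OF N]) auto
    also have "(\<lambda>r. rdens N r * (\<gamma> r * (indicator {a..b} r / r ^ (N - 1)))) =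
        (\<lambda>r. (real N * vball N) * (\<gamma> r * indicator {a..b} r))"
      using a by (intro ext) (auto simp: rdens_def indicator_def)
    finally show ?thesis using N vball_pos[of N] by auto
  qed
  have Vi: "integrable lborel (\<lambda>r. profile r * indicator {a..b} r)" if a: "0 < a" for a b
  proof -
    have "continuous_on {a..b} profile"
      using a by (intro continuous_on_subset[OF continuous_profile]) auto
    from borel_integrable_compact[OF compact_Icc this] show ?thesis
      by (simp add: mult.commute)
  qed
  obtain C where C: "AE r in lborel. 0 < r \<longrightarrow> profile r - \<gamma> r = C"
  proof (rule du_Bois_Reymond)
    show "integrable lborel (\<lambda>r. (profile r - \<gamma> r) * indicator {a..b} r)" if "0 < a" for a b
      using Vi[OF that] \<gamma>i[OF that] by (simp add: left_diff_distrib)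
    fix H k :: "real \<Rightarrow> real" and a b
    assume H: "\<And>r. (H has_field_derivative k r) (at r)" and k: "continuous_on UNIV k"
      and a: "0 < a" and zero: "\<And>r. r \<notin> {a..b} \<Longrightarrow> H r = 0 \<and> k r = 0"
    have kz: "k r = 0" if "r \<notin> {a..b}" for r using zero[OF that] by simp
    have [measurable]: "k \<in> borel_measurable borel" by (rule borel_measurable_continuous_onI[OF k])
    have "real N * vball N * (\<integral>r. profile r * k r \<partial>lborel) =
        (\<integral>z. u z * (k (nrm N z) / nrm N z ^ (N - 1)) \<partial>leb N)"
      by (rule profile_pairing[OF H k a zero])
    also have "\<dots> = (\<integral>z. \<gamma> (nrm N z) * (k (nrm N z) / nrm N z ^ (N - 1)) \<partial>leb N)"
      by (rule Bochner_Integration.integral_cong) (auto simp: u\<gamma>)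
    also have "\<dots> = (\<integral>r. rdens N r * (\<gamma> r * (k r / r ^ (N - 1))) \<partial>lborel)"
      by (rule integral_radial[OF N]) measurable
    also have "\<dots> = (\<integral>r. (real N * vball N) * (\<gamma> r * k r) \<partial>lborel)"
    proof (rule Bochner_Integration.integral_cong[OF refl])
      fix r
      show "rdens N r * (\<gamma> r * (k r / r ^ (N - 1))) = (real N * vball N) * (\<gamma> r * k r)"
        using kz[of r] a by (cases "0 < r") (auto simp: rdens_def)
    qed
    finally have "(\<integral>r. profile r * k r \<partial>lborel) = (\<integral>r. \<gamma> r * k r \<partial>lborel)"
      using N vball_pos[of N] by auto
    then show "(\<integral>r. (profile r - \<gamma> r) * k r \<partial>lborel) = 0"
      using integrable_mult_compact_support[OF Vi[OF a] k kz] integrable_mult_compact_support[OF \<gamma>i[OF a] k kz]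
      by (simp add: left_diff_distrib)
  qed
  let ?V = "\<lambda>r. profile r - C"
  have Vm [measurable]: "(\<lambda>r. indicator {0<..} r *\<^sub>R profile r) \<in> borel_measurable borel"
    by (intro borel_measurable_continuous_on_indicator continuous_profile) simp
  have "AE z in leb N. indicator {0<..} (nrm N z) *\<^sub>R profile (nrm N z) - C = \<gamma> (nrm N z)"
  proof (rule AE_radial[OF N, where P = "\<lambda>r. indicator {0<..} r *\<^sub>R profile r - C = \<gamma> r"])
    show "AE r in lborel. 0 < r \<longrightarrow> indicator {0<..} r *\<^sub>R profile r - C = \<gamma> r"
      using C by eventually_elim auto
    have "{r \<in> space borel. indicator {0<..} r *\<^sub>R profile r - C = \<gamma> r} \<in> sets borel"
      by (intro borel_measurable_eq borel_measurable_diff Vm \<gamma>m borel_measurable_const)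
    then show "{r. indicator {0<..} r *\<^sub>R profile r - C = \<gamma> r} \<in> sets borel" by simp
  qed
  then have "AE z in leb N. ?V (nrm N z) = u z"
    using AE_nrm_neq[OF N, of 0] AE_space
  proof eventually_elim
    case (elim z)
    then have "0 < nrm N z" by (simp add: less_le)
    then show ?case using elim by (simp add: u\<gamma>)
  qed
  moreover have "continuous_on {0<..} ?V" by (intro continuous_intros continuous_profile)
  ultimately show thesis using that by blast
qed

end

section \<open>Near extremals of the Hardy inequality in dimension three\<close>

lemma nn_integral_inverse_symmetric:
  assumes "0 < S"
  shows "(\<integral>\<^sup>+r. ennreal (1 / r) * indicator {exp (- S)..exp S} r \<partial>lborel) = ennreal (2 * S)"
proof -
  have "(\<integral>\<^sup>+r. ennreal (1 / r) * indicator {exp (- S)..exp S} r \<partial>lborel) = ennreal (ln (exp S) - ln (exp (- S)))"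
  proof (rule nn_integral_FTC_Icc)
    fix r assume "r \<in> {exp (- S)..exp S}"
    then have r: "0 < r" by (metis atLeastAtMost_iff exp_gt_zero less_le_trans)
    then show "(ln has_real_derivative 1 / r) (at r)"
      by (auto intro!: derivative_eq_intros)
    show "0 \<le> 1 / r" using r by simp
  qed (use assms in auto)
  then show ?thesis by simp
qed

lemma sq_add_le:
  fixes x y \<eta> :: real
  assumes "0 < \<eta>"
  shows "(x + y)\<^sup>2 \<le> (1 + \<eta>) * x\<^sup>2 + (1 + 1 / \<eta>) * y\<^sup>2"
proof -
  have "0 \<le> (sqrt \<eta> * x - y / sqrt \<eta>)\<^sup>2" by simp
  also have "\<dots> = \<eta> * x\<^sup>2 - 2 * x * y + y\<^sup>2 / \<eta>"
    using assms by (simp add: power2_diff power_mult_distrib power_divide)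
  finally show ?thesis by (simp add: power2_sum algebra_simps)
qed

lemma ennreal_lincomb:
  "0 \<le> A \<Longrightarrow> 0 \<le> B \<Longrightarrow> 0 \<le> x \<Longrightarrow> 0 \<le> y \<Longrightarrow>
    ennreal (A * x + B * y) = ennreal A * ennreal x + ennreal B * ennreal y"
  by (simp add: ennreal_mult)

text \<open>
  The function \<open>r\<^bsup>-1/2\<^esup>\<close> turns the radial Hardy inequality into an equality of integrands, but its integrals diverge
  logarithmically at zero and at infinity.  The factor \<open>h(ln r / T)\<close> cuts it off on the logarithmic scale: both
  integrals then grow like \<open>T\<close>, while the derivative of the factor contributes only \<open>1 / T\<close>.
\<close>

lemma Hardy_near_extremal:
  assumes e: "0 < (e::real)"
  obtains u X where "u \<in> Cc1 3" "u \<in> Rad 3" "0 < X"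
    "Hardy_mass 2 3 u = ennreal X"
    "energy 2 3 (\<lambda>z i. partial i u z) \<le> ennreal ((1 + e) / 4 * X)"
proof -
  \<comment> \<open>The estimate \<open>bound\<close> at the end loses the factor \<open>1 + 1025 / T\<close>, where 1025 is \<open>1 + 4 * 256\<close>.\<close>
  define T where "T = max 1 (1025 / e)"
  have T: "1 \<le> T" "1025 / T \<le> e" using e by (auto simp: T_def max_def field_simps)
  define h where "h = (\<lambda>s::real. (max 0 (1 - s\<^sup>2))\<^sup>2)"
  define h1 where "h1 = (\<lambda>s::real. 2 * max 0 (1 - s\<^sup>2) * (- 2 * s))"
  have dh: "(h has_field_derivative h1 s) (at s)" for s
    unfolding h_def h1_def
    by (rule DERIV_chain2[OF DERIV_max_zero_sq]) (auto intro!: derivative_eq_intros)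
  have h1c: "continuous_on S h1" for S unfolding h1_def by (intro continuous_intros)
  have hc: "continuous_on S h" for S unfolding h_def by (intro continuous_intros)
  have hz: "h s = 0" "h1 s = 0" if "1 \<le> \<bar>s\<bar>" for s
  proof -
    have "1 \<le> s\<^sup>2" using that by (metis abs_ge_zero abs_le_square_iff abs_one one_power2)
    then show "h s = 0" "h1 s = 0" by (auto simp: h_def h1_def max_def)
  qed
  have h01: "0 \<le> h s" "h s \<le> 1" for s
  proof -
    show "0 \<le> h s" by (simp add: h_def)
    have "(max 0 (1 - s\<^sup>2))\<^sup>2 \<le> 1\<^sup>2" by (intro power_mono) auto
    then show "h s \<le> 1" by (simp add: h_def)
  qed
  have h1b: "\<bar>h1 s\<bar> \<le> 4" for s
  proof (cases "1 \<le> \<bar>s\<bar>")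
    case False
    have "\<bar>h1 s\<bar> = 4 * (max 0 (1 - s\<^sup>2) * \<bar>s\<bar>)" by (simp add: h1_def abs_mult)
    also have "\<dots> \<le> 4 * (1 * 1)"
      using False by (intro mult_left_mono mult_mono) auto
    finally show ?thesis by simp
  qed (simp add: hz)
  have hhalf: "1 / 2 \<le> (h s)\<^sup>2 * 2" if "\<bar>s\<bar> \<le> 1 / 2" for s
  proof -
    have "s\<^sup>2 \<le> (1 / 2)\<^sup>2" using that by (metis abs_le_square_iff abs_of_nonneg zero_le_divide_1_iff zero_le_numeral)
    then have s: "3 / 4 \<le> 1 - s\<^sup>2" by (simp add: power2_eq_square)
    then have "(3 / 4)\<^sup>2 \<le> h s" unfolding h_def by (intro power_mono) auto
    then have "((3 / 4)\<^sup>2)\<^sup>2 \<le> (h s)\<^sup>2" by (intro power_mono) auto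
    then show ?thesis by (simp add: power2_eq_square)
  qed
  let ?l = "\<lambda>r. ln r / T"
  define g where "g = (\<lambda>r. if r \<le> 0 then 0 else r powr (- 1 / 2) * h (?l r))"
  define g' where "g' = (\<lambda>r. if r \<le> 0 then 0 else r powr (- 3 / 2) * (- h (?l r) / 2 + h1 (?l r) / T))"
  have out: "1 \<le> \<bar>?l r\<bar>" if "0 < r" "r \<notin> {exp (- T)..exp T}" for r
  proof -
    have "ln r < - T \<or> T < ln r"
      using that by (auto simp: not_le ) (metis exp_less_cancel_iff exp_ln)+
    then have "T \<le> \<bar>ln r\<bar>" by auto
    then show ?thesis using T by (simp add: abs_divide)
  qed
  have gz: "g r = 0" "g' r = 0" if "r \<notin> {exp (- T)..exp T}" for r
    using out[of r] that hz[of "?l r"] by (auto simp: g_def g'_def)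
  have dg: "(g has_field_derivative g' r) (at r)" if r: "0 < r" for r
  proof -
    have ev: "eventually (\<lambda>s. g s = s powr (- 1 / 2) * h (?l s)) (nhds r)"
      using eventually_nhds_in_open[of "{0<..}" r] r by (auto simp: g_def elim: eventually_mono)
    have p: "((\<lambda>s. s powr (- 1 / 2)) has_field_derivative (- 1 / 2) * r powr (- 1 / 2 - 1)) (at r)"
      using r by (rule has_real_derivative_powr)
    have l: "(?l has_field_derivative 1 / (r * T)) (at r)"
      using r T by (auto intro!: derivative_eq_intros simp: field_simps)
    have q: "((\<lambda>s. h (?l s)) has_field_derivative h1 (?l r) * (1 / (r * T))) (at r)"
      by (rule DERIV_chain2[OF dh l])
    have "((\<lambda>s. s powr (- 1 / 2) * h (?l s)) has_field_derivative
        (- 1 / 2) * r powr (- 1 / 2 - 1) * h (?l r) + h1 (?l r) * (1 / (r * T)) * r powr (- 1 / 2)) (at r)"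
      by (rule DERIV_mult[OF p q])
    moreover have "(- 1 / 2) * r powr (- 1 / 2 - 1) * h (?l r) + h1 (?l r) * (1 / (r * T)) * r powr (- 1 / 2) = g' r"
    proof -
      have "r powr (- 1 / 2) / r = r powr (- 3 / 2)"
      proof -
        have "r powr (- 1 / 2) / r = r powr (- 1 / 2 - 1)" using r by (simp only: powr_diff powr_one)
        then show ?thesis by simp
      qed
      then have "r powr (- 1 / 2) = r powr (- 3 / 2) * r" using r by (simp add: field_simps)
      then show ?thesis using r T by (simp add: g'_def field_simps)
    qed
    ultimately show ?thesis
      by (subst DERIV_cong_ev[OF refl ev refl]) simp
  qed
  have cg': "continuous_on {0<..} g'"
  proof -
    have "continuous_on {0<..} (\<lambda>r. r powr (- 3 / 2) * (- h (?l r) / 2 + h1 (?l r) / T))"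
      using T by (intro continuous_intros continuous_on_compose2[OF hc[of UNIV]] continuous_on_compose2[OF h1c[of UNIV]]) auto
    then show ?thesis
      by (rule continuous_on_cong[THEN iffD1, rotated 2]) (auto simp: g'_def)
  qed
  define u where "u = (\<lambda>z. g (nrm 3 z))"
  have C1: "C1_with 3 u (\<lambda>i z. g' (nrm 3 z) * z i / nrm 3 z)"
    unfolding u_def by (rule C1_with_radial[where a = "exp (- T)"]) (use dg cg' gz in auto)
  have uC: "u \<in> Cc1 3"
    by (rule C1_with_Cc1[OF C1, of "exp T"]) (auto simp: u_def gz)
  have gm: "g \<in> borel_measurable borel" "g' \<in> borel_measurable borel"
  proof -
    have "continuous_on {0<..} g"
      using dg by (intro continuous_at_imp_continuous_on) (auto intro: DERIV_isCont)
    then have "(\<lambda>r. indicator {0<..} r *\<^sub>R g r) \<in> borel_measurable borel"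
      by (intro borel_measurable_continuous_on_indicator) auto
    moreover have "(\<lambda>r. indicator {0<..} r *\<^sub>R g r) = g" by (auto simp: g_def indicator_def)
    ultimately show "g \<in> borel_measurable borel" by simp
    have "(\<lambda>r. indicator {0<..} r *\<^sub>R g' r) \<in> borel_measurable borel"
      using cg' by (intro borel_measurable_continuous_on_indicator) auto
    moreover have "(\<lambda>r. indicator {0<..} r *\<^sub>R g' r) = g'" by (auto simp: g'_def indicator_def)
    ultimately show "g' \<in> borel_measurable borel" by simp
  qed
  note [measurable] = gm
  define c where "c = 3 * vball 3"
  have c: "0 < c" using vball_pos[of 3] by (simp add: c_def)
  have rd: "rdens 3 r = c * r\<^sup>2" if "0 < r" for r
    using that by (simp add: rdens_def c_def)
  define I where "I = (\<integral>\<^sup>+r. ennreal ((g r)\<^sup>2) \<partial>lborel)"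
  have gsq: "(g r)\<^sup>2 = (h (?l r))\<^sup>2 / r" "r\<^sup>2 * (g' r)\<^sup>2 = (- h (?l r) / 2 + h1 (?l r) / T)\<^sup>2 / r" if r: "0 < r" for r
  proof -
    have "(r powr (- 1 / 2))\<^sup>2 = r powr (- 1)" "(r powr (- 3 / 2))\<^sup>2 = r powr (- 3)"
      using r by (auto simp: power2_eq_square simp flip: powr_add)
    then have sq: "(r powr (- 1 / 2))\<^sup>2 = 1 / r" "(r powr (- 3 / 2))\<^sup>2 = 1 / r ^ 3"
      using r by (auto simp: powr_minus_divide)
    have "(g r)\<^sup>2 = (r powr (- 1 / 2))\<^sup>2 * (h (?l r))\<^sup>2"
      using r by (simp add: g_def power_mult_distrib)
    then show "(g r)\<^sup>2 = (h (?l r))\<^sup>2 / r" by (simp only: sq) simp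
    have "r\<^sup>2 * (g' r)\<^sup>2 = r\<^sup>2 * (r powr (- 3 / 2))\<^sup>2 * (- h (?l r) / 2 + h1 (?l r) / T)\<^sup>2"
      using r by (simp add: g'_def power_mult_distrib)
    also have "r\<^sup>2 * (r powr (- 3 / 2))\<^sup>2 = 1 / r"
      unfolding sq using r by (simp add: power2_eq_square power3_eq_cube)
    finally show "r\<^sup>2 * (g' r)\<^sup>2 = (- h (?l r) / 2 + h1 (?l r) / T)\<^sup>2 / r" by simp
  qed
  have Xeq: "Hardy_mass 2 3 u = ennreal c * I"
  proof -
    have "Hardy_mass 2 3 u =
        (\<integral>\<^sup>+r. ennreal (rdens 3 r) * ennreal (\<bar>g r\<bar> powr 2 * r powr (- 2)) \<partial>lborel)"
      unfolding u_def by (rule nn_integral_radial) (auto, measurable)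
    also have "\<dots> = (\<integral>\<^sup>+r. ennreal c * ennreal ((g r)\<^sup>2) \<partial>lborel)"
    proof (rule nn_integral_cong)
      fix r :: real
      show "ennreal (rdens 3 r) * ennreal (\<bar>g r\<bar> powr 2 * r powr (- 2)) = ennreal c * ennreal ((g r)\<^sup>2)"
      proof (cases "0 < r")
        case True
        have "rdens 3 r * (\<bar>g r\<bar> powr 2 * r powr (- 2)) = c * (g r)\<^sup>2"
          using True by (simp add: rd powr_minus_divide)
        then show ?thesis using c by (simp flip: ennreal_mult)
      qed (simp add: g_def)
    qed
    also have "\<dots> = ennreal c * I" unfolding I_def by (rule nn_integral_cmult) measurable
    finally show ?thesis .
  qed
  have Ilow: "ennreal (T / 4) \<le> I"
  proof -
    have "ennreal (T / 4) = ennreal (1 / 4) * ennreal (2 * (T / 2))"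
      using T by (simp flip: ennreal_mult)
    also have "\<dots> = ennreal (1 / 4) * (\<integral>\<^sup>+r. ennreal (1 / r) * indicator {exp (- (T / 2))..exp (T / 2)} r \<partial>lborel)"
      using T by (subst nn_integral_inverse_symmetric) auto
    also have "\<dots> = (\<integral>\<^sup>+r. ennreal (1 / 4) * (ennreal (1 / r) * indicator {exp (- (T / 2))..exp (T / 2)} r) \<partial>lborel)"
      by (rule nn_integral_cmult[symmetric]) measurable
    also have "\<dots> \<le> I"
      unfolding I_def
    proof (rule nn_integral_mono)
      fix r
      show "ennreal (1 / 4) * (ennreal (1 / r) * indicator {exp (- (T / 2))..exp (T / 2)} r) \<le> ennreal ((g r)\<^sup>2)"
      proof (cases "r \<in> {exp (- (T / 2))..exp (T / 2)}")
        case True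
        then have r: "0 < r" by (metis atLeastAtMost_iff exp_gt_zero less_le_trans)
        have "- (T / 2) \<le> ln r" "ln r \<le> T / 2"
          using True r ln_le_cancel_iff[of r "exp (T / 2)"] by (auto simp: ln_ge_iff)
        then have "\<bar>ln r\<bar> \<le> T / 2" by linarith
        then have "\<bar>?l r\<bar> \<le> 1 / 2" using T by (simp add: abs_divide field_simps)
        from hhalf[OF this] have "1 / 4 \<le> (h (?l r))\<^sup>2" by simp
        then have "1 / 4 * (1 / r) \<le> (g r)\<^sup>2"
          using r unfolding gsq(1)[OF r] by (simp add: field_simps)
        then show ?thesis using True r by (simp add: ennreal_leI flip: ennreal_mult)
      qed simp
    qed
    finally show ?thesis .
  qed
  have Iup: "I \<le> ennreal (2 * T)"
  proof -
    have "I \<le> (\<integral>\<^sup>+r. ennreal (1 / r) * indicator {exp (- T)..exp T} r \<partial>lborel)"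
      unfolding I_def
    proof (rule nn_integral_mono)
      fix r
      show "ennreal ((g r)\<^sup>2) \<le> ennreal (1 / r) * indicator {exp (- T)..exp T} r"
      proof (cases "r \<in> {exp (- T)..exp T}")
        case True
        then have r: "0 < r" by (metis atLeastAtMost_iff exp_gt_zero less_le_trans)
        have "(h (?l r))\<^sup>2 \<le> 1\<^sup>2" by (intro power_mono h01)
        then have "(g r)\<^sup>2 \<le> 1 / r" unfolding gsq(1)[OF r] using r by (simp add: divide_right_mono)
        then show ?thesis using True by (simp add: ennreal_leI)
      qed (simp add: gz)
    qed
    also have "\<dots> = ennreal (2 * T)" using T by (intro nn_integral_inverse_symmetric) simp
    finally show ?thesis .
  qed
  then obtain X0 where X0: "I = ennreal X0" "0 \<le> X0" by (cases I) (auto simp: top_unique)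
  have X0low: "T / 4 \<le> X0" using Ilow X0 by simp
  have grad: "energy 2 3 (\<lambda>z i. partial i u z) \<le> ennreal (c * ((1 + 1 / T) / 4 * X0 + (1 + T) * 16 / T\<^sup>2 * (2 * T)))"
  proof -
    have "energy 2 3 (\<lambda>z i. partial i u z) = (\<integral>\<^sup>+z. ennreal ((g' (nrm 3 z))\<^sup>2) \<partial>leb 3)"
    proof (rule nn_integral_cong)
      fix z assume "z \<in> space (leb 3)"
      then have z: "z \<in> Rn 3" by simp
      have "nrm 3 (\<lambda>i. partial i u z) = nrm 3 (\<lambda>i. g' (nrm 3 z) / nrm 3 z * z i)"
        using C1_with_partial[OF C1 _ z] by (intro L2_set_cong) auto
      moreover have "(nrm 3 (\<lambda>i. s * z i))\<^sup>2 = s\<^sup>2 * (nrm 3 z)\<^sup>2" for s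
        by (simp add: L2_set_def sum_nonneg power_mult_distrib sum_distrib_left)
      ultimately have "(nrm 3 (\<lambda>i. partial i u z))\<^sup>2 = (g' (nrm 3 z) / nrm 3 z)\<^sup>2 * (nrm 3 z)\<^sup>2"
        by (simp only:)
      also have "\<dots> = (g' (nrm 3 z))\<^sup>2"
        by (cases "nrm 3 z = 0") (simp_all add: g'_def power_divide)
      finally show "ennreal (nrm 3 (\<lambda>i. partial i u z) powr 2) = ennreal ((g' (nrm 3 z))\<^sup>2)"
        by simp
    qed
    also have "\<dots> = (\<integral>\<^sup>+r. ennreal (rdens 3 r) * ennreal ((g' r)\<^sup>2) \<partial>lborel)"
      by (rule nn_integral_radial) (auto, measurable)
    also have "\<dots> \<le> (\<integral>\<^sup>+r. ennreal (c * ((1 + 1 / T) / 4)) * ennreal ((g r)\<^sup>2) +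
        ennreal (c * ((1 + T) * 16 / T\<^sup>2)) * (ennreal (1 / r) * indicator {exp (- T)..exp T} r) \<partial>lborel)"
    proof (rule nn_integral_mono)
      fix r
      show "ennreal (rdens 3 r) * ennreal ((g' r)\<^sup>2) \<le> ennreal (c * ((1 + 1 / T) / 4)) * ennreal ((g r)\<^sup>2) +
        ennreal (c * ((1 + T) * 16 / T\<^sup>2)) * (ennreal (1 / r) * indicator {exp (- T)..exp T} r)"
      proof (cases "r \<in> {exp (- T)..exp T}")
        case True
        then have r: "0 < r" by (metis atLeastAtMost_iff exp_gt_zero less_le_trans)
        \<comment> \<open>The weight \<open>1 / T\<close> keeps the main term sharp and the error term of order \<open>1 / T\<close>.\<close>
        have "(- h (?l r) / 2 + h1 (?l r) / T)\<^sup>2 \<le>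
            (1 + 1 / T) * (- h (?l r) / 2)\<^sup>2 + (1 + 1 / (1 / T)) * (h1 (?l r) / T)\<^sup>2"
          using T by (intro sq_add_le) simp
        also have "\<dots> \<le> (1 + 1 / T) * (- h (?l r) / 2)\<^sup>2 + (1 + 1 / (1 / T)) * (16 / T\<^sup>2)"
        proof (intro add_left_mono mult_left_mono)
          have "\<bar>h1 (?l r)\<bar>\<^sup>2 \<le> 4\<^sup>2" by (intro power_mono h1b) simp
          then show "(h1 (?l r) / T)\<^sup>2 \<le> 16 / T\<^sup>2"
            using T by (simp add: power_divide divide_right_mono)
        qed (use T in auto)
        also have "\<dots> = (1 + 1 / T) / 4 * (h (?l r))\<^sup>2 + (1 + T) * 16 / T\<^sup>2"
          by (simp add: power_divide)
        finally have "(- h (?l r) / 2 + h1 (?l r) / T)\<^sup>2 / r \<le> ((1 + 1 / T) / 4 * (h (?l r))\<^sup>2 + (1 + T) * 16 / T\<^sup>2) / r"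
          using r by (intro divide_right_mono) auto
        then have "r\<^sup>2 * (g' r)\<^sup>2 \<le> (1 + 1 / T) / 4 * (g r)\<^sup>2 + (1 + T) * 16 / T\<^sup>2 * (1 / r)"
          unfolding gsq[OF r] by (simp add: add_divide_distrib)
        then have "c * (r\<^sup>2 * (g' r)\<^sup>2) \<le> c * ((1 + 1 / T) / 4 * (g r)\<^sup>2 + (1 + T) * 16 / T\<^sup>2 * (1 / r))"
          using c by (intro mult_left_mono) auto
        then have "rdens 3 r * (g' r)\<^sup>2 \<le> c * ((1 + 1 / T) / 4) * (g r)\<^sup>2 + c * ((1 + T) * 16 / T\<^sup>2) * (1 / r)"
          by (simp only: rd[OF r] distrib_left mult.assoc)
        from ennreal_leI[OF this]
        have "ennreal (rdens 3 r) * ennreal ((g' r)\<^sup>2) \<le> ennreal (c * ((1 + 1 / T) / 4)) * ennreal ((g r)\<^sup>2) +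
          ennreal (c * ((1 + T) * 16 / T\<^sup>2)) * ennreal (1 / r)"
          using c T r by (subst (asm) ennreal_lincomb) (auto simp only: ennreal_mult rdens_nonneg zero_le_power2, auto)
        then show ?thesis using True by simp
      qed (simp add: gz)
    qed
    also have "\<dots> = ennreal (c * ((1 + 1 / T) / 4)) * I + ennreal (c * ((1 + T) * 16 / T\<^sup>2)) * ennreal (2 * T)"
      using T by (simp add: nn_integral_add nn_integral_cmult I_def nn_integral_inverse_symmetric)
    also have "\<dots> = ennreal (c * ((1 + 1 / T) / 4) * X0 + c * ((1 + T) * 16 / T\<^sup>2) * (2 * T))"
      unfolding X0(1) using c T X0(2) by (intro ennreal_lincomb[symmetric]) auto
    finally show ?thesis by (simp add: algebra_simps)
  qed
  have bound: "(1 + 1 / T) / 4 * X0 + (1 + T) * 16 / T\<^sup>2 * (2 * T) \<le> (1 + e) / 4 * X0"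
  proof -
    have "(1 + T) * 16 / T\<^sup>2 * (2 * T) = (1 + T) * 32 / T" using T by (simp add: power2_eq_square field_simps)
    also have "\<dots> \<le> (2 * T) * 32 / T" using T by (intro divide_right_mono mult_right_mono) auto
    also have "\<dots> = 256 / T * (T / 4)" using T by simp
    also have "\<dots> \<le> 256 / T * X0" using T X0low by (intro mult_left_mono) auto
    finally have "(1 + 1 / T) / 4 * X0 + (1 + T) * 16 / T\<^sup>2 * (2 * T) \<le> (1 + 1 / T) / 4 * X0 + 256 / T * X0" by simp
    also have "\<dots> = (1 + 1025 / T) / 4 * X0" by (simp add: field_simps)
    also have "\<dots> \<le> (1 + e) / 4 * X0" using T X0(2) by (intro mult_right_mono divide_right_mono) auto
    finally show ?thesis .
  qed
  show thesis
  proof (rule that[of u "c * X0"])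
    show "u \<in> Rad 3" by (auto simp: Rad_def u_def)
    show "0 < c * X0" using c T X0low by simp
    show "Hardy_mass 2 3 u = ennreal (c * X0)"
      using Xeq X0 c by (simp add: ennreal_mult)
    have "c * ((1 + 1 / T) / 4 * X0 + (1 + T) * 16 / T\<^sup>2 * (2 * T)) \<le> (1 + e) / 4 * (c * X0)"
      using mult_left_mono[OF bound, of c] c by (simp add: mult_ac)
    from order_trans[OF grad ennreal_leI[OF this]]
    show "energy 2 3 (\<lambda>z i. partial i u z) \<le> ennreal ((1 + e) / 4 * (c * X0))" .
  qed (rule uC)
qed

section \<open>Radial traces\<close>

lemma epowr_mono: "0 \<le> r \<Longrightarrow> x \<le> y \<Longrightarrow> epowr x r \<le> epowr y r"
  by (cases x; cases y) (auto simp: epowr_def top_unique intro!: ennreal_leI powr_mono2)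

lemma epowr_ennreal: "0 \<le> a \<Longrightarrow> epowr (ennreal a) r = ennreal (a powr r)"
  by (simp add: epowr_def)

lemma epowr_mult: "0 < a \<Longrightarrow> epowr (ennreal a * x) r = ennreal (a powr r) * epowr x r"
  by (cases x) (auto simp: epowr_def ennreal_mult_top powr_mult simp flip: ennreal_mult)

lemma ennreal_divide_le: "a \<le> k * b \<Longrightarrow> a / b \<le> (k :: ennreal)"
  by (cases "b = 0") (auto intro: divide_le_posI_ennreal simp: mult.commute zero_less_iff_neq_zero)

lemma ennreal_divide_antimono:
  fixes a b c :: ennreal
  assumes "b \<le> c"
  shows "a / c \<le> a / b"
proof -
  have "inverse c \<le> inverse b"
    using assms by (cases "b = 0"; cases b; cases c) (auto simp: inverse_ennreal top_unique intro!: ennreal_leI le_imp_inverse_le)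
  then show ?thesis unfolding divide_ennreal_def by (rule mult_left_mono) simp
qed

lemma Lnorm_AE_zero:
  assumes "AE x in leb m. f x = 0"
  shows "Lnorm q m f = 0"
proof -
  have "(\<integral>\<^sup>+x. ennreal (\<bar>f x\<bar> powr q) \<partial>leb m) = (\<integral>\<^sup>+x. 0 \<partial>leb m)"
    by (rule nn_integral_cong_AE) (use assms in eventually_elim, simp)
  then show ?thesis by (simp add: Lnorm_def epowr_def)
qed

lemma trace_AE_zero:
  assumes "1 \<le> m" "AE z in leb (m + n). u z = 0"
  shows "Lnorm q m (trace_op m n u) = 0"
proof (rule Lnorm_AE_zero)
  have "AE x in leb m. trace_op m n u x = (\<lambda>_. 0) (nrm m x)"
    by (rule trace_radial[OF assms(1) continuous_on_const]) (use assms(2) in eventually_elim, simp)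
  then show "AE x in leb m. trace_op m n u x = 0" by simp
qed

text \<open>
  For a nonzero gradient, \<open>u\<close> takes part in the supremum that defines \<^const>\<open>K\<close>.  For a zero gradient the trace must be
  zero: otherwise the left-hand side would be infinite if \<open>K m n p = 0\<close>.
\<close>

lemma trace_le_K:
  assumes mn: "1 \<le> m" and p: "1 < p" "p < real (m + n)"
    and u: "u \<in> W1 m n p" "u \<in> Rad (m + n)" and fin: "grad_norm m n p u < \<infinity>" and c: "0 < c"
  shows "Lnorm (q_of m n p) m (trace_op m n u) / (K m n p * ennreal c) \<le> grad_norm m n p u / ennreal c"
proof -
  let ?a = "Lnorm (q_of m n p) m (trace_op m n u)" and ?b = "grad_norm m n p u" and ?K = "K m n p"
  show ?thesis
  proof (cases "grad_nonzero (m + n) u")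
    case False
    then have "AE z in leb (m + n). u z = 0"
      using W1_zero_grad[OF u(1) W1_has_weak_grad[OF u(1)] p] by (simp add: grad_nonzero_def)
    then have "?a = 0" by (rule trace_AE_zero[OF mn])
    then show ?thesis by simp
  next
    case True
    then have le: "?a / ?b \<le> ?K"
      unfolding K_def using u by (intro SUP_upper2[of u]) auto
    have c': "ennreal c \<noteq> 0" "ennreal c \<noteq> top" using c by auto
    consider "?K = top" | "?K = 0" | "?K \<noteq> 0" "?K \<noteq> top" by blast
    then show ?thesis
    proof cases
      case 1
      then show ?thesis using c' by (simp add: ennreal_top_mult)
    next
      case 2
      then have "?a = 0" using le fin by (auto simp: divide_eq_0_iff)
      then show ?thesis by simp
    next
      case 3
      have "?a \<le> ?b * ?K"
      proof (cases "?b = 0")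
        case True
        then show ?thesis using le 3 by (auto simp: top_unique split: if_splits)
      next
        case False
        have "?a = ?a / ?b * ?b"
          using False fin by (simp add: ennreal_divide_times)
        also have "\<dots> \<le> ?K * ?b" by (intro mult_right_mono le) simp
        finally show ?thesis by (simp add: mult.commute)
      qed
      then have "?a / (?K * ennreal c) \<le> ?b * ?K / (ennreal c * ?K)"
        by (simp add: mult.commute divide_right_mono_ennreal)
      also have "\<dots> = ?b / ennreal c"
        using 3 by (intro divide_mult_eq) auto
      finally show ?thesis .
    qed
  qed
qed

lemma p_of_bounds:
  assumes "1 \<le> m" "1 \<le> n" "3 \<le> m + n" "1 < q"
  shows "p0 m n < p_of m n q" "p_of m n q < real (m + n)" "1 < p_of m n q" "q_of m n (p_of m n q) = q"
proof -
  let ?N = "real (m + n)" and ?m = "real m"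
  have m: "1 \<le> ?m" "?m \<le> ?N - 1" and N: "0 < ?N" using assms by auto
  have d: "0 < ?m + q" using assms m by simp
  have "?N * ?m * 1 < ?N * ?m * q"
    using assms N m by (intro mult_strict_left_mono mult_pos_pos) auto
  then have "?N * (?m + q) < ?N * q * (?m + 1)"
    by (simp add: algebra_simps)
  then have 1: "?N / (?m + 1) < p_of m n q"
    using d m unfolding p_of_def by (simp add: divide_less_eq less_divide_eq mult_ac)
  have "?m * 1 \<le> (?N - 1) * 1" using m by simp
  also have "\<dots> < (?N - 1) * q" using m assms by (intro mult_strict_left_mono) auto
  finally show 2: "1 < p_of m n q"
    using d unfolding p_of_def by (simp add: less_divide_eq algebra_simps)
  show "p0 m n < p_of m n q" using 1 2 by (simp add: p0_def)
  show 3: "p_of m n q < ?N"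
  proof -
    have "?N * q < ?N * (?m + q)" using N m by (intro mult_strict_left_mono) auto
    then show ?thesis unfolding p_of_def by (rule iffD2[OF pos_divide_less_eq[OF d]])
  qed
  have "?N - p_of m n q = ?N * ?m / (?m + q)"
    using d unfolding p_of_def by (simp add: field_simps)
  moreover have "a * (b * q / x) / (b * a / x) = q" if "0 < a" "0 < b" "0 < x" for a b x :: real
    using that by simp
  ultimately show "q_of m n (p_of m n q) = q"
    using d N m unfolding q_of_def by (simp only: p_of_def)
qed

theorem grand_trace_le:
  assumes mn: "1 \<le> m" "1 \<le> n" "3 \<le> m + n" and \<psi>: "\<psi> \<in> G\<Psi> (p0 m n) (real (m + n))"
    and u: "u \<in> radial_W m n" and fin: "grand_grad_norm m n \<psi> u < \<infinity>"
  shows "grand_trace_norm m n \<psi> u \<le> grand_grad_norm m n \<psi> u"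
  unfolding grand_trace_norm_def
proof (rule SUP_least)
  fix q :: real assume "q \<in> {1<..}"
  then have q: "1 < q" by simp
  define p where "p = p_of m n q"
  note pb = p_of_bounds[OF mn q, folded p_def]
  have pin: "p \<in> {p0 m n<..<real (m + n)}" using pb by simp
  have c: "0 < \<psi> p" using \<psi> pin by (auto simp: G\<Psi>_def)
  have le: "grad_norm m n p u / ennreal (\<psi> p) \<le> grand_grad_norm m n \<psi> u"
    unfolding grand_grad_norm_def by (rule SUP_upper[OF pin])
  have f: "grad_norm m n p u < \<infinity>"
  proof (rule ccontr)
    assume "\<not> ?thesis"
    then have "grad_norm m n p u = top"
      using top.not_eq_extremum[of "grad_norm m n p u"] by auto
    then have "grad_norm m n p u / ennreal (\<psi> p) = top" by (simp add: ennreal_top_divide)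
    with le fin show False by (simp add: top_unique)
  qed
  have "Lnorm q m (trace_op m n u) / \<zeta> m n \<psi> q = Lnorm (q_of m n p) m (trace_op m n u) / (K m n p * ennreal (\<psi> p))"
    by (simp add: \<zeta>_def pb p_def[symmetric])
  also have "\<dots> \<le> grad_norm m n p u / ennreal (\<psi> p)"
    using u pin f c pb mn by (intro trace_le_K) (auto simp: radial_W_def)
  finally show "Lnorm q m (trace_op m n u) / \<zeta> m n \<psi> q \<le> grand_grad_norm m n \<psi> u"
    using le by (rule order_trans)
qed

section \<open>The sharp trace constant for m = 1, n = 2, p = 2\<close>

text \<open>
  In polar coordinates both sides are multiples of the integral of the squared profile over the radius.  This turns
  the Hardy inequality into a trace inequality.
\<close>

lemma trace_sq_eq_Hardy_term:
  assumes g: "has_weak_grad 3 u g" and rad: "u \<in> Rad 3"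
  shows "(\<integral>\<^sup>+x. ennreal (\<bar>trace_op 1 2 u x\<bar> powr 2) \<partial>leb 1) =
    ennreal (vball 1 / (3 * vball 3)) * Hardy_mass 2 3 u"
proof -
  obtain V where V: "continuous_on {0<..} V" "AE z in leb 3. V (nrm 3 z) = u z"
    using radial_continuous_representative[OF _ g rad] by auto
  define W where "W = (\<lambda>r. indicator {0<..} r *\<^sub>R V r)"
  have [measurable]: "W \<in> borel_measurable borel"
    unfolding W_def using V(1) by (intro borel_measurable_continuous_on_indicator) auto
  have v: "0 < vball 1" "0 < vball 3" by (auto intro: vball_pos)
  let ?J = "\<integral>\<^sup>+r. ennreal ((W r)\<^sup>2) \<partial>lborel"
  have tr: "AE x in leb 1. trace_op 1 2 u x = V (nrm 1 x)"
  proof -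
    have "(1::nat) + 2 = 3" by simp
    then show ?thesis
      using trace_radial[of 1 V 2 u] V by (simp only: order_refl)
  qed
  have "(\<integral>\<^sup>+x. ennreal (\<bar>trace_op 1 2 u x\<bar> powr 2) \<partial>leb 1) = (\<integral>\<^sup>+x. ennreal ((W (nrm 1 x))\<^sup>2) \<partial>leb 1)"
  proof (rule nn_integral_cong_AE)
    show "AE x in leb 1. ennreal (\<bar>trace_op 1 2 u x\<bar> powr 2) = ennreal ((W (nrm 1 x))\<^sup>2)"
      using tr AE_nrm_neq[of 1 0, OF order_refl]
    proof eventually_elim
      case (elim x)
      then have "0 < nrm 1 x" by (simp add: less_le)
      then show ?case using elim by (simp add: W_def)
    qed
  qed
  also have "\<dots> = (\<integral>\<^sup>+r. ennreal (rdens 1 r) * ennreal ((W r)\<^sup>2) \<partial>lborel)"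
    by (rule nn_integral_radial) (auto, measurable)
  also have "\<dots> = (\<integral>\<^sup>+r. ennreal (vball 1) * ennreal ((W r)\<^sup>2) \<partial>lborel)"
    by (rule nn_integral_cong) (auto simp: rdens_def W_def indicator_def)
  also have "\<dots> = ennreal (vball 1) * ?J" by (rule nn_integral_cmult) measurable
  finally have 1: "(\<integral>\<^sup>+x. ennreal (\<bar>trace_op 1 2 u x\<bar> powr 2) \<partial>leb 1) = ennreal (vball 1) * ?J" .
  have "Hardy_mass 2 3 u =
      (\<integral>\<^sup>+z. ennreal ((W (nrm 3 z))\<^sup>2 * nrm 3 z powr (- 2)) \<partial>leb 3)"
  proof (rule nn_integral_cong_AE)
    have "AE z in leb 3. nrm 3 z \<noteq> 0" by (rule AE_nrm_neq) simp
    with V(2) show "AE z in leb 3. ennreal (\<bar>u z\<bar> powr 2 * nrm 3 z powr (- 2)) =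
        ennreal ((W (nrm 3 z))\<^sup>2 * nrm 3 z powr (- 2))"
    proof eventually_elim
      case (elim z)
      then have "0 < nrm 3 z" by (simp add: less_le)
      then show ?case using elim by (simp add: W_def)
    qed
  qed
  also have "\<dots> = (\<integral>\<^sup>+r. ennreal (rdens 3 r) * ennreal ((W r)\<^sup>2 * r powr (- 2)) \<partial>lborel)"
    by (rule nn_integral_radial) (auto, measurable)
  also have "\<dots> = (\<integral>\<^sup>+r. ennreal (3 * vball 3) * ennreal ((W r)\<^sup>2) \<partial>lborel)"
  proof (rule nn_integral_cong)
    fix r :: real
    show "ennreal (rdens 3 r) * ennreal ((W r)\<^sup>2 * r powr (- 2)) = ennreal (3 * vball 3) * ennreal ((W r)\<^sup>2)"
    proof (cases "0 < r")
      case True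
      have "rdens 3 r * ((W r)\<^sup>2 * r powr (- 2)) = 3 * vball 3 * (W r)\<^sup>2"
        using True by (simp add: rdens_def powr_minus_divide)
      then show ?thesis using v by (simp flip: ennreal_mult)
    qed (simp add: W_def)
  qed
  also have "\<dots> = ennreal (3 * vball 3) * ?J" by (rule nn_integral_cmult) measurable
  finally have 2: "Hardy_mass 2 3 u = ennreal (3 * vball 3) * ?J" .
  have "ennreal (vball 1 / (3 * vball 3)) * ennreal (3 * vball 3) = ennreal (vball 1)"
    using v by (simp flip: ennreal_mult)
  then show ?thesis unfolding 1 2 by (simp add: mult.assoc[symmetric])
qed

lemma grad_norm_1_2_2:
  assumes g: "has_weak_grad 3 u g"
  shows "grad_norm 1 2 2 u = epowr (energy 2 3 g) (1 / 2)"
proof -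
  have gm: "(\<lambda>z. g z i) \<in> borel_measurable (leb 3)" if "i < 3" for i
    by (rule weak_grad_measurable[OF g that])
  have [measurable]: "(\<lambda>z. L2_set (g z) {..<1}) \<in> borel_measurable (leb 3)"
    "(\<lambda>z. L2_set (g z) {1..<3}) \<in> borel_measurable (leb 3)"
    by (intro measurable_L2_set gm; simp)+
  have e: "(1::nat) + 2 = 3" by simp
  have "grad_norm 1 2 2 u =
    epowr ((\<integral>\<^sup>+z. ennreal (L2_set (g z) {..<1} powr 2) \<partial>leb 3) +
           (\<integral>\<^sup>+z. ennreal (L2_set (g z) {1..<3} powr 2) \<partial>leb 3)) (1 / 2)"
    using grad_norm_eq[of 1 2 u g 2, unfolded e, OF g] by simp
  also have "(\<integral>\<^sup>+z. ennreal (L2_set (g z) {..<1} powr 2) \<partial>leb 3) + (\<integral>\<^sup>+z. ennreal (L2_set (g z) {1..<3} powr 2) \<partial>leb 3) =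
      (\<integral>\<^sup>+z. ennreal (L2_set (g z) {..<1} powr 2) + ennreal (L2_set (g z) {1..<3} powr 2) \<partial>leb 3)"
    by (rule nn_integral_add[symmetric]) measurable
  also have "\<dots> = energy 2 3 g"
  proof (rule nn_integral_cong)
    fix z
    have "(\<Sum>i<3. (g z i)\<^sup>2) = (\<Sum>i<1. (g z i)\<^sup>2) + (\<Sum>i=1..<3. (g z i)\<^sup>2)"
      by (subst sum.union_disjoint[symmetric]) (auto intro!: sum.cong)
    then have "(nrm 3 (g z))\<^sup>2 = (L2_set (g z) {..<1})\<^sup>2 + (L2_set (g z) {1..<3})\<^sup>2"
      by (simp add: L2_set_def sum_nonneg add_nonneg_nonneg)
    then show "ennreal (L2_set (g z) {..<1} powr 2) + ennreal (L2_set (g z) {1..<3} powr 2) = ennreal (nrm 3 (g z) powr 2)"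
      by (simp flip: ennreal_plus)
  qed
  finally show ?thesis .
qed

text \<open>
  The number 4 is the constant \<open>(p / (N - p))\<^sup>p\<close> of the Hardy inequality for \<open>p = 2\<close>, \<open>N = 3\<close>.
\<close>

lemma K_1_2_2_le: "K 1 2 2 \<le> ennreal ((4 * (vball 1 / (3 * vball 3))) powr (1 / 2))"
  unfolding K_def
proof (rule SUP_least, rule ennreal_divide_le)
  let ?c = "vball 1 / (3 * vball 3)"
  have c: "0 < ?c" using vball_pos by simp
  have e: "(1::nat) + 2 = 3" by simp
  fix u assume "u \<in> {u \<in> W1 1 2 2 \<inter> Rad (1 + 2). grad_nonzero (1 + 2) u}"
  then have u: "u \<in> W1 1 2 2" and rad: "u \<in> Rad 3" unfolding e by auto
  define g where "g = grad 3 u"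
  have g: "has_weak_grad 3 u g"
    using W1_has_weak_grad[OF u] unfolding e g_def .
  let ?Y = "\<integral>\<^sup>+z. ennreal (nrm 3 (g z) powr 2) \<partial>leb 3"
  have H: "Hardy_mass 2 3 u \<le> ennreal 4 * ?Y"
    using Hardy_W1[OF u, of g] g unfolding e by simp
  have q: "q_of 1 2 2 = 2" by (simp add: q_of_def)
  have "Lnorm (q_of 1 2 2) 1 (trace_op 1 2 u) =
      epowr (ennreal ?c * Hardy_mass 2 3 u) (1 / 2)"
    unfolding q Lnorm_def trace_sq_eq_Hardy_term[OF g rad] ..
  also have "\<dots> \<le> epowr (ennreal ?c * (ennreal 4 * ?Y)) (1 / 2)"
    by (intro epowr_mono mult_left_mono H) auto
  also have "ennreal ?c * (ennreal 4 * ?Y) = ennreal (4 * ?c) * ?Y"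
    using c by (subst ennreal_mult) (auto simp: mult_ac)
  also have "epowr (ennreal (4 * ?c) * ?Y) (1 / 2) = ennreal ((4 * ?c) powr (1 / 2)) * epowr ?Y (1 / 2)"
    using c by (intro epowr_mult) simp
  also have "epowr ?Y (1 / 2) = grad_norm 1 2 2 u"
    by (rule grad_norm_1_2_2[OF g, symmetric])
  finally show "Lnorm (q_of 1 2 2) 1 (trace_op 1 2 u) \<le> ennreal ((4 * ?c) powr (1 / 2)) * grad_norm 1 2 2 u" .
qed

lemma Cc1_W1:
  assumes u: "u \<in> Cc1 (m + n)" and p: "0 < p"
  shows "u \<in> W1 m n p"
  unfolding W1_def
proof (intro CollectI conjI allI impI)
  note wg = Cc1_has_weak_grad[OF u]
  show "\<exists>g. has_weak_grad (m + n) u g" using wg by blast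
  fix e :: ennreal assume e: "0 < e"
  have "grad_norm m n p (\<lambda>z. u z - u z) = 0"
    unfolding grad_norm_eq[OF has_weak_grad_diff[OF wg wg] p] using p by (simp add: L2_set_def epowr_def)
  moreover have "Lnorm p (m + n) (\<lambda>z. u z - u z) = 0" by (rule Lnorm_AE_zero) simp
  ultimately show "\<exists>\<phi>\<in>Cc1 (m + n). sobolev_norm m n p (\<lambda>z. u z - \<phi> z) < e"
    using u e by (intro bexI[of _ u]) (auto simp: sobolev_norm_def)
qed

section \<open>A weight that is adapted to a given function\<close>

lemma powr_bounded_support:
  assumes f: "continuous_on (Rn N) f" "\<And>z. 0 \<le> f z" and R: "\<And>z. z \<in> Rn N \<Longrightarrow> R < nrm N z \<Longrightarrow> f z = 0"
    and p: "0 < (p::real)"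
  shows "integrable (leb N) (\<lambda>z. f z powr p)"
proof (intro integrable_bounded_support continuous_bounded_support)
  show "continuous_on (Rn N) (\<lambda>z. f z powr p)"
    using f p by (intro continuous_on_powr' continuous_intros) auto
  show "f z powr p = 0" if "z \<in> Rn N" "R < nrm N z" for z
    using R[OF that] by simp
qed

lemma continuous_on_integral_powr:
  assumes f: "continuous_on (Rn N) f" "\<And>z. 0 \<le> f z" and R: "\<And>z. z \<in> Rn N \<Longrightarrow> R < nrm N z \<Longrightarrow> f z = 0"
    and a: "0 < (a::real)"
  shows "continuous_on {a..b} (\<lambda>p. \<integral>z. f z powr p \<partial>leb N)"
proof (rule continuous_on_sequentiallyI)
  fix s p assume s: "\<forall>n. s n \<in> {a..b}" and p: "p \<in> {a..b}" and lim: "s \<longlonglongrightarrow> p"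
  have "bounded_support N f" by (rule continuous_bounded_support[OF f(1) R])
  then obtain B where B: "\<And>z. z \<in> Rn N \<Longrightarrow> \<bar>f z\<bar> \<le> B" and [measurable]: "f \<in> borel_measurable (leb N)"
    by (auto simp: bounded_support_def)
  let ?S = "{z \<in> Rn N. nrm N z \<le> R}" and ?B = "max 1 B powr b"
  show "(\<lambda>n. \<integral>z. f z powr s n \<partial>leb N) \<longlonglongrightarrow> (\<integral>z. f z powr p \<partial>leb N)"
  proof (rule integral_dominated_convergence)
    show "integrable (leb N) (\<lambda>z. ?B * indicator ?S z)"
      using emeasure_ball_finite by (intro integrable_mult_right integrable_real_indicator sets_ball) auto
    show "AE z in leb N. norm (f z powr s n) \<le> ?B * indicator ?S z" for n
    proof (rule AE_I2)
      fix z assume "z \<in> space (leb N)"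
      then have z: "z \<in> Rn N" by simp
      show "norm (f z powr s n) \<le> ?B * indicator ?S z"
      proof (cases "nrm N z \<le> R")
        case True
        have sn: "0 < s n" "s n \<le> b" using s a by (auto intro: less_le_trans)
        have "f z powr s n \<le> max 1 B powr s n"
          using f(2)[of z] B[OF z] sn by (intro powr_mono2) auto
        also have "\<dots> \<le> ?B" using sn by (intro powr_mono) auto
        finally show ?thesis using True z by simp
      qed (use R[OF z] in simp)
    qed
    show "AE z in leb N. (\<lambda>n. f z powr s n) \<longlonglongrightarrow> f z powr p"
    proof (rule AE_I2)
      fix z
      have "0 < p" using p a by auto
      then show "(\<lambda>n. f z powr s n) \<longlonglongrightarrow> f z powr p"
        using f(2)[of z] by (cases "f z = 0") (auto intro!: tendsto_powr lim)
    qed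
  qed auto
qed

text \<open>
  The gradient norm \<open>M p\<close> of \<open>u\<close> is continuous and positive on the compact interval, so \<open>\<psi>\<close> is \<open>M\<close> times a continuous
  factor that is at least 1, equals 1 at \<open>p = 2\<close> and tends to infinity at \<open>p = 3\<close>.
\<close>

lemma adapted_weight:
  assumes u: "u \<in> Cc1 3" and nz: "energy 2 3 (\<lambda>z i. partial i u z) \<noteq> 0"
  obtains \<psi> where "\<psi> \<in> G\<Psi> (3 / 2) 3" "\<And>p. p \<in> {3 / 2<..<3} \<Longrightarrow> grad_norm 1 2 p u \<le> ennreal (\<psi> p)"
    "grad_norm 1 2 2 u = ennreal (\<psi> 2)"
proof -
  define A where "A = (\<lambda>z. L2_set (\<lambda>i. partial i u z) {..<1})"
  define B where "B = (\<lambda>z. L2_set (\<lambda>i. partial i u z) {1..<3})"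
  obtain R where R: "\<And>i z. i < 3 \<Longrightarrow> z \<in> Rn 3 \<Longrightarrow> R < nrm 3 z \<Longrightarrow> partial i u z = 0"
    using Cc1_support[OF u] by metis
  have c: "continuous_on (Rn 3) (partial i u)" if "i < 3" for i
    using u that by (simp add: Cc1_def)
  have A: "continuous_on (Rn 3) A" "\<And>z. 0 \<le> A z" "\<And>z. z \<in> Rn 3 \<Longrightarrow> R < nrm 3 z \<Longrightarrow> A z = 0"
    unfolding A_def using R
    by (auto simp: L2_set_def intro!: continuous_intros c L2_set_0')
  have B: "continuous_on (Rn 3) B" "\<And>z. 0 \<le> B z" "\<And>z. z \<in> Rn 3 \<Longrightarrow> R < nrm 3 z \<Longrightarrow> B z = 0"
    unfolding B_def using R
    by (auto simp: L2_set_def sum_nonneg intro!: continuous_intros c)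
  define I where "I = (\<lambda>p. (\<integral>z. A z powr p \<partial>leb 3) + (\<integral>z. B z powr p \<partial>leb 3))"
  have int: "integrable (leb 3) (\<lambda>z. A z powr p)" "integrable (leb 3) (\<lambda>z. B z powr p)" if "0 < p" for p
    using powr_bounded_support[OF A that] powr_bounded_support[OF B that] by auto
  have Ic: "continuous_on {3 / 2..3} I"
    unfolding I_def by (intro continuous_on_add continuous_on_integral_powr[OF A] continuous_on_integral_powr[OF B]) auto
  have e: "(1::nat) + 2 = 3" by simp
  have wg: "has_weak_grad (1 + 2) u (\<lambda>z i. partial i u z)"
    unfolding e by (rule Cc1_has_weak_grad[OF u])
  have I0: "0 \<le> I p" for p unfolding I_def by (intro add_nonneg_nonneg integral_nonneg_AE) auto
  have gn: "grad_norm 1 2 p u = ennreal (I p powr (1 / p))" if "0 < p" for p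
  proof -
    have "(\<integral>\<^sup>+z. ennreal (A z powr p) \<partial>leb 3) = ennreal (\<integral>z. A z powr p \<partial>leb 3)"
      "(\<integral>\<^sup>+z. ennreal (B z powr p) \<partial>leb 3) = ennreal (\<integral>z. B z powr p \<partial>leb 3)"
      by (intro nn_integral_eq_integral int that AE_I2; simp)+
    then have "grad_norm 1 2 p u = epowr (ennreal (\<integral>z. A z powr p \<partial>leb 3) + ennreal (\<integral>z. B z powr p \<partial>leb 3)) (1 / p)"
      unfolding grad_norm_eq[OF wg that] e A_def B_def by simp
    also have "ennreal (\<integral>z. A z powr p \<partial>leb 3) + ennreal (\<integral>z. B z powr p \<partial>leb 3) = ennreal (I p)"
      unfolding I_def by (intro ennreal_plus[symmetric] integral_nonneg_AE) auto
    finally show ?thesis by (simp add: epowr_ennreal I0)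
  qed
  have Ipos: "0 < I p" if p: "0 < p" for p
  proof (rule ccontr)
    assume "\<not> 0 < I p"
    moreover have nn: "0 \<le> (\<integral>z. A z powr p \<partial>leb 3)" "0 \<le> (\<integral>z. B z powr p \<partial>leb 3)"
      by (auto intro!: integral_nonneg_AE)
    ultimately have "(\<integral>z. A z powr p \<partial>leb 3) = 0" "(\<integral>z. B z powr p \<partial>leb 3) = 0"
      unfolding I_def by linarith+
    then have "AE z in leb 3. A z powr p = 0" "AE z in leb 3. B z powr p = 0"
      using integral_nonneg_eq_0_iff_AE[OF int(1)[OF p]] integral_nonneg_eq_0_iff_AE[OF int(2)[OF p]] by auto
    then have "AE z in leb 3. ennreal (nrm 3 (\<lambda>i. partial i u z) powr 2) = 0"
    proof eventually_elim
      case (elim z)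
      then have "nrm 3 (\<lambda>i. partial i u z) \<le> 0"
        using nrm_le_blocks[where m = 1 and n = 2 and x = "\<lambda>i. partial i u z", unfolded e]
        by (simp add: A_def B_def)
      then have "nrm 3 (\<lambda>i. partial i u z) = 0"
        by (rule antisym) simp
      then show ?case by simp
    qed
    then have "energy 2 3 (\<lambda>z i. partial i u z) = (\<integral>\<^sup>+z. 0 \<partial>leb 3)"
      by (rule nn_integral_cong_AE)
    with nz show False by simp
  qed
  define M where "M = (\<lambda>p. I p powr (1 / p))"
  have Mc: "continuous_on {3 / 2..3} M"
    unfolding M_def using Ipos by (intro continuous_on_powr Ic continuous_intros) (auto simp: less_imp_neq[symmetric])
  obtain p1 where p1: "p1 \<in> {3 / 2..3}" "\<And>p. p \<in> {3 / 2..3} \<Longrightarrow> M p1 \<le> M p"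
    using continuous_attains_inf[OF compact_Icc _ Mc] by auto
  define k where "k = M p1"
  have k: "0 < k" "\<And>p. p \<in> {3 / 2..3} \<Longrightarrow> k \<le> M p"
    using p1 Ipos[of p1] by (auto simp: k_def M_def)
  define \<psi> where "\<psi> = (\<lambda>p. M p * (1 + (p - 2)\<^sup>2 / (3 - p)))"
  have ge1: "1 \<le> 1 + (p - 2)\<^sup>2 / (3 - p)" if "p < 3" for p :: real using that by simp
  have \<psi>M: "M p \<le> \<psi> p" if "p \<in> {3 / 2<..<3}" for p
    using mult_left_mono[OF ge1[of p], of "M p"] that by (simp add: \<psi>_def M_def)
  have \<psi>k: "k \<le> \<psi> p" if "p \<in> {3 / 2<..<3}" for p
    using order_trans[OF k(2)[of p] \<psi>M[OF that]] that by auto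
  have "\<psi> \<in> G\<Psi> (3 / 2) 3"
    unfolding G\<Psi>_def
  proof (intro CollectI conjI ballI)
    show "continuous_on {3 / 2<..<3} \<psi>"
      unfolding \<psi>_def by (intro continuous_intros continuous_on_subset[OF Mc]) auto
    show "0 < \<psi> p" if "p \<in> {3 / 2<..<3}" for p
      using k(1) \<psi>k[OF that] by simp
    have INF: "ereal k \<le> (INF p\<in>{3 / 2<..<3}. ereal (\<psi> p))"
      using \<psi>k by (intro INF_greatest) simp
    have "0 < ereal k" using k(1) by simp
    from less_le_trans[OF this INF] show "0 < (INF p\<in>{3 / 2<..<3}. ereal (\<psi> p))" .
    show "(SUP p\<in>{3 / 2<..<3}. ereal (\<psi> p)) = \<infinity>"
    proof (rule SUP_PInfty)
      fix n :: nat
      \<comment> \<open>At \<open>p = 3 - d\<close> the factor is at least \<open>1 / (4 d)\<close>.\<close>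
      define d where "d = min (1 / 2) (k / (4 * (real n + 1)))"
      have "0 < d" using k(1) by (simp add: d_def)
      moreover have "d \<le> 1 / 2" "d \<le> k / (4 * (real n + 1))"
        unfolding d_def by (rule min.cobounded1 min.cobounded2)+
      ultimately have d: "0 < d" "d \<le> 1 / 2" "d \<le> k / (4 * (real n + 1))" by auto
      have pin: "3 - d \<in> {3 / 2<..<3}" using d by auto
      have "d * (4 * (real n + 1)) \<le> k" using d(3) by (simp add: pos_le_divide_eq)
      then have "real n + 1 \<le> k / (4 * d)" using d(1) by (simp add: pos_le_divide_eq mult_ac)
      then have "real n \<le> k * (1 / (4 * d))" by simp
      also have "\<dots> \<le> M (3 - d) * (1 + (1 - d)\<^sup>2 / d)"
      proof (rule mult_mono)
        show "k \<le> M (3 - d)" using k(2) pin by simp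
        have "(1 / 2)\<^sup>2 \<le> (1 - d)\<^sup>2" using d by (intro power_mono) auto
        then have "(1 / 4) / d \<le> (1 - d)\<^sup>2 / d" using d by (intro divide_right_mono) (auto simp: power2_eq_square)
        then show "1 / (4 * d) \<le> 1 + (1 - d)\<^sup>2 / d" by simp
      qed (use d k k(2)[of "3 - d"] pin in \<open>auto simp: M_def\<close>)
      also have "\<dots> = \<psi> (3 - d)" by (simp add: \<psi>_def)
      finally show "\<exists>p\<in>{3 / 2<..<3}. ereal (real n) \<le> ereal (\<psi> p)"
        using pin by (intro bexI[of _ "3 - d"]) auto
    qed
  qed
  moreover have "grad_norm 1 2 p u \<le> ennreal (\<psi> p)" if "p \<in> {3 / 2<..<3}" for p
    using gn[of p] \<psi>M[OF that] that by (auto simp: M_def intro!: ennreal_leI)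
  moreover have "grad_norm 1 2 2 u = ennreal (\<psi> 2)"
    using gn[of 2] by (simp add: \<psi>_def M_def)
  ultimately show thesis by (rule that)
qed

section \<open>Sharpness\<close>

text \<open>
  With the adapted weight the norm of the gradient is at most 1, and the exponent \<open>q = 2\<close> alone gives the lower
  bound for the norm of the trace, because \<open>u\<close> nearly attains the bound for \<open>K 1 2 2\<close>.
\<close>

lemma quotient_near_one:
  assumes e: "0 < (e::real)"
  obtains \<psi> u where "\<psi> \<in> G\<Psi> (p0 1 2) (real (1 + 2))" "u \<in> radial_W 1 2" "grad_nonzero (1 + 2) u"
    "grand_grad_norm 1 2 \<psi> u < \<infinity>"
    "ennreal (1 / sqrt (1 + e)) \<le> grand_trace_norm 1 2 \<psi> u / grand_grad_norm 1 2 \<psi> u"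
proof -
  have e3: "(1::nat) + 2 = 3" and p0: "p0 1 2 = 3 / 2" by (simp_all add: p0_def)
  define c where "c = vball 1 / (3 * vball 3)"
  have c: "0 < c" using vball_pos by (simp add: c_def)
  obtain u X where u: "u \<in> Cc1 3" "u \<in> Rad 3" and X: "0 < X"
    "Hardy_mass 2 3 u = ennreal X"
    and Y: "energy 2 3 (\<lambda>z i. partial i u z) \<le> ennreal ((1 + e) / 4 * X)"
    using Hardy_near_extremal[OF e] by blast
  note wg = Cc1_has_weak_grad[OF u(1)]
  obtain Y0 where Y0: "energy 2 3 (\<lambda>z i. partial i u z) = ennreal Y0" "0 \<le> Y0"
    using Y by (cases "energy 2 3 (\<lambda>z i. partial i u z)") (auto simp: top_unique)
  have YX: "Y0 \<le> (1 + e) / 4 * X" using Y X e unfolding Y0 by simp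
  have uW: "u \<in> W1 1 2 p" if "0 < p" for p
    by (rule Cc1_W1[OF _ that]) (use u in \<open>simp only: e3\<close>)
  have "ennreal X \<le> ennreal 4 * ennreal Y0"
    using Hardy_W1[where m = 1 and n = 2 and p = 2 and u = u and g = "\<lambda>z i. partial i u z",
        unfolded e3 X(2) Y0(1), OF _ wg] uW[of 2] by simp
  also have "\<dots> = ennreal (4 * Y0)" using Y0(2) by (intro ennreal_mult[symmetric]) auto
  finally have "X \<le> 4 * Y0" using Y0(2) by (subst (asm) ennreal_le_iff) auto
  then have Ypos: "0 < Y0" using X by simp
  obtain \<psi> where \<psi>: "\<psi> \<in> G\<Psi> (3 / 2) 3" "\<And>p. p \<in> {3 / 2<..<3} \<Longrightarrow> grad_norm 1 2 p u \<le> ennreal (\<psi> p)"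
    "grad_norm 1 2 2 u = ennreal (\<psi> 2)"
    using adapted_weight[OF u(1)] Y0 Ypos by auto
  have \<psi>pos: "0 < \<psi> p" if "p \<in> {3 / 2<..<3}" for p using \<psi>(1) that by (simp add: G\<Psi>_def)
  have g2: "grad_norm 1 2 2 u = ennreal (Y0 powr (1 / 2))"
    unfolding grad_norm_1_2_2[OF wg] Y0(1) by (simp add: epowr_ennreal Y0(2))
  have \<psi>2: "\<psi> 2 = Y0 powr (1 / 2)" using g2 \<psi>(3) \<psi>pos[of 2] by simp
  have G1: "grand_grad_norm 1 2 \<psi> u \<le> 1"
    unfolding grand_grad_norm_def p0
  proof (rule SUP_least)
    fix p assume "p \<in> {3 / 2<..<real (1 + 2)}"
    then have p: "p \<in> {3 / 2<..<3}" by simp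
    have "grad_norm 1 2 p u / ennreal (\<psi> p) \<le> ennreal (\<psi> p) / ennreal (\<psi> p)"
      by (rule divide_right_mono_ennreal[OF \<psi>(2)[OF p]])
    also have "\<dots> = 1" using \<psi>pos[OF p] by simp
    finally show "grad_norm 1 2 p u / ennreal (\<psi> p) \<le> 1" .
  qed
  have tr: "Lnorm 2 1 (trace_op 1 2 u) = ennreal ((c * X) powr (1 / 2))"
  proof -
    have "Lnorm 2 1 (trace_op 1 2 u) = epowr (ennreal c * ennreal X) (1 / 2)"
      unfolding Lnorm_def trace_sq_eq_Hardy_term[OF wg u(2)] X(2) c_def ..
    also have "ennreal c * ennreal X = ennreal (c * X)" using c X by (simp add: ennreal_mult)
    also have "epowr (ennreal (c * X)) (1 / 2) = ennreal ((c * X) powr (1 / 2))"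
      using c X by (intro epowr_ennreal) simp
    finally show ?thesis .
  qed
  have "p_of 1 2 2 = 2" by (simp add: p_of_def)
  then have "\<zeta> 1 2 \<psi> 2 = K 1 2 2 * ennreal (\<psi> 2)" by (simp add: \<zeta>_def)
  also have "\<dots> \<le> ennreal ((4 * c) powr (1 / 2)) * ennreal (Y0 powr (1 / 2))"
    unfolding \<psi>2 c_def by (intro mult_right_mono K_1_2_2_le) simp
  also have "\<dots> = ennreal ((4 * c * Y0) powr (1 / 2))"
    using c Ypos by (simp add: powr_mult flip: ennreal_mult)
  finally have z: "\<zeta> 1 2 \<psi> 2 \<le> ennreal ((4 * c * Y0) powr (1 / 2))" .
  have "1 / sqrt (1 + e) \<le> (c * X) powr (1 / 2) / (4 * c * Y0) powr (1 / 2)"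
  proof -
    have "1 / (1 + e) \<le> (c * X) / (4 * c * Y0)"
      using YX e c Ypos by (simp add: divide_simps mult_ac)
    then have "(1 / (1 + e)) powr (1 / 2) \<le> ((c * X) / (4 * c * Y0)) powr (1 / 2)"
      using e by (intro powr_mono2) auto
    also have "\<dots> = (c * X) powr (1 / 2) / (4 * c * Y0) powr (1 / 2)"
      by (rule powr_divide)
    finally show ?thesis using e by (simp add: powr_half_sqrt real_sqrt_divide)
  qed
  then have "ennreal (1 / sqrt (1 + e)) \<le> ennreal ((c * X) powr (1 / 2) / (4 * c * Y0) powr (1 / 2))"
    by (rule ennreal_leI)
  also have "\<dots> = ennreal ((c * X) powr (1 / 2)) / ennreal ((4 * c * Y0) powr (1 / 2))"
    using c Ypos by (intro divide_ennreal[symmetric]) auto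
  also have "\<dots> \<le> Lnorm 2 1 (trace_op 1 2 u) / \<zeta> 1 2 \<psi> 2"
    unfolding tr by (rule ennreal_divide_antimono[OF z])
  also have "\<dots> \<le> grand_trace_norm 1 2 \<psi> u"
    unfolding grand_trace_norm_def by (rule SUP_upper2[of 2]) auto
  also have "\<dots> \<le> grand_trace_norm 1 2 \<psi> u / grand_grad_norm 1 2 \<psi> u"
    using ennreal_divide_antimono[OF G1, of "grand_trace_norm 1 2 \<psi> u"] by (simp add: divide_ennreal_def)
  finally have q: "ennreal (1 / sqrt (1 + e)) \<le> grand_trace_norm 1 2 \<psi> u / grand_grad_norm 1 2 \<psi> u" .
  show thesis
  proof (rule that[OF _ _ _ _ q])
    show "\<psi> \<in> G\<Psi> (p0 1 2) (real (1 + 2))" using \<psi>(1) unfolding p0 by simp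
    show "u \<in> radial_W 1 2" unfolding radial_W_def p0 e3 using u(2) uW by auto
    show "grand_grad_norm 1 2 \<psi> u < \<infinity>" using G1 by (rule le_less_trans) simp
    show "grad_nonzero (1 + 2) u"
      unfolding grad_nonzero_def e3
    proof
      assume "AE z in leb 3. \<forall>i<3. grad 3 u z i = 0"
      moreover have "AE z in leb 3. \<forall>i<3. grad 3 u z i = partial i u z"
        by (rule has_weak_grad_unique[OF has_weak_grad_grad[OF wg] wg])
      ultimately have "AE z in leb 3. ennreal (nrm 3 (\<lambda>i. partial i u z) powr 2) = 0"
        by eventually_elim (simp add: L2_set_0')
      then have "energy 2 3 (\<lambda>z i. partial i u z) = (\<integral>\<^sup>+z. 0 \<partial>leb 3)"
        by (rule nn_integral_cong_AE)
      then show False using Y0 Ypos by simp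
    qed
  qed
qed

theorem theorem2:
  shows "(\<forall>m n. 1 \<le> m \<and> 1 \<le> n \<and> 3 \<le> m + n \<longrightarrow>
            (\<forall>\<psi> \<in> G\<Psi> (p0 m n) (real (m + n)). \<forall>u \<in> radial_W m n.
               grand_grad_norm m n \<psi> u < \<infinity> \<longrightarrow>
               grand_trace_norm m n \<psi> u \<le> 1 * grand_grad_norm m n \<psi> u)) \<and>
         (SUP (m, n) \<in> {(m, n). 1 \<le> m \<and> 1 \<le> n \<and> 3 \<le> m + n}.
            SUP \<psi> \<in> G\<Psi> (p0 m n) (real (m + n)).
              SUP u \<in> {u \<in> radial_W m n. grad_nonzero (m + n) u \<and> grand_grad_norm m n \<psi> u < \<infinity>}.
                grand_trace_norm m n \<psi> u / grand_grad_norm m n \<psi> u) = 1"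
    (is "?ineq \<and> ?S = 1")
proof
  show ?ineq using grand_trace_le by simp
  show "?S = 1"
  proof (rule antisym)
    show "?S \<le> 1"
    proof (rule SUP_least)
      fix mn :: "nat \<times> nat"
      assume mn: "mn \<in> {(m, n). 1 \<le> m \<and> 1 \<le> n \<and> 3 \<le> m + n}"
      obtain m n where mn_eq: "mn = (m, n)" by (cases mn)
      show "(case mn of (m, n) \<Rightarrow> SUP \<psi> \<in> G\<Psi> (p0 m n) (real (m + n)).
              SUP u \<in> {u \<in> radial_W m n. grad_nonzero (m + n) u \<and> grand_grad_norm m n \<psi> u < \<infinity>}.
                grand_trace_norm m n \<psi> u / grand_grad_norm m n \<psi> u) \<le> 1"
        unfolding mn_eq prod.case
      proof (intro SUP_least ennreal_divide_le)
        fix \<psi> u assume "\<psi> \<in> G\<Psi> (p0 m n) (real (m + n))"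
          "u \<in> {u \<in> radial_W m n. grad_nonzero (m + n) u \<and> grand_grad_norm m n \<psi> u < \<infinity>}"
        then show "grand_trace_norm m n \<psi> u \<le> 1 * grand_grad_norm m n \<psi> u"
          using grand_trace_le[of m n \<psi> u] mn mn_eq by simp
      qed
    qed
    show "1 \<le> ?S"
    proof (rule dense_le)
      fix y :: ennreal assume y: "y < 1"
      then obtain r where r: "y = ennreal r" "0 \<le> r" "r < 1"
        by (cases y) (auto simp: ennreal_less_one_iff)
      define s where "s = max r (1 / 2)"
      have s: "0 < s" "s < 1" "r \<le> s" using r by (auto simp: s_def)
      define e where "e = 1 / s\<^sup>2 - 1"
      have "s\<^sup>2 < 1" using s by (simp add: power_less_one_iff)
      then have e: "0 < e" using s by (simp add: e_def)
      have "1 / sqrt (1 + e) = s" using s by (simp add: e_def real_sqrt_divide)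
      moreover obtain \<psi> u where \<psi>: "\<psi> \<in> G\<Psi> (p0 1 2) (real (1 + 2))" and
        u: "u \<in> radial_W 1 2" "grad_nonzero (1 + 2) u" "grand_grad_norm 1 2 \<psi> u < \<infinity>"
        and q: "ennreal (1 / sqrt (1 + e)) \<le> grand_trace_norm 1 2 \<psi> u / grand_grad_norm 1 2 \<psi> u"
        using quotient_near_one[OF e] by blast
      ultimately have "y \<le> grand_trace_norm 1 2 \<psi> u / grand_grad_norm 1 2 \<psi> u"
        using s r by (auto intro: order_trans[OF ennreal_leI])
      also have "\<dots> \<le> (SUP u \<in> {u \<in> radial_W 1 2. grad_nonzero (1 + 2) u \<and> grand_grad_norm 1 2 \<psi> u < \<infinity>}.
          grand_trace_norm 1 2 \<psi> u / grand_grad_norm 1 2 \<psi> u)"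
        using u by (intro SUP_upper) simp
      also have "\<dots> \<le> (SUP \<psi> \<in> G\<Psi> (p0 1 2) (real (1 + 2)).
          SUP u \<in> {u \<in> radial_W 1 2. grad_nonzero (1 + 2) u \<and> grand_grad_norm 1 2 \<psi> u < \<infinity>}.
          grand_trace_norm 1 2 \<psi> u / grand_grad_norm 1 2 \<psi> u)"
        by (rule SUP_upper[OF \<psi>])
      also have "\<dots> \<le> ?S"
        by (rule SUP_upper2[of "(1, 2)"]) (simp, simp only: prod.case order_refl)
      finally show "y \<le> ?S" .
    qed
  qed
qed

end
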